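(* Let $\delta>0$ be a fixed small constant and $B>0$ a constant. There are constants $c_1,c_2,C,C_{B,\delta}>0$ depending only on $\delta$ and $B$ such that the following holds. Let $H_N$ be a deterministic nonzero positive semi-definite $N\times N$ real symmetric (resp. complex Hermitian) matrix, and let $P_N$ be a deterministic $N\times N$ real symmetric (resp. complex Hermitian) matrix of rank $M=o(N)$ all of whose eigenvalues are larger than $-1$, with $\|H_N\|\le B$ and $\|P_N\|\le B$. Let the nonzero eigenvalues of $P_N$ be $\theta_1\ge\dots\ge\theta_{M_1}>0>\theta_{M_1+1}\ge\dots\ge\theta_M$, and put $\tilde P_M=\mathrm{diag}(\theta_1,\dots,\theta_M)$. Let $U$ be a Haar-distributed $N\times N$ orthogonal (resp. unitary) matrix, let $$\tilde W_N=(I_N+P_N)^{1/2}U^*H_NU(I_N+P_N)^{1/2},$$ and denote its eigenvalues by $\lambda_1(\tilde W_N)\ge\dots\ge\lambda_N(\tilde W_N)$. Let $1\le i\le M$ be such that $$T_N^{-1}\Big(\frac1{\theta_i}\Big)\ge\lambda_1(H_N)+2\delta\ \text{ if }\theta_i>0,\qquad T_N^{-1}\Big(\frac1{\theta_i}\Big)\le\lambda_N(H_N)-2\delta\ \text{ if }\theta_i<0 .$$ Set $\tilde\lambda_i=\lambda_i(\tilde W_N)$ if $\theta_i>0$ and $\tilde\lambda_i=\lambda_{N-M+i}(\tilde W_N)$ if $\theta_i<0$. Let $v_i$ be a unit eigenvector of $\tilde W_N$ for the eigenvalue $\tilde\lambda_i$ (any one, if $\tilde\lambda_i$ is not simple),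 and let $\tilde v_i$ be the projection of $v_i$ onto the span of the eigenvectors of $P_N$ with nonzero eigenvalues, written in coordinates as a vector of length $M$ (see context). Then for any $0<\epsilon\le\delta$ ($\epsilon$ may depend on $M$ and $N$), with probability at least $1-Ce^{-c_1N\epsilon^2+c_2M}$, both of the following hold: (1) $$\left|\,\|\tilde v_i\|^2+\frac{\theta_i+1}{\theta_i^2\,T_N^{-1}(\frac1{\theta_i})\,T_N'\big(T_N^{-1}(\frac1{\theta_i})\big)}\right|\le\epsilon\, C_{B,\delta};$$ (2) $$\left\|\tilde P_M\tilde v_i-\theta_i\tilde v_i\right\|\le\epsilon\, C_{B,\delta}.$$
   Context: $\|\cdot\|$ is the operator norm for matrices and the Euclidean norm for vectors. The ordered eigenvalues of $H_N$ are $\lambda_1(H_N)\ge\dots\ge\lambda_N(H_N)\ge0$. The T-transform of the empirical eigenvalue distribution of $H_N$ is $$T_N(z)=\frac1N\sum_{k=1}^N\frac{\lambda_k(H_N)}{z-\lambda_k(H_N)},\qquad z\in(-\infty,\lambda_N(H_N))\cup(\lambda_1(H_N),\infty).$$ It is strictly decreasing on each of the two intervals, $T_N'$ is its derivative, and $T_N^{-1}$ denotes its inverse, mapping $(0,\infty)$ onto $(\lambda_1(H_N),\infty)$ and $(-\infty,0)$ onto $(-\infty,\lambda_N(H_N))$ (for negative arguments this requires $\lambda_N(H_N)>0$; for $\theta_i<0$ the separation condition is understood to include that $1/\theta_i$ lies in the range of $T_N$ on $(-\infty,\lambda_N(H_N))$). Coordinates for $\tilde v_i$: fix a deterministic $N\times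 M$ matrix $V$ whose $j$-th column is a unit eigenvector of $P_N$ for $\theta_j$, with orthonormal columns, so that $P_N=V\tilde P_MV^*$; then $\tilde v_i=V^*v_i$. (If $P_N=\mathrm{diag}(\theta_1,\dots,\theta_M,0,\dots,0)$, then $\tilde v_i$ consists of the first $M$ coordinates of $v_i$.) The rank $M=M(N)$ may grow with $N$; the assumption $M=o(N)$ refers to the sequence $N\to\infty$, and the constants do not depend on $N$, $M$, $\epsilon$, $i$ or on the matrices. *)

theory Defs
  imports
    "HOL-Library.Landau_Symbols"
    "HOL-Analysis.Derivative"
    "HOL-Probability.Probability_Measure"
    "Jordan_Normal_Form.Char_Poly"
    "Jordan_Normal_Form.Schur_Decomposition"
    "Jordan_Normal_Form.DL_Rank"
begin

text \<open>
  The dimension \<open>N\<close> is a number quantified inside the statement, hence matrices with explicit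
  carriers. All notions are polymorphic in the scalars and are used for \<^typ>\<open>real\<close> and
  \<^typ>\<open>complex\<close> only. On \<^typ>\<open>real\<close>, \<^const>\<open>conjugate\<close> is the identity, so that
  \<^const>\<open>mat_adjoint\<close> is the transpose, Hermitian means symmetric and unitary means orthogonal.
\<close>

definition vnorm :: "'a::real_normed_field vec \<Rightarrow> real" where
  "vnorm v = sqrt (\<Sum>i<dim_vec v. (norm (vec_index v i))\<^sup>2)"

definition opnorm :: "'a::real_normed_field mat \<Rightarrow> real" where
  "opnorm A = Sup {vnorm (A *\<^sub>v x) |x. x \<in> carrier_vec (dim_col A) \<and> vnorm x \<le> 1}"

definition hermitian :: "nat \<Rightarrow> 'a::conjugatable_field mat \<Rightarrow> bool" where
  "hermitian N A \<longleftrightarrow> A \<in> carrier_mat N N \<and> mat_adjoint A = A"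

text \<open>
  On \<^typ>\<open>complex\<close>, \<open>0 \<le> x\<close> says that \<open>x\<close> is a nonnegative real number.
\<close>

definition psd :: "nat \<Rightarrow> 'a::conjugatable_ordered_field mat \<Rightarrow> bool" where
  "psd N A \<longleftrightarrow> hermitian N A \<and> (\<forall>x\<in>carrier_vec N. 0 \<le> (A *\<^sub>v x) \<bullet>c x)"

definition mat_sqrt :: "'a::conjugatable_ordered_field mat \<Rightarrow> 'a mat" where
  "mat_sqrt A = (THE S. psd (dim_row A) S \<and> S * S = A)"

text \<open>
  The eigenvalues of a Hermitian matrix with multiplicity, in decreasing order; the list exists by
  the spectral theorem and is unique because the characteristic polynomial determines its roots.
  In \<open>eigval A k\<close> and \<open>nz_eigval A j\<close> (nonzero eigenvalues only) the count starts at 1.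
\<close>

definition eigvals :: "'a::{conjugatable_ordered_field,real_normed_field} mat \<Rightarrow> real list" where
  "eigvals A = (THE ls. sorted_wrt (\<ge>) ls \<and> char_poly A = (\<Prod>a\<leftarrow>ls. [:- of_real a, 1:]))"

definition eigval :: "'a::{conjugatable_ordered_field,real_normed_field} mat \<Rightarrow> nat \<Rightarrow> real" where
  "eigval A k = eigvals A ! (k - 1)"

definition nz_eigval :: "'a::{conjugatable_ordered_field,real_normed_field} mat \<Rightarrow> nat \<Rightarrow> real" where
  "nz_eigval A j = filter (\<lambda>x. x \<noteq> 0) (eigvals A) ! (j - 1)"

definition T_transform ::
    "'a::{conjugatable_ordered_field,real_normed_field} mat \<Rightarrow> real \<Rightarrow> real" where
  "T_transform H z =
     1 / real (dim_row H) * (\<Sum>k=1..dim_row H. eigval H k / (z - eigval H k))"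

definition T_inverse ::
    "'a::{conjugatable_ordered_field,real_normed_field} mat \<Rightarrow> real \<Rightarrow> real" where
  "T_inverse H y =
     (if 0 < y then the_inv_into {eigval H 1 <..} (T_transform H) y
      else the_inv_into {..< eigval H (dim_row H)} (T_transform H) y)"

text \<open>
  For \<open>\<theta> < 0\<close> the inverse is meaningful only if \<open>1/\<theta>\<close> is in the range of the T-transform to the
  left of the spectrum, so this is part of the condition; for \<open>\<theta> > 0\<close> and a nonzero positive
  semi-definite \<open>H\<close> the range to the right of the spectrum is all of \<open>(0,\<infinity>)\<close>.
\<close>

definition separated ::
    "real \<Rightarrow> 'a::{conjugatable_ordered_field,real_normed_field} mat \<Rightarrow> real \<Rightarrow> bool" where
  "separated \<delta> H \<theta> \<longleftrightarrow>
     (0 < \<theta> \<longrightarrow> T_inverse H (1 / \<theta>) \<ge> eigval H 1 + 2 * \<delta>) \<and>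
     (\<theta> < 0 \<longrightarrow> 1 / \<theta> \<in> T_transform H ` {..< eigval H (dim_row H)} \<and>
               T_inverse H (1 / \<theta>) \<le> eigval H (dim_row H) - 2 * \<delta>)"

definition admissible ::
    "real \<Rightarrow> nat \<Rightarrow> nat \<Rightarrow> 'a::{conjugatable_ordered_field,real_normed_field} mat \<Rightarrow> 'a mat \<Rightarrow> bool" where
  "admissible B N M H P \<longleftrightarrow>
     psd N H \<and> H \<noteq> 0\<^sub>m N N \<and> opnorm H \<le> B \<and>
     hermitian N P \<and> vec_space.rank N P = M \<and> opnorm P \<le> B \<and>
     (\<forall>x. eigenvalue P (of_real x) \<longrightarrow> x > - 1)"

text \<open>
  The columns of \<open>V\<close> are orthonormal eigenvectors for the nonzero eigenvalues of \<open>P\<close>.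
\<close>

definition nz_eigenbasis ::
    "nat \<Rightarrow> nat \<Rightarrow> 'a::{conjugatable_ordered_field,real_normed_field} mat \<Rightarrow> 'a mat \<Rightarrow> bool" where
  "nz_eigenbasis N M P V \<longleftrightarrow>
     V \<in> carrier_mat N M \<and> mat_adjoint V * V = 1\<^sub>m M \<and>
     (\<forall>j\<in>{1..M}. eigenvector P (col V (j - 1)) (of_real (nz_eigval P j)))"

definition nz_diag ::
    "nat \<Rightarrow> 'a::{conjugatable_ordered_field,real_normed_field} mat \<Rightarrow> 'a mat" where
  "nz_diag M P = mat_diag M (\<lambda>j. of_real (nz_eigval P (j + 1)))"

definition unitary_group :: "nat \<Rightarrow> 'a::conjugatable_field mat set" where
  "unitary_group N = {U \<in> carrier_mat N N. mat_adjoint U * U = 1\<^sub>m N}"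

text \<open>
  The Borel sets of the group are generated by the matrix entries. The group is compact, so a
  left invariant probability measure is the (two-sided) Haar measure.
\<close>

definition unitary_borel :: "nat \<Rightarrow> 'a::{conjugatable_field,real_normed_field} mat measure" where
  "unitary_borel N =
     vimage_algebra (unitary_group N) (\<lambda>U. \<lambda>ij\<in>{..<N} \<times> {..<N}. U $$ ij)
       (\<Pi>\<^sub>M ij\<in>{..<N} \<times> {..<N}. borel)"

definition haar :: "nat \<Rightarrow> 'a::{conjugatable_field,real_normed_field} mat measure \<Rightarrow> bool" where
  "haar N \<mu> \<longleftrightarrow>
     prob_space \<mu> \<and> sets \<mu> = sets (unitary_borel N) \<and>
     (\<forall>Q\<in>unitary_group N. distr \<mu> \<mu> (\<lambda>U. Q * U) = \<mu>)"

definition W_mat :: "'a::conjugatable_ordered_field mat \<Rightarrow> 'a mat \<Rightarrow> 'a mat \<Rightarrow> 'a mat" where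
  "W_mat H P U =
     (let R = mat_sqrt (1\<^sub>m (dim_row P) + P) in R * mat_adjoint U * H * U * R)"

definition outlier ::
    "nat \<Rightarrow> 'a::{conjugatable_ordered_field,real_normed_field} mat \<Rightarrow> 'a mat \<Rightarrow> 'a mat \<Rightarrow> nat \<Rightarrow> real" where
  "outlier M H P U i =
     (if 0 < nz_eigval P i then eigval (W_mat H P U) i
      else eigval (W_mat H P U) (dim_row P - M + i))"

end

theory Submission
  imports Defs "HOL-Library.Poly_Mapping" "HOL-Probability.Probability"
begin

text \<open>
  Write \<open>A = U\<^sup>*HU\<close>, \<open>X = (z - A)\<inverse>\<close> with \<open>z = T\<inverse>(1/\<theta>\<^sub>i)\<close>, and let \<open>V\<close> be the isometry onto the range
  of \<open>P\<close>. By invariance of the Haar measure the quadratic forms \<open>U \<mapsto> \<langle>a, Xa\<rangle>\<close> and \<open>U \<mapsto> \<langle>a, X\<^sup>2a\<rangle>\<close> have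
  sub-Gaussian exponential moments, so a net of \<open>exp (O(M))\<close> points in the unit ball of the range
  of \<open>P\<close> shows that \<open>V\<^sup>*XV\<close> and \<open>V\<^sup>*X\<^sup>2V\<close> are \<open>\<epsilon>\<close>-close to multiples \<open>g\<close> and \<open>g\<^sub>2\<close> of the identity
  outside an event of probability \<open>O(exp (- c\<^sub>1N\<epsilon>\<^sup>2 + c\<^sub>2M))\<close>. Everything else is deterministic, and only
  this single value of \<open>z\<close> is needed. First, the Schur complement \<open>(V\<^sup>*XV)\<inverse>\<close> of \<open>z - A\<close> is close to
  \<open>1/g\<close>, so that the forms of \<open>A\<close> and \<open>z - VV\<^sup>*/g\<close> differ, up to \<open>O(\<epsilon>)\<close>, by a form of definite sign
  that vanishes on the vectors \<open>XVc\<close>; hence the min-max principle places the eigenvalue in question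
  within \<open>O(\<epsilon>)\<close> of \<open>z\<close>. Second, the components of the
  eigenvalue equation along and across the range of \<open>P\<close> then determine both \<open>P\<close> on the projected
  eigenvector and the norm of the latter, up to \<open>O(\<epsilon>)\<close>.
\<close>

section \<open>Scalars and vectors\<close>

text \<open>One value of \<open>z\<close> suffices because of an identity. If \<open>g\<close> is
  the mean of \<open>1 / (z - ls k)\<close>, then \<open>T z = 1 / t\<close> gives
  \<open>z * g = 1 + T z = (1 + t) / t\<close>, so \<open>s = z - 1 / g\<close> equals
  \<open>z / (1 + t)\<close>. With the Schur complement replaced by the scalar \<open>1 / g\<close>,
  the comparison form for \<open>W - z\<close> is a sum of squared coordinates with the coefficients
  \<open>s * (1 + \<theta> j) - z = s * (\<theta> j - t)\<close>, and \<open>s\<close> is positive: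
  every other spike is compared with \<open>t\<close> by its sign alone. The obstacle is that
  nothing separates the spikes from each other. They may coincide or be arbitrarily close, so
  eigenvectors cannot be followed by perturbation theory. The second step therefore takes any unit
  vector that solves the eigenvalue equation for an eigenvalue near \<open>z\<close>. The second
  mean \<open>g2\<close> enters through the norm of the eigenvector, since the squared norm of
  \<open>X V c\<close> is a form of the square of \<open>X\<close>. A single constant
  \<open>K\<close> bounds all scalars and the inverses that occur, so each error is \<epsilon> times
  a power of \<open>K\<close>. Concentration is applied with a fixed fraction of \<epsilon>, small
  enough for the compression of \<open>X\<close> to stay invertible.\<close>

class rc_field = conjugatable_ordered_field + real_normed_field + euclidean_space +
  assumes inner_mult_left_conjugate: "inner (a * x) y = inner x (conjugate a * y)"
    and mult_conjugate_norm: "conjugate a * a = (norm a)\<^sup>2 *\<^sub>R 1"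
    and inner_one_nonneg: "0 \<le> a \<Longrightarrow> 0 \<le> inner a 1"

text \<open>The class ties the real inner product of the scalars to their algebra: multiplication by
  \<open>a\<close> has multiplication by \<open>conjugate a\<close> as its adjoint, and a scalar
  that is nonnegative in the Hermitian order has nonnegative real part \<open>inner a 1\<close>. The
  real coordinates of a scalar, one or two, are supplied by \<open>Basis\<close>.\<close>

instance real :: rc_field
  by standard (auto simp: power2_eq_square)

instance complex :: rc_field
proof
  fix a x y :: complex
  show "inner (a * x) y = inner x (conjugate a * y)"
    by (simp add: inner_complex_def algebra_simps)
  show "conjugate a * a = (norm a)\<^sup>2 *\<^sub>R 1"
    using cmod_power2[of a] by (simp add: complex_eq_iff power2_eq_square)
  show "0 \<le> a \<Longrightarrow> 0 \<le> inner a 1"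
    by (simp add: inner_complex_def less_eq_complex_def)
qed

text \<open>
  Since the dimension is not a type, the vectors of all dimensions are embedded into the inner product
  space of finitely supported sequences, where \<open>fspace n\<close> below is the copy of the \<open>n\<close>-dimensional
  space. The inner product is the real part of the Hermitian one, so that the library results on
  \<^class>\<open>real_inner\<close> apply to both kinds of scalars; the Hermitian one is \<open>cdot\<close>.
\<close>

instantiation poly_mapping :: (type, rc_field) real_vector
begin

lift_definition scaleR_poly_mapping :: "real \<Rightarrow> ('a \<Rightarrow>\<^sub>0 'b) \<Rightarrow> 'a \<Rightarrow>\<^sub>0 'b"
  is "\<lambda>r f k. r *\<^sub>R f k"
  by (rule finite_subset) auto

instance
  by standard (transfer; auto simp: scaleR_add_right scaleR_add_left fun_eq_iff)+

end

instantiation poly_mapping :: (type, rc_field) real_inner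
begin

definition inner_poly_mapping :: "('a \<Rightarrow>\<^sub>0 'b) \<Rightarrow> ('a \<Rightarrow>\<^sub>0 'b) \<Rightarrow> real" where
  "inner_poly_mapping f g = (\<Sum>k\<in>Poly_Mapping.keys f. inner (Poly_Mapping.lookup f k) (Poly_Mapping.lookup g k))"

definition norm_poly_mapping :: "('a \<Rightarrow>\<^sub>0 'b) \<Rightarrow> real" where
  "norm_poly_mapping f = sqrt (inner f f)"

definition dist_poly_mapping :: "('a \<Rightarrow>\<^sub>0 'b) \<Rightarrow> ('a \<Rightarrow>\<^sub>0 'b) \<Rightarrow> real" where
  "dist_poly_mapping f g = norm (f - g)"

definition sgn_poly_mapping :: "('a \<Rightarrow>\<^sub>0 'b) \<Rightarrow> 'a \<Rightarrow>\<^sub>0 'b" where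
  "sgn_poly_mapping f = f /\<^sub>R norm f"

definition uniformity_poly_mapping :: "(('a \<Rightarrow>\<^sub>0 'b) \<times> ('a \<Rightarrow>\<^sub>0 'b)) filter" where
  "uniformity_poly_mapping = (INF e\<in>{0 <..}. principal {(x, y). dist x y < e})"

definition open_poly_mapping :: "('a \<Rightarrow>\<^sub>0 'b) set \<Rightarrow> bool" where
  "open_poly_mapping U \<longleftrightarrow> (\<forall>x\<in>U. eventually (\<lambda>(x', y). x' = x \<longrightarrow> y \<in> U) uniformity)"

instance
proof
  \<comment> \<open>The defining sum runs over the support of the first argument only. Over a common
    finite set of indices, symmetry and additivity become termwise.\<close>
  have inner_sup: "inner f g = (\<Sum>k\<in>S. inner (Poly_Mapping.lookup f k) (Poly_Mapping.lookup g k))"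
    if "finite S" "Poly_Mapping.keys f \<subseteq> S" for f g :: "'a \<Rightarrow>\<^sub>0 'b" and S
    unfolding inner_poly_mapping_def
    by (rule sum.mono_neutral_left) (use that in \<open>simp_all add: in_keys_iff\<close>)
  fix x y z :: "'a \<Rightarrow>\<^sub>0 'b" and a b :: real and U :: "('a \<Rightarrow>\<^sub>0 'b) set"
  show "dist x y = norm (x - y)" by (rule dist_poly_mapping_def)
  show "sgn x = x /\<^sub>R norm x" by (rule sgn_poly_mapping_def)
  show "uniformity = (INF e\<in>{0<..}. principal {(x :: 'a \<Rightarrow>\<^sub>0 'b, y). dist x y < e})"
    by (rule uniformity_poly_mapping_def)
  show "open U = (\<forall>x\<in>U. \<forall>\<^sub>F (x', y) in uniformity. x' = x \<longrightarrow> y \<in> U)"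
    by (rule open_poly_mapping_def)
  show "norm x = sqrt (inner x x)" by (rule norm_poly_mapping_def)
  define S where "S = Poly_Mapping.keys x \<union> Poly_Mapping.keys y \<union> Poly_Mapping.keys z
    \<union> Poly_Mapping.keys (x + y) \<union> Poly_Mapping.keys (a *\<^sub>R x)"
  have "finite S" by (simp only: S_def finite_Un finite_keys)
  note s = inner_sup[OF this]
  have sub: "Poly_Mapping.keys x \<subseteq> S" "Poly_Mapping.keys y \<subseteq> S" "Poly_Mapping.keys z \<subseteq> S"
    "Poly_Mapping.keys (x + y) \<subseteq> S" "Poly_Mapping.keys (a *\<^sub>R x) \<subseteq> S"
    unfolding S_def by blast+
  show "inner x y = inner y x"
    by (simp only: s[OF sub(1)] s[OF sub(2)] inner_commute)
  show "inner (x + y) z = inner x z + inner y z"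
    by (simp only: s[OF sub(1)] s[OF sub(2)] s[OF sub(4)] lookup_add inner_add_left sum.distrib)
  show "inner (a *\<^sub>R x) y = a * inner x y"
    by (simp only: s[OF sub(1)] s[OF sub(5)] scaleR_poly_mapping.rep_eq inner_scaleR_left sum_distrib_left)
  show "0 \<le> inner x x" by (simp only: inner_poly_mapping_def) (simp only: sum_nonneg inner_ge_zero)
  show "(inner x x = 0) = (x = 0)"
  proof
    assume "inner x x = 0"
    then have "(\<Sum>k\<in>Poly_Mapping.keys x. inner (Poly_Mapping.lookup x k) (Poly_Mapping.lookup x k)) = 0"
      by (simp only: inner_poly_mapping_def)
    then have "\<forall>k\<in>Poly_Mapping.keys x. inner (Poly_Mapping.lookup x k) (Poly_Mapping.lookup x k) = 0"
      by (subst (asm) sum_nonneg_eq_0_iff) (simp_all only: finite_keys inner_ge_zero)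
    then have "Poly_Mapping.lookup x k = 0" for k
      by (cases "k \<in> Poly_Mapping.keys x") (simp_all add: in_keys_iff)
    then show "x = 0" by (intro poly_mapping_eqI) simp
  next
    assume "x = 0"
    then show "inner x x = 0" by (simp only: inner_poly_mapping_def keys_zero sum.empty)
  qed
qed

end

text \<open>Multiplication by a real number is self-adjoint for the real inner product, so the
  conjugate acts in the same way; testing the difference of the two against itself makes it
  vanish.\<close>

lemma conjugate_of_real [simp]: "conjugate (of_real r :: 'a::rc_field) = of_real r"
proof -
  have "inner x (conjugate (of_real r) * y) = inner x (of_real r * y)" for x y :: 'a
    using inner_mult_left_conjugate[of "of_real r" x y]
    by (simp add: scaleR_conv_of_real[symmetric])
  from this[of "conjugate (of_real r) * 1 - of_real r * 1" 1]
  have "inner (conjugate (of_real r) - of_real r :: 'a) (conjugate (of_real r) - of_real r) = 0"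
    by (simp add: inner_diff_right)
  then show ?thesis by simp
qed

lemma conjugate_scaleR [simp]: "conjugate (r *\<^sub>R x) = r *\<^sub>R conjugate (x :: 'a::rc_field)"
  by (simp add: scaleR_conv_of_real conjugate_dist_mul)

lemma conjugate_one [simp]: "conjugate (1 :: 'a::rc_field) = 1"
  using conjugate_of_real[of 1, where ?'a = 'a] by simp

lemma inner_mult_right_conjugate:
  fixes a :: "'a::rc_field"
  shows "inner x (a * y) = inner (conjugate a * x) y"
  using inner_mult_left_conjugate[of "conjugate a" x y] by simp

lemma inner_one_conjugate: "inner x y = inner (conjugate y * x) (1 :: 'a::rc_field)"
  using inner_mult_right_conjugate[of x y 1] by simp

type_synonym 'a fvec = "nat \<Rightarrow>\<^sub>0 'a"

abbreviation coord :: "'a::rc_field fvec \<Rightarrow> nat \<Rightarrow> 'a" where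
  "coord \<equiv> Poly_Mapping.lookup"

definition fvec :: "nat \<Rightarrow> (nat \<Rightarrow> 'a) \<Rightarrow> 'a::rc_field fvec" where
  "fvec N f = (\<Sum>k<N. Poly_Mapping.single k (f k))"

definition fspace :: "nat \<Rightarrow> 'a::rc_field fvec set" where
  "fspace N = {x. \<forall>k\<ge>N. coord x k = 0}"

lemma coord_sum [simp]: "coord (sum f S) k = (\<Sum>i\<in>S. coord (f i) k)"
  by (induction S rule: infinite_finite_induct) (auto simp: lookup_add)

lemma coord_fvec [simp]: "coord (fvec N f) k = (if k < N then f k else 0)"
proof -
  have "(\<Sum>i<N. f i when i = k) = (\<Sum>i<N. if i = k then f i else 0)"
    by (rule sum.cong) (auto simp: when_def)
  then show ?thesis by (simp add: fvec_def lookup_single)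
qed

lemma coord_scaleR [simp]: "coord (r *\<^sub>R x) k = r *\<^sub>R coord x k"
  by (simp add: scaleR_poly_mapping.rep_eq)

lemma fvec_eqI: "(\<And>k. coord x k = coord y k) \<Longrightarrow> x = y"
  by (rule poly_mapping_eqI)

lemma fvec_in_fspace [simp]: "fvec N f \<in> fspace N"
  by (simp add: fspace_def)

lemma fvec_coord: "x \<in> fspace N \<Longrightarrow> fvec N (coord x) = x"
  by (rule fvec_eqI) (auto simp: fspace_def)

lemma subspace_fspace: "Real_Vector_Spaces.subspace (fspace N)"
  by (auto simp: Real_Vector_Spaces.subspace_def fspace_def lookup_add)

lemmas fspace_closed = Real_Vector_Spaces.subspace_add[OF subspace_fspace] Real_Vector_Spaces.subspace_diff[OF subspace_fspace]
  Real_Vector_Spaces.subspace_scale[OF subspace_fspace] Real_Vector_Spaces.subspace_0[OF subspace_fspace]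

lemma inner_fspace:
  fixes x y :: "'a::rc_field fvec"
  assumes "x \<in> fspace N"
  shows "inner x y = (\<Sum>k<N. inner (coord x k) (coord y k))"
  unfolding inner_poly_mapping_def
  by (rule sum.mono_neutral_left) (use assms in \<open>auto simp: in_keys_iff fspace_def not_less[symmetric]\<close>)

lemma norm_fspace:
  fixes x :: "'a::rc_field fvec"
  assumes "x \<in> fspace N"
  shows "(norm x)\<^sup>2 = (\<Sum>k<N. (norm (coord x k))\<^sup>2)"
  using inner_fspace[OF assms, of x] by (simp add: power2_norm_eq_inner)

lemma inner_single_right: "inner x (Poly_Mapping.single k c) = inner (coord x k) (c :: 'a::rc_field)"
proof -
  have "inner x (Poly_Mapping.single k c) = inner (Poly_Mapping.single k c) x"
    by (rule inner_commute)
  also have "\<dots> = (\<Sum>i<Suc k. inner (coord (Poly_Mapping.single k c) i) (coord x i))"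
    by (rule inner_fspace) (auto simp: fspace_def lookup_single when_def)
  also have "\<dots> = inner c (coord x k)"
    by (simp add: lookup_single when_def)
  finally show ?thesis by (simp add: inner_commute)
qed

lemma norm_coord_le: "norm (coord x k) \<le> norm (x :: 'a::rc_field fvec)"
proof -
  have "(norm (coord x k))\<^sup>2 = inner x (Poly_Mapping.single k (coord x k))"
    by (simp add: inner_single_right power2_norm_eq_inner)
  also have "\<dots> \<le> norm x * norm (Poly_Mapping.single k (coord x k))"
    by (rule norm_cauchy_schwarz)
  also have "norm (Poly_Mapping.single k (coord x k)) = norm (coord x k)"
    by (simp add: norm_eq_sqrt_inner inner_single_right lookup_single)
  finally show ?thesis by (cases "coord x k = 0") (simp_all add: power2_eq_square)
qed

lemma bounded_linear_coord: "bounded_linear (\<lambda>x :: 'a::rc_field fvec. coord x k)"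
  by (rule bounded_linear_intro[where K = 1]) (simp_all add: lookup_add norm_coord_le)

lemma bounded_linear_single: "bounded_linear (\<lambda>c :: 'a::rc_field. Poly_Mapping.single (k :: nat) c)"
proof (rule bounded_linear_intro[where K = 1])
  fix c :: 'a
  show "norm (Poly_Mapping.single k c) \<le> norm c * 1"
    by (simp add: norm_eq_sqrt_inner inner_single_right lookup_single)
  show "Poly_Mapping.single k (r *\<^sub>R c) = r *\<^sub>R Poly_Mapping.single k c" for r
    by (rule fvec_eqI) (simp add: lookup_single when_def)
qed (rule single_add)

section \<open>Matrices as linear operators on finitely supported sequences\<close>

definition mop :: "'a::rc_field mat \<Rightarrow> 'a fvec \<Rightarrow> 'a fvec" where
  "mop A x = fvec (dim_row A) (\<lambda>i. \<Sum>j<dim_col A. A $$ (i, j) * coord x j)"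

definition emb :: "'a vec \<Rightarrow> 'a::rc_field fvec" where
  "emb v = fvec (dim_vec v) (vec_index v)"

lemma mop_in_fspace: "A \<in> carrier_mat n m \<Longrightarrow> mop A x \<in> fspace n"
  unfolding mop_def by auto

lemma coord_mop: "A \<in> carrier_mat n m \<Longrightarrow> coord (mop A x) i = (if i < n then \<Sum>j<m. A $$ (i, j) * coord x j else 0)"
  unfolding mop_def by auto

lemma emb_in_fspace: "v \<in> carrier_vec n \<Longrightarrow> emb v \<in> fspace n"
  unfolding emb_def by auto

lemma coord_emb: "v \<in> carrier_vec n \<Longrightarrow> coord (emb v) i = (if i < n then v $ i else 0)"
  unfolding emb_def by auto

lemma emb_vec_coord: "x \<in> fspace n \<Longrightarrow> emb (vec n (coord x)) = x"
  by (rule fvec_eqI) (auto simp: coord_emb[of _ n] fspace_def)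

lemma fspace_obtain_vec:
  assumes "x \<in> fspace n"
  obtains v where "v \<in> carrier_vec n" "x = emb v"
  using emb_vec_coord[OF assms] by (metis vec_carrier)

lemma emb_eq_iff: "v \<in> carrier_vec n \<Longrightarrow> w \<in> carrier_vec n \<Longrightarrow> emb v = emb w \<longleftrightarrow> v = w"
  by (metis coord_emb carrier_vecD eq_vecI)

lemma norm_emb: "norm (emb v) = vnorm v"
  using norm_fspace[OF emb_in_fspace[OF carrier_vec_dim_vec[of v]]]
  by (simp add: vnorm_def coord_emb[OF carrier_vec_dim_vec[of v]] real_sqrt_unique[symmetric] real_sqrt_abs2)

lemma mop_emb:
  assumes "A \<in> carrier_mat n m" "v \<in> carrier_vec m"
  shows "mop A (emb v) = emb (A *\<^sub>v v)"
  by (rule fvec_eqI) (use assms in \<open>auto simp: coord_mop[OF assms(1)] coord_emb[of _ n] coord_emb[OF assms(2)]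
        scalar_prod_def atLeast0LessThan\<close>)

lemma mop_mult:
  assumes "A \<in> carrier_mat n m" "B \<in> carrier_mat m p"
  shows "mop (A * B) x = mop A (mop B x)"
proof (rule fvec_eqI)
  fix i
  have "(\<Sum>j<p. (A * B) $$ (i, j) * coord x j) = (\<Sum>k<m. A $$ (i, k) * (\<Sum>j<p. B $$ (k, j) * coord x j))" if "i < n"
  proof -
    have "(\<Sum>j<p. (A * B) $$ (i, j) * coord x j) = (\<Sum>j<p. \<Sum>k<m. A $$ (i, k) * B $$ (k, j) * coord x j)"
      by (rule sum.cong) (use assms that in \<open>auto simp: scalar_prod_def atLeast0LessThan sum_distrib_right\<close>)
    also have "\<dots> = (\<Sum>k<m. \<Sum>j<p. A $$ (i, k) * B $$ (k, j) * coord x j)"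
      by (rule sum.swap)
    finally show ?thesis by (simp add: sum_distrib_left mult.assoc)
  qed
  then show "coord (mop (A * B) x) i = coord (mop A (mop B x)) i"
    by (simp add: coord_mop[OF mult_carrier_mat[OF assms]] coord_mop[OF assms(1)] coord_mop[OF assms(2)])
qed

text \<open>Since \<open>mop A\<close> reads the first \<open>dim_col A\<close> coordinates and
  ignores the others, it is linear on the whole sequence space, and the library facts on linear maps
  apply without carrier side conditions.\<close>

lemma linear_mop: "linear (mop A)"
  by (rule linearI) (auto intro!: fvec_eqI simp: mop_def lookup_add algebra_simps sum.distrib scaleR_sum_right)

lemmas mop_add = linear_add[OF linear_mop]
  and mop_diff = linear_diff[OF linear_mop]
  and mop_scaleR = linear_scale[OF linear_mop]
  and mop_zero [simp] = linear_0[OF linear_mop]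

lemma bounded_linear_mop: "bounded_linear (mop A)"
  unfolding mop_def[abs_def] fvec_def
  by (intro bounded_linear_sum bounded_linear_compose[OF bounded_linear_single]
      bounded_linear_compose[OF bounded_linear_mult_right] bounded_linear_coord)

lemma mop_one: "x \<in> fspace n \<Longrightarrow> mop (1\<^sub>m n) x = x"
  by (rule fvec_eqI) (auto simp: mop_def fspace_def if_distrib[of "\<lambda>a. a * _"] cong: if_cong)

lemma mop_mat_add:
  assumes "A \<in> carrier_mat n m" "B \<in> carrier_mat n m"
  shows "mop (A + B) x = mop A x + mop B x"
  by (rule fvec_eqI) (use assms in \<open>auto simp: mop_def lookup_add sum.distrib algebra_simps\<close>)

lemma mop_mat_diag:
  "mop (mat_diag n d) x = fvec n (\<lambda>k. d k * coord x k)"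
  by (rule fvec_eqI)
    (auto simp: mop_def mat_diag_def if_distrib[of "\<lambda>a. a * _"] cong: if_cong)

lemma mat_adjoint_carrier [simp]: "A \<in> carrier_mat n m \<Longrightarrow> mat_adjoint A \<in> carrier_mat m n"
  unfolding mat_adjoint_def by auto

lemma mat_adjoint_dim [simp]: "dim_row (mat_adjoint A) = dim_col A" "dim_col (mat_adjoint A) = dim_row A"
  unfolding mat_adjoint_def by auto

lemma mat_adjoint_index:
  "A \<in> carrier_mat n m \<Longrightarrow> i < m \<Longrightarrow> j < n \<Longrightarrow> mat_adjoint A $$ (i, j) = conjugate (A $$ (j, i))"
  unfolding mat_adjoint_def by (auto simp: mat_of_rows_def)

lemma mat_adjoint_adjoint [simp]: "mat_adjoint (mat_adjoint A) = A"
  by (rule eq_matI) (auto simp: mat_adjoint_def mat_of_rows_def)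

lemma inner_mop_left:
  assumes "A \<in> carrier_mat n m" "y \<in> fspace n"
  shows "inner (mop A x) y = inner x (mop (mat_adjoint A) y)"
proof -
  have "inner (mop A x) y = (\<Sum>i<n. inner (\<Sum>j<m. A $$ (i, j) * coord x j) (coord y i))"
    by (simp add: inner_fspace[OF mop_in_fspace[OF assms(1)]] coord_mop[OF assms(1)])
  also have "\<dots> = (\<Sum>i<n. \<Sum>j<m. inner (coord x j) (conjugate (A $$ (i, j)) * coord y i))"
    by (simp add: inner_sum_left inner_mult_left_conjugate)
  also have "\<dots> = (\<Sum>j<m. \<Sum>i<n. inner (coord x j) (conjugate (A $$ (i, j)) * coord y i))"
    by (rule sum.swap)
  also have "\<dots> = (\<Sum>j<m. inner (coord x j) (coord (mop (mat_adjoint A) y) j))"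
    using assms(1)
    by (simp add: coord_mop[of "mat_adjoint A" m n] mat_adjoint_index[of A n m] inner_sum_right)
  also have "\<dots> = inner (mop (mat_adjoint A) y) x"
    using assms(1) by (subst inner_fspace[OF mop_in_fspace[of "mat_adjoint A" m n]]) (simp_all add: inner_commute)
  finally show ?thesis by (simp add: inner_commute)
qed

lemma inner_mop_hermitian:
  assumes "hermitian n A" "y \<in> fspace n"
  shows "inner (mop A x) y = inner x (mop A y)"
  using inner_mop_left[of A n n y x] assms by (simp add: hermitian_def)

lemma mop_unitary:
  assumes "U \<in> carrier_mat n m" "mat_adjoint U * U = 1\<^sub>m m" "x \<in> fspace m"
  shows "mop (mat_adjoint U) (mop U x) = x"
  using mop_mult[of "mat_adjoint U" m n U m x] assms by (simp add: mop_one)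

lemma norm_mop_unitary:
  assumes "U \<in> carrier_mat n m" "mat_adjoint U * U = 1\<^sub>m m" "x \<in> fspace m"
  shows "norm (mop U x) = norm x"
  using inner_mop_left[OF assms(1) mop_in_fspace[OF assms(1)], of x x] mop_unitary[OF assms]
  by (simp add: norm_eq_sqrt_inner)

text \<open>One equation fewer than unknowns, encoded as a square matrix whose row \<open>k\<close>
  is zero, so that its determinant vanishes. Leaving the gap at an arbitrary \<open>k\<close> is
  convenient for the dimension counts: the equations before and after the gap can be of two
  different kinds.\<close>

lemma homogeneous_system_nontrivial:
  fixes r :: "nat \<Rightarrow> nat \<Rightarrow> 'a::rc_field"
  assumes "k < n"
  obtains x where "x \<in> fspace n" "x \<noteq> 0" "\<And>i. i < n \<Longrightarrow> i \<noteq> k \<Longrightarrow> (\<Sum>j<n. r i j * coord x j) = 0"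
proof -
  define A where "A = mat n n (\<lambda>(i, j). if i = k then 0 else r i j)"
  have A: "A \<in> carrier_mat n n" by (simp add: A_def)
  have "A = mat\<^sub>r n n (\<lambda>i. if i = k then 0\<^sub>v n else vec n (r i))"
    by (rule eq_matI) (auto simp: A_def)
  then have "det A = 0"
    using det_row_0[OF assms, of "\<lambda>i. vec n (r i)"] by simp
  then obtain v where v: "v \<in> carrier_vec n" "v \<noteq> 0\<^sub>v n" "A *\<^sub>v v = 0\<^sub>v n"
    using det_0_iff_vec_prod_zero_field[OF A] by blast
  show ?thesis
  proof (rule that[of "emb v"])
    show "emb v \<in> fspace n" using v by (simp add: emb_in_fspace)
    have "emb (0\<^sub>v n) = (0 :: 'a fvec)" by (rule fvec_eqI) (simp add: coord_emb[of _ n])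
    then show "emb v \<noteq> 0" using v emb_eq_iff[of v n "0\<^sub>v n"] by auto
    fix i assume i: "i < n" "i \<noteq> k"
    have "0 = (A *\<^sub>v v) $ i" using v i by simp
    also have "\<dots> = (\<Sum>j<n. r i j * coord (emb v) j)"
      using i v(1) by (simp add: A_def scalar_prod_def coord_emb[of v n] atLeast0LessThan)
    finally show "(\<Sum>j<n. r i j * coord (emb v) j) = 0" by simp
  qed
qed

section \<open>The spectral theorem\<close>

definition cdot :: "nat \<Rightarrow> 'a::rc_field fvec \<Rightarrow> 'a fvec \<Rightarrow> 'a" where
  "cdot n x y = (\<Sum>k<n. conjugate (coord x k) * coord y k)"

lemma inner_eq_cdot: "x \<in> fspace n \<Longrightarrow> inner x y = inner (cdot n x y) 1"
  by (simp add: cdot_def inner_fspace inner_sum_left inner_commute[of "coord x _"]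
      inner_one_conjugate[of "coord y _"])

lemma cdot_self: "x \<in> fspace n \<Longrightarrow> cdot n x x = of_real ((norm x)\<^sup>2)"
  by (simp add: cdot_def norm_fspace mult_conjugate_norm scaleR_conv_of_real)

lemma cdot_add_right: "cdot n x (y + z) = cdot n x y + cdot n x z"
  by (simp add: cdot_def lookup_add algebra_simps sum.distrib)

lemma cdot_scaleR_right: "cdot n x (r *\<^sub>R y) = r *\<^sub>R cdot n x y"
  by (simp add: cdot_def scaleR_sum_right)

lemma cdot_diff_right: "cdot n x (y - z) = cdot n x y - cdot n x z"
  by (simp add: cdot_def lookup_minus algebra_simps sum_subtractf)

lemma cdot_scaleR_left: "cdot n (r *\<^sub>R x) y = r *\<^sub>R cdot n x y"
  by (simp add: cdot_def scaleR_sum_right)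

lemma conjugate_cdot: "conjugate (cdot n x y) = cdot n y x"
  by (simp add: cdot_def sum_conjugate conjugate_dist_mul mult.commute)

lemma cdot_mop_left:
  assumes "A \<in> carrier_mat n m"
  shows "cdot n (mop A x) y = cdot m x (mop (mat_adjoint A) y)"
proof -
  have "cdot n (mop A x) y = (\<Sum>i<n. \<Sum>j<m. conjugate (A $$ (i, j)) * conjugate (coord x j) * coord y i)"
    by (simp add: cdot_def coord_mop[OF assms] sum_conjugate conjugate_dist_mul sum_distrib_right)
  also have "\<dots> = (\<Sum>j<m. \<Sum>i<n. conjugate (A $$ (i, j)) * conjugate (coord x j) * coord y i)"
    by (rule sum.swap)
  also have "\<dots> = cdot m x (mop (mat_adjoint A) y)"
    using assms by (simp add: cdot_def coord_mop[of _ m n] mat_adjoint_index[of A n m] sum_distrib_left ac_simps)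
  finally show ?thesis .
qed

lemma bounded_linear_cdot: "bounded_linear (cdot n x)"
  unfolding cdot_def[abs_def]
  by (intro bounded_linear_sum bounded_linear_compose[OF bounded_linear_mult_right] bounded_linear_coord)

text \<open>The ambient sequence space is infinite dimensional, so compactness must come from the
  coordinates: a product of closed balls of scalars is compact by Tychonoff, and its continuous
  image under \<open>fvec n\<close> contains the unit sphere of \<open>fspace n\<close>.\<close>

lemma compact_fspace_sphere_Int:
  fixes S :: "'a::rc_field fvec set"
  assumes "closed S"
  shows "compact {x \<in> fspace n. norm x = 1 \<and> x \<in> S}"
proof -
  define K where "K = (PiE UNIV (\<lambda>_. cball 0 1) :: (nat \<Rightarrow> 'a) set)"
  have "compactin (product_topology (\<lambda>_. euclidean) UNIV) K"
    unfolding K_def by (subst compactin_PiE) auto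
  then have "compact K" by (simp add: euclidean_product_topology flip: compactin_euclidean_iff)
  moreover have "continuous_on K (fvec n)"
    unfolding fvec_def[abs_def]
    by (intro continuous_intros linear_continuous_on_compose[OF _ bounded_linear.linear]
        bounded_linear.continuous_on[OF bounded_linear_single]
        continuous_on_subset[OF continuous_on_product_coordinates]) auto
  ultimately have "compact (fvec n ` K)" by (rule compact_continuous_image[rotated])
  moreover have "closed ({x. norm x = 1} \<inter> S)"
    by (intro closed_Int assms closed_Collect_eq continuous_intros)
  ultimately have "compact (fvec n ` K \<inter> ({x. norm x = 1} \<inter> S))"
    by (rule compact_Int_closed)
  also have "fvec n ` K \<inter> ({x. norm x = 1} \<inter> S) = {x \<in> fspace n. norm x = 1 \<and> x \<in> S}"
  proof safe
    fix x :: "'a fvec" assume x: "x \<in> fspace n" "norm x = 1"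
    have "coord x \<in> K" using x norm_coord_le[of x] by (auto simp: K_def)
    then show "x \<in> fvec n ` K" using fvec_coord[OF x(1)] by (metis image_eqI)
  qed auto
  finally show ?thesis .
qed

lemma exists_unit_orthogonal:
  fixes u :: "nat \<Rightarrow> 'a::rc_field fvec"
  assumes "k < n"
  obtains x where "x \<in> fspace n" "norm x = 1" "\<And>i. i < k \<Longrightarrow> cdot n (u i) x = 0"
proof -
  obtain y where y: "y \<in> fspace n" "y \<noteq> 0"
    "\<And>i. i < n \<Longrightarrow> i \<noteq> k \<Longrightarrow> (\<Sum>j<n. conjugate (coord (u i) j) * coord y j) = 0"
    using homogeneous_system_nontrivial[OF assms, of "\<lambda>i j. conjugate (coord (u i) j)"] by metis
  show ?thesis
  proof (rule that[of "(1 / norm y) *\<^sub>R y"])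
    show "(1 / norm y) *\<^sub>R y \<in> fspace n" using y by (simp add: fspace_closed)
    show "norm ((1 / norm y) *\<^sub>R y) = 1" using y by simp
    show "cdot n (u i) ((1 / norm y) *\<^sub>R y) = 0" if "i < k" for i
      using y(3)[of i] that assms by (simp add: cdot_scaleR_right flip: cdot_def)
  qed
qed

text \<open>The complement \<open>F\<close> of known eigenvectors is invariant under a Hermitian
  matrix, so a maximiser of the Rayleigh quotient on the unit sphere of \<open>F\<close> is a
  further eigenvector. The bound on \<open>F\<close> is returned as well because it orders the
  eigenvalues.\<close>

lemma rayleigh_maximum:
  fixes u :: "nat \<Rightarrow> 'a::rc_field fvec"
  assumes A: "hermitian n A" and k: "k < n"
    and u: "\<And>i. i < k \<Longrightarrow> mop A (u i) = l i *\<^sub>R u i"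
  defines "F \<equiv> {x \<in> fspace n. \<forall>i<k. cdot n (u i) x = 0}"
  shows "\<exists>v\<in>F. \<exists>c. norm v = 1 \<and> mop A v = c *\<^sub>R v \<and> (\<forall>x\<in>F. inner x (mop A x) \<le> c * (norm x)\<^sup>2)"
proof -
  have A': "A \<in> carrier_mat n n" "mat_adjoint A = A" using A by (auto simp: hermitian_def)
  define q where "q x = inner x (mop A x)" for x
  define S where "S = (\<Inter>i\<in>{..<k}. {x. cdot n (u i) x = 0})"
  have cF: "x \<in> F \<Longrightarrow> y \<in> F \<Longrightarrow> x + y \<in> F" "x \<in> F \<Longrightarrow> y \<in> F \<Longrightarrow> x - y \<in> F"
    "x \<in> F \<Longrightarrow> r *\<^sub>R x \<in> F" for x y r
    by (auto simp: F_def fspace_closed cdot_add_right cdot_diff_right cdot_scaleR_right)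
  have AF: "mop A x \<in> F" if "x \<in> F" for x
    using that cdot_mop_left[OF A'(1), of "u _" x, symmetric]
    by (auto simp: F_def A' u mop_in_fspace[OF A'(1)] cdot_scaleR_left)
  define C where "C = {x \<in> fspace n. norm x = 1 \<and> x \<in> S}"
  have "closed S" unfolding S_def
    by (intro closed_INT ballI closed_Collect_eq linear_continuous_on bounded_linear_cdot) auto
  then have "compact C" unfolding C_def by (rule compact_fspace_sphere_Int)
  moreover have "C \<noteq> {}"
  proof -
    obtain x where "x \<in> fspace n" "norm x = 1" "\<And>i. i < k \<Longrightarrow> cdot n (u i) x = 0"
      using exists_unit_orthogonal[OF k, of u] by auto
    then have "x \<in> C" by (simp add: C_def S_def)
    then show ?thesis by blast
  qed
  moreover have "continuous_on C q"
    unfolding q_def by (intro continuous_intros linear_continuous_on bounded_linear_mop)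
  ultimately have "\<exists>v\<in>C. \<forall>x\<in>C. q x \<le> q v" by (rule continuous_attains_sup)
  then obtain v where v: "v \<in> C" "\<And>x. x \<in> C \<Longrightarrow> q x \<le> q v" by blast
  have vF: "v \<in> F" "norm v = 1" using v(1) by (auto simp: C_def S_def F_def)
  define c where "c = q v"
  have le: "q x \<le> c * (norm x)\<^sup>2" if "x \<in> F" for x
  proof (cases "x = 0")
    case False
    have "(1 / norm x) *\<^sub>R x \<in> C"
      using False that by (auto simp: C_def S_def F_def fspace_closed cdot_scaleR_right)
    from v(2)[OF this] have "q x / (norm x)\<^sup>2 \<le> c"
      by (simp add: q_def mop_scaleR c_def power2_eq_square)
    then show ?thesis using False by (simp add: field_simps)
  qed (simp add: q_def)
  \<comment> \<open>The residual is itself a direction in \<open>F\<close>. Maximality along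
    \<open>v + t w\<close> bounds the first-order gain \<open>2 * t * b\<close> by
    \<open>t\<^sup>2 * d\<close> for every \<open>t\<close>, which forces
    \<open>b = 0\<close>.\<close>
  define w where "w = mop A v - c *\<^sub>R v"
  have wF: "w \<in> F" unfolding w_def by (intro cF AF vF)
  define b where "b = (norm w)\<^sup>2"
  define d where "d = c * (norm w)\<^sup>2 - q w"
  have d0: "d \<ge> 0" using le[OF wF] by (simp add: d_def)
  have bw: "b = inner w (mop A v) - c * inner w v"
    unfolding b_def power2_norm_eq_inner by (subst (2) w_def) (simp add: inner_diff_right)
  have quad: "2 * t * b \<le> t\<^sup>2 * d" for t
  proof -
    have sym: "inner v (mop A w) = inner w (mop A v)"
      using inner_mop_hermitian[OF A, of w v] wF inner_commute by (metis (mono_tags, lifting) F_def mem_Collect_eq)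
    have "q (v + t *\<^sub>R w) \<le> c * (norm (v + t *\<^sub>R w))\<^sup>2"
      by (intro le cF vF wF)
    moreover have "q (v + t *\<^sub>R w) = c + 2 * t * inner w (mop A v) + t\<^sup>2 * q w"
      by (simp add: q_def c_def mop_add mop_scaleR inner_add_left inner_add_right sym power2_eq_square algebra_simps)
    moreover have "(norm (v + t *\<^sub>R w))\<^sup>2 = 1 + 2 * t * inner w v + t\<^sup>2 * (norm w)\<^sup>2"
      using vF(2) unfolding power2_norm_eq_inner
      by (simp add: inner_add_left inner_add_right inner_commute[of v w] norm_eq_1 power2_eq_square algebra_simps)
    ultimately show ?thesis by (simp add: bw d_def algebra_simps)
  qed
  have "b = 0"
  proof (rule ccontr)
    assume "b \<noteq> 0"
    then have b: "b > 0" by (simp add: b_def)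
    \<comment> \<open>The choice \<open>t = b / (d + 1)\<close> is small enough for the linear term
      to dominate, and it also covers \<open>d = 0\<close>.\<close>
    have "2 * (b / (d + 1)) * b \<le> (b / (d + 1))\<^sup>2 * d" by (rule quad)
    also have "\<dots> = (b * b / (d + 1)) * (d / (d + 1))" by (simp add: power2_eq_square)
    also have "\<dots> \<le> (b * b / (d + 1)) * 1" using d0 by (intro mult_left_mono) auto
    finally have "b * b / (d + 1) \<le> 0" by simp
    moreover have "b * b / (d + 1) > 0" using d0 b by simp
    ultimately show False by simp
  qed
  then have "mop A v = c *\<^sub>R v" by (simp add: b_def w_def)
  then show ?thesis using vF le unfolding q_def by blast
qed

text \<open>The last clause carries the induction: the next eigenvector lies in the complement of
  the earlier ones, where the form is bounded by each earlier eigenvalue, so the new eigenvalue is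
  not larger.\<close>

lemma hermitian_eigenvectors:
  assumes A: "hermitian n A" and k: "k \<le> n"
  shows "\<exists>(u :: nat \<Rightarrow> 'a::rc_field fvec) l.
    (\<forall>i<k. u i \<in> fspace n \<and> mop A (u i) = l i *\<^sub>R u i) \<and>
    (\<forall>i<k. \<forall>j<k. cdot n (u i) (u j) = (if i = j then 1 else 0)) \<and>
    (\<forall>j<k. \<forall>i\<le>j. l j \<le> l i) \<and>
    (\<forall>i<k. \<forall>x\<in>fspace n. (\<forall>j<k. cdot n (u j) x = 0) \<longrightarrow> inner x (mop A x) \<le> l i * (norm x)\<^sup>2)"
  using k
proof (induction k)
  case (Suc k)
  then have "k \<le> n" "k < n" by auto
  obtain u :: "nat \<Rightarrow> 'a fvec" and l where u:
    "(\<forall>i<k. u i \<in> fspace n \<and> mop A (u i) = l i *\<^sub>R u i) \<and>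
    (\<forall>i<k. \<forall>j<k. cdot n (u i) (u j) = (if i = j then 1 else 0)) \<and>
    (\<forall>j<k. \<forall>i\<le>j. l j \<le> l i) \<and>
    (\<forall>i<k. \<forall>x\<in>fspace n. (\<forall>j<k. cdot n (u j) x = 0) \<longrightarrow> inner x (mop A x) \<le> l i * (norm x)\<^sup>2)"
    using Suc.IH[OF \<open>k \<le> n\<close>] by blast
  then have 1: "\<And>i. i < k \<Longrightarrow> u i \<in> fspace n" "\<And>i. i < k \<Longrightarrow> mop A (u i) = l i *\<^sub>R u i"
    and 2: "\<And>i j. i < k \<Longrightarrow> j < k \<Longrightarrow> cdot n (u i) (u j) = (if i = j then 1 else 0)"
    and 3: "\<And>i j. j < k \<Longrightarrow> i \<le> j \<Longrightarrow> l j \<le> l i"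
    and 4: "\<And>i x. i < k \<Longrightarrow> x \<in> fspace n \<Longrightarrow> (\<forall>j<k. cdot n (u j) x = 0) \<Longrightarrow> inner x (mop A x) \<le> l i * (norm x)\<^sup>2"
    by blast+
  obtain v c where "v \<in> {x \<in> fspace n. \<forall>i<k. cdot n (u i) x = 0}"
    "norm v = 1 \<and> mop A v = c *\<^sub>R v \<and>
      (\<forall>x\<in>{x \<in> fspace n. \<forall>i<k. cdot n (u i) x = 0}. inner x (mop A x) \<le> c * (norm x)\<^sup>2)"
    using rayleigh_maximum[of n A k u l, OF A \<open>k < n\<close> 1(2)] by blast
  then have v: "v \<in> fspace n" "\<And>i. i < k \<Longrightarrow> cdot n (u i) v = 0" "norm v = 1" "mop A v = c *\<^sub>R v"
    "\<And>x. x \<in> fspace n \<Longrightarrow> (\<forall>i<k. cdot n (u i) x = 0) \<Longrightarrow> inner x (mop A x) \<le> c * (norm x)\<^sup>2"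
    by blast+
  have c: "c \<le> l i" if "i < k" for i
    using 4[OF that v(1)] v by (simp add: power2_norm_eq_inner[symmetric])
  have vi: "cdot n v (u i) = 0" if "i < k" for i
    using conjugate_cdot[of n "u i" v] v(2)[OF that] by simp
  define u' where "u' = u(k := v)"
  define l' where "l' = l(k := c)"
  have "\<forall>i<Suc k. u' i \<in> fspace n \<and> mop A (u' i) = l' i *\<^sub>R u' i"
    using 1 v by (auto simp: u'_def l'_def less_Suc_eq)
  moreover have "\<forall>i<Suc k. \<forall>j<Suc k. cdot n (u' i) (u' j) = (if i = j then 1 else 0)"
    using 2 v vi cdot_self[OF v(1)] by (auto simp: u'_def less_Suc_eq)
  moreover have "\<forall>j<Suc k. \<forall>i\<le>j. l' j \<le> l' i"
    using 3 c by (auto simp: l'_def less_Suc_eq)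
  moreover have "\<forall>i<Suc k. \<forall>x\<in>fspace n. (\<forall>j<Suc k. cdot n (u' j) x = 0) \<longrightarrow>
      inner x (mop A x) \<le> l' i * (norm x)\<^sup>2"
  proof (intro allI impI ballI)
    fix i x assume i: "i < Suc k" and x: "x \<in> fspace n" "\<forall>j<Suc k. cdot n (u' j) x = 0"
    then have "\<forall>j<k. cdot n (u j) x = 0" by (auto simp: u'_def less_Suc_eq)
    then show "inner x (mop A x) \<le> l' i * (norm x)\<^sup>2"
      using 4[OF _ x(1)] v(5)[OF x(1)] i by (auto simp: l'_def less_Suc_eq)
  qed
  ultimately show ?case by blast
qed auto

lemma mat_eq_mopI:
  assumes A: "A \<in> carrier_mat n m" and B: "B \<in> carrier_mat n m"
    and eq: "\<And>x. x \<in> fspace m \<Longrightarrow> mop A x = mop B x"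
  shows "A = B"
proof (rule eq_matI)
  fix i j assume ij: "i < dim_row B" "j < dim_col B"
  have *: "coord (mop C (Poly_Mapping.single j 1)) i = C $$ (i, j)" if "C \<in> carrier_mat n m" for C
    using ij B by (simp add: coord_mop[OF that] lookup_single when_def
        if_distrib[of "\<lambda>a. _ * a"] cong: if_cong)
  have "Poly_Mapping.single j 1 \<in> fspace m"
    using ij B by (auto simp: fspace_def lookup_single when_def)
  from eq[OF this] show "A $$ (i, j) = B $$ (i, j)" using *[OF A] *[OF B] by simp
qed (use A B in auto)

definition cols_mat :: "nat \<Rightarrow> (nat \<Rightarrow> 'a::rc_field fvec) \<Rightarrow> 'a mat" where
  "cols_mat n u = mat n n (\<lambda>(i, j). coord (u j) i)"

lemma cols_mat_unitary:
  assumes "\<And>i j. i < n \<Longrightarrow> j < n \<Longrightarrow> cdot n (u i) (u j) = (if i = j then 1 else 0)"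
  shows "cols_mat n u \<in> unitary_group n"
proof -
  have Q: "cols_mat n u \<in> carrier_mat n n" by (simp add: cols_mat_def)
  have "mat_adjoint (cols_mat n u) * cols_mat n u = 1\<^sub>m n"
  proof (rule eq_matI)
    fix i j assume ij: "i < dim_row (1\<^sub>m n)" "j < dim_col (1\<^sub>m n)"
    then have "(mat_adjoint (cols_mat n u) * cols_mat n u) $$ (i, j) = cdot n (u i) (u j)"
      using Q by (simp add: scalar_prod_def mat_adjoint_index[OF Q] cdot_def atLeast0LessThan)
        (simp add: cols_mat_def)
    then show "(mat_adjoint (cols_mat n u) * cols_mat n u) $$ (i, j) = 1\<^sub>m n $$ (i, j)"
      using assms ij by simp
  qed (use Q mat_adjoint_carrier[OF Q] in auto)
  then show ?thesis using Q by (simp add: unitary_group_def)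
qed

definition first_unit :: "'a::rc_field fvec" where
  "first_unit = fvec 1 (\<lambda>_. 1)"

lemma first_unit_in_fspace: "0 < n \<Longrightarrow> first_unit \<in> fspace n"
  by (simp add: first_unit_def fspace_def)

lemma mop_cols_mat_first:
  assumes "0 < n" "u 0 \<in> fspace n"
  shows "mop (cols_mat n u) first_unit = u 0"
  by (rule fvec_eqI) (use assms in \<open>simp add: first_unit_def coord_mop[of _ n n] cols_mat_def fspace_def
      if_distrib[of "\<lambda>a. _ * a"] cong: if_cong\<close>)

lemma unitary_groupD:
  assumes "U \<in> unitary_group n"
  shows "U \<in> carrier_mat n n" "mat_adjoint U * U = 1\<^sub>m n" "U * mat_adjoint U = 1\<^sub>m n"
  using assms mat_mult_left_right_inverse[of "mat_adjoint U" n U]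
  by (auto simp: unitary_group_def)

lemma unitary_group_adjoint:
  assumes "U \<in> unitary_group n"
  shows "mat_adjoint U \<in> unitary_group n"
  using unitary_groupD[OF assms] unfolding unitary_group_def by simp

lemma spectral_theorem:
  fixes A :: "'a::rc_field mat"
  assumes A: "hermitian n A"
  obtains Q ls where "Q \<in> unitary_group n" "length ls = n" "sorted_wrt (\<ge>) ls"
    "A = Q * mat_diag n (\<lambda>k. of_real (ls ! k)) * mat_adjoint Q"
proof -
  have A': "A \<in> carrier_mat n n" using A by (simp add: hermitian_def)
  obtain u :: "nat \<Rightarrow> 'a fvec" and l where ul:
    "(\<forall>i<n. u i \<in> fspace n \<and> mop A (u i) = l i *\<^sub>R u i) \<and>
    (\<forall>i<n. \<forall>j<n. cdot n (u i) (u j) = (if i = j then 1 else 0)) \<and>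
    (\<forall>j<n. \<forall>i\<le>j. l j \<le> l i) \<and>
    (\<forall>i<n. \<forall>x\<in>fspace n. (\<forall>j<n. cdot n (u j) x = 0) \<longrightarrow> inner x (mop A x) \<le> l i * (norm x)\<^sup>2)"
    using hermitian_eigenvectors[OF A order.refl] by (elim exE) (rule that)
  have u: "u i \<in> fspace n" "mop A (u i) = l i *\<^sub>R u i" if "i < n" for i
    using conjunct1[OF ul] that by blast+
  have orth: "cdot n (u i) (u j) = (if i = j then 1 else 0)" if "i < n" "j < n" for i j
    using conjunct1[OF conjunct2[OF ul]] that by blast
  have l: "l j \<le> l i" if "j < n" "i \<le> j" for i j
    using conjunct1[OF conjunct2[OF conjunct2[OF ul]]] that by blast
  define Q where "Q = cols_mat n u"
  define ls where "ls = map l [0..<n]"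
  define D where "D = mat_diag n (\<lambda>k. of_real (ls ! k) :: 'a)"
  have QU: "Q \<in> unitary_group n" unfolding Q_def by (rule cols_mat_unitary[OF orth])
  note Q = unitary_groupD[OF QU]
  have D: "D \<in> carrier_mat n n" by (simp add: D_def)
  have "A * Q = Q * D"
  proof (rule eq_matI)
    fix i j assume ij: "i < dim_row (Q * D)" "j < dim_col (Q * D)"
    then have ij: "i < n" "j < n" using Q D by auto
    have "(A * Q) $$ (i, j) = coord (mop A (u j)) i"
      using ij A' by (auto simp: scalar_prod_def Q_def cols_mat_def coord_mop[OF A'] atLeast0LessThan)
    also have "\<dots> = (Q * D) $$ (i, j)"
      using ij u by (simp add: D_def mat_diag_mult_right[OF Q(1)]) (simp add: Q_def cols_mat_def ls_def scaleR_conv_of_real)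
    finally show "(A * Q) $$ (i, j) = (Q * D) $$ (i, j)" .
  qed (use A' Q D in auto)
  then have "A * Q * mat_adjoint Q = Q * D * mat_adjoint Q" by simp
  also have "A * Q * mat_adjoint Q = A"
    using assoc_mult_mat[OF A' Q(1) mat_adjoint_carrier[OF Q(1)]] A' Q(3) by simp
  finally have "A = Q * D * mat_adjoint Q" .
  moreover have "sorted_wrt (\<ge>) ls"
    using l by (auto simp: ls_def sorted_wrt_iff_nth_less)
  ultimately show ?thesis using that[of Q ls] QU by (simp add: D_def ls_def)
qed

lemma char_poly_unitary_diag:
  fixes Q :: "'a::rc_field mat"
  assumes Q: "Q \<in> unitary_group n" and len: "length ls = n"
    and A: "A = Q * mat_diag n (\<lambda>k. of_real (ls ! k)) * mat_adjoint Q"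
  shows "char_poly A = (\<Prod>a\<leftarrow>ls. [:- of_real a, 1:])"
proof -
  let ?D = "mat_diag n (\<lambda>k. of_real (ls ! k)) :: 'a mat"
  note Q' = unitary_groupD[OF Q]
  have "similar_mat_wit A ?D Q (mat_adjoint Q)"
    unfolding similar_mat_wit_def Let_def A using Q' by (auto intro!: mult_carrier_mat)
  then have "similar_mat A ?D" unfolding similar_mat_def by blast
  then have "char_poly A = char_poly ?D" by (rule char_poly_similar)
  also have "\<dots> = (\<Prod>a\<leftarrow>diag_mat ?D. [:- a, 1:])"
    by (rule char_poly_upper_triangular[of _ n]) (auto simp: mat_diag_def)
  also have "diag_mat ?D = map of_real ls"
    by (rule nth_equalityI) (auto simp: diag_mat_def mat_diag_def len)
  finally show ?thesis by (simp add: o_def)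
qed

text \<open>The linear factors determine the multiset of roots, \<open>of_real\<close> is injective,
  and a decreasing list is determined by its multiset. This gives the uniqueness that the definite
  description in \<open>eigvals\<close> requires.\<close>

lemma eigvals_eqI:
  fixes A :: "'a::rc_field mat"
  assumes "sorted_wrt (\<ge>) ls" "char_poly A = (\<Prod>a\<leftarrow>ls. [:- of_real a, 1:])"
  shows "eigvals A = ls"
  unfolding eigvals_def
proof (rule the_equality)
  fix ks assume ks: "sorted_wrt (\<ge>) ks \<and> char_poly A = (\<Prod>a\<leftarrow>ks. [:- of_real a, 1:])"
  have roots: "proots (\<Prod>a\<leftarrow>xs. [:- of_real a, 1 :: 'a:]) = image_mset of_real (mset xs)" for xs :: "real list"
  proof (induction xs)
    case (Cons a xs)
    have "(\<Prod>a\<leftarrow>xs. [:- of_real a, 1 :: 'a:]) \<noteq> 0" by (auto simp: prod_list_zero_iff)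
    then show ?case using Cons by (simp add: proots_mult del: mult_pCons_left)
  qed simp
  have "image_mset (of_real :: real \<Rightarrow> 'a) (mset ks) = image_mset of_real (mset ls)"
    using ks assms(2) roots by metis
  then have eq: "mset ks = mset ls"
    using injD[OF multiset.inj_map[of "of_real :: real \<Rightarrow> 'a"]] by (simp only: inj_of_real)
  have "sorted (rev xs)" if "sorted_wrt (\<ge>) xs" for xs :: "real list"
    using that by (simp add: sorted_wrt_rev)
  then have "rev ks = rev ls"
    using properties_for_sort[of "rev ks" "rev ls"] properties_for_sort[of "rev ls" "rev ls"] eq ks assms(1)
    by (metis mset_rev)
  then show "ks = ls" by simp
qed (use assms in auto)

lemma spectral_eigvals:
  fixes A :: "'a::rc_field mat"
  assumes "hermitian n A"
  obtains Q where "Q \<in> unitary_group n" "length (eigvals A) = n" "sorted_wrt (\<ge>) (eigvals A)"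
    "A = Q * mat_diag n (\<lambda>k. of_real (eigvals A ! k)) * mat_adjoint Q"
proof -
  obtain Q ls where Q: "Q \<in> unitary_group n" "length ls = n" "sorted_wrt (\<ge>) ls"
    "A = Q * mat_diag n (\<lambda>k. of_real (ls ! k)) * mat_adjoint Q"
    using spectral_theorem[OF assms] .
  then have "eigvals A = ls" by (intro eigvals_eqI char_poly_unitary_diag)
  with Q show ?thesis by (intro that[of Q]) simp_all
qed

section \<open>Exponential moments of the Haar measure\<close>

text \<open>A composition of isometries preserves the inner product. The matrix identity follows by
  testing the defect \<open>y\<close> against itself, a device that recurs below for equalities
  between operators.\<close>

lemma unitary_group_mult:
  fixes U V :: "'a::rc_field mat"
  assumes "U \<in> unitary_group n" "V \<in> unitary_group n"
  shows "U * V \<in> unitary_group n"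
proof -
  note U = unitary_groupD[OF assms(1)] and V = unitary_groupD[OF assms(2)]
  have UV: "U * V \<in> carrier_mat n n" using U V by simp
  have UVa: "mat_adjoint (U * V) * (U * V) \<in> carrier_mat n n"
    by (rule mult_carrier_mat[OF mat_adjoint_carrier[OF UV] UV])
  then have "mat_adjoint (U * V) * (U * V) = 1\<^sub>m n"
  proof (rule mat_eq_mopI)
    fix x :: "'a fvec" assume x: "x \<in> fspace n"
    define y where "y = mop (mat_adjoint (U * V) * (U * V)) x - x"
    have y: "y \<in> fspace n"
      unfolding y_def by (intro fspace_closed mop_in_fspace[OF UVa] x)
    have "inner (mop (mat_adjoint (U * V) * (U * V)) x) y = inner x y"
    proof -
      have "inner (mop (mat_adjoint (U * V) * (U * V)) x) y = inner (mop (U * V) x) (mop (U * V) y)"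
        using inner_mop_left[OF mat_adjoint_carrier[OF UV] y, of "mop (U * V) x"]
          mop_mult[OF mat_adjoint_carrier[OF UV] UV] by simp
      also have "\<dots> = inner (mop U (mop V x)) (mop U (mop V y))"
        by (simp add: mop_mult[OF U(1) V(1)])
      also have "\<dots> = inner (mop V x) (mop V y)"
        using inner_mop_left[OF U(1) mop_in_fspace[OF U(1)], of "mop V x" "mop V y"]
          mop_unitary[OF U(1,2) mop_in_fspace[OF V(1)]] by simp
      also have "\<dots> = inner x y"
        using inner_mop_left[OF V(1) mop_in_fspace[OF V(1)], of x y] mop_unitary[OF V(1,2) y] by simp
      finally show ?thesis .
    qed
    then have "inner y y = 0" by (subst y_def) (simp add: inner_diff_left)
    then show "mop (mat_adjoint (U * V) * (U * V)) x = mop (1\<^sub>m n) x"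
      using x by (simp add: y_def mop_one)
  qed simp
  then show ?thesis using UV unfolding unitary_group_def by simp
qed

section \<open>Transitivity of the group on spheres\<close>

lemma unitary_first_column:
  fixes w :: "'a::rc_field fvec"
  assumes n: "0 < n" and w: "w \<in> fspace n" "norm w = 1"
  obtains Q where "Q \<in> unitary_group n" "mop Q first_unit = w"
proof -
  have "\<exists>u :: nat \<Rightarrow> 'a fvec. u 0 = w \<and> (\<forall>i<k. u i \<in> fspace n) \<and>
      (\<forall>i<k. \<forall>j<k. cdot n (u i) (u j) = (if i = j then 1 else 0))" if "1 \<le> k" "k \<le> n" for k
    using that
  proof (induction k)
    case (Suc k)
    show ?case
    proof (cases "k = 0")
      case True
      then show ?thesis using cdot_self[OF w(1)] w by (intro exI[of _ "\<lambda>_. w"]) simp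
    next
      case False
      then have "1 \<le> k" "k \<le> n" using Suc.prems by auto
      then obtain u :: "nat \<Rightarrow> 'a fvec" where u: "u 0 = w \<and> (\<forall>i<k. u i \<in> fspace n) \<and>
        (\<forall>i<k. \<forall>j<k. cdot n (u i) (u j) = (if i = j then 1 else 0))"
        using Suc.IH by blast
      obtain v where v: "v \<in> fspace n" "norm v = 1" "\<And>i. i < k \<Longrightarrow> cdot n (u i) v = 0"
        using exists_unit_orthogonal[of k n u] Suc.prems by auto
      have vi: "cdot n v (u i) = 0" if "i < k" for i
        using conjugate_cdot[of n "u i" v] v(3)[OF that] by simp
      show ?thesis
        using u v vi cdot_self[OF v(1)] False
        by (intro exI[of _ "u(k := v)"]) (auto simp: less_Suc_eq)
    qed
  qed simp
  from this[of n] n obtain u :: "nat \<Rightarrow> 'a fvec" where u: "u 0 = w \<and> (\<forall>i<n. u i \<in> fspace n) \<and>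
      (\<forall>i<n. \<forall>j<n. cdot n (u i) (u j) = (if i = j then 1 else 0))" by auto
  show ?thesis
  proof (rule that[of "cols_mat n u"])
    show "cols_mat n u \<in> unitary_group n" using u by (intro cols_mat_unitary) auto
    show "mop (cols_mat n u) first_unit = w"
      using mop_cols_mat_first[of n u] u n w by auto
  qed
qed

text \<open>Both vectors are the same multiple of images of \<open>first_unit\<close>. This is what
  turns left invariance of the Haar measure into the freedom to replace a vector by any other of
  equal norm.\<close>

lemma unitary_transitive:
  fixes v w :: "'a::rc_field fvec"
  assumes v: "v \<in> fspace n" and w: "w \<in> fspace n" and eq: "norm v = norm w"
  obtains Q where "Q \<in> unitary_group n" "mop Q v = w"
proof (cases "v = 0")
  case True
  then have "w = 0" using eq by simp
  moreover have "1\<^sub>m n \<in> (unitary_group n :: 'a mat set)"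
  proof -
    have "mat_adjoint (1\<^sub>m n) = (1\<^sub>m n :: 'a mat)"
      by (rule eq_matI) (auto simp: mat_adjoint_index[of _ n n])
    then show ?thesis by (simp add: unitary_group_def)
  qed
  ultimately show ?thesis using that[of "1\<^sub>m n"] True by simp
next
  case False
  then have w0: "w \<noteq> 0" using eq by auto
  have n: "0 < n"
  proof (rule ccontr)
    assume "\<not> 0 < n"
    then have "v = 0" using v by (intro fvec_eqI) (simp add: fspace_def)
    then show False using False by simp
  qed
  define r where "r = norm v"
  have r: "r \<noteq> 0" "r = norm w" using False eq by (auto simp: r_def)
  obtain Q1 where Q1: "Q1 \<in> unitary_group n" "mop Q1 first_unit = (1 / r) *\<^sub>R v"
    using unitary_first_column[OF n, of "(1 / r) *\<^sub>R v"] v r by (auto simp: fspace_closed r_def)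
  obtain Q2 where Q2: "Q2 \<in> unitary_group n" "mop Q2 first_unit = (1 / r) *\<^sub>R w"
    using unitary_first_column[OF n, of "(1 / r) *\<^sub>R w"] w r w0 by (auto simp: fspace_closed)
  have e: "(first_unit :: 'a fvec) \<in> fspace n" using n by (rule first_unit_in_fspace)
  have "mop (mat_adjoint Q1) v = mop (mat_adjoint Q1) (r *\<^sub>R mop Q1 first_unit)"
    using r by (simp add: Q1(2))
  also have "\<dots> = r *\<^sub>R first_unit"
    using mop_unitary[OF unitary_groupD(1,2)[OF Q1(1)] e] by (simp add: mop_scaleR)
  finally have 1: "mop (mat_adjoint Q1) v = r *\<^sub>R first_unit" .
  have "mop (Q2 * mat_adjoint Q1) v = mop Q2 (mop (mat_adjoint Q1) v)"
    using unitary_groupD[OF Q1(1)] unitary_groupD[OF Q2(1)] by (intro mop_mult) auto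
  also have "\<dots> = r *\<^sub>R ((1 / r) *\<^sub>R w)" unfolding 1 mop_scaleR Q2(2) ..
  also have "\<dots> = w" using r(1) by simp
  finally show ?thesis
    by (rule that[OF unitary_group_mult[OF Q2(1) unitary_group_adjoint[OF Q1(1)]]])
qed

lemma norm_fspace_Basis:
  fixes x :: "'a::rc_field fvec"
  assumes "x \<in> fspace n"
  shows "(norm x)\<^sup>2 = (\<Sum>(k, b)\<in>{..<n} \<times> Basis. (inner (coord x k) b)\<^sup>2)"
proof -
  have "(norm y)\<^sup>2 = (\<Sum>b\<in>Basis. (inner y b)\<^sup>2)" for y :: 'a
    unfolding power2_norm_eq_inner by (subst euclidean_inner) (simp only: power2_eq_square)
  then have "(norm x)\<^sup>2 = (\<Sum>k<n. \<Sum>b\<in>Basis. (inner (coord x k) b)\<^sup>2)"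
    by (simp only: norm_fspace[OF assms])
  then show ?thesis by (simp add: sum.cartesian_product)
qed

text \<open>Vectors are prescribed by their \<open>n * DIM('a)\<close> real coordinates, indexed by
  a position and a basis element of the scalars. Random signs and Gaussian variables are attached to
  these real coordinates, for both kinds of scalars alike.\<close>

definition basis_fvec :: "nat \<Rightarrow> (nat \<times> 'a \<Rightarrow> real) \<Rightarrow> 'a::rc_field fvec" where
  "basis_fvec n g = fvec n (\<lambda>k. \<Sum>b\<in>Basis. g (k, b) *\<^sub>R b)"

lemma basis_fvec_in_fspace [simp]: "basis_fvec n g \<in> fspace n"
  by (simp add: basis_fvec_def)

lemma norm_basis_fvec: "(norm (basis_fvec n g))\<^sup>2 = (\<Sum>i\<in>{..<n} \<times> Basis. (g i)\<^sup>2)"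
  unfolding norm_fspace_Basis[OF basis_fvec_in_fspace]
  by (rule sum.cong) (auto simp: basis_fvec_def inner_sum_left_Basis)

lemma inner_basis_fvec:
  "inner (basis_fvec n g) x = (\<Sum>(k, b)\<in>{..<n} \<times> Basis. g (k, b) * inner (coord x k) b)"
proof -
  have "inner (basis_fvec n g) x = (\<Sum>k<n. \<Sum>b\<in>Basis. g (k, b) * inner (coord x k) b)"
    by (simp add: inner_fspace[OF basis_fvec_in_fspace])
      (simp add: basis_fvec_def inner_sum_right inner_commute[of _ "coord x _"])
  then show ?thesis by (simp add: sum.cartesian_product)
qed

section \<open>Measurability and translation invariance\<close>

lemma haar_space: "haar n \<mu> \<Longrightarrow> space \<mu> = unitary_group n"
  using sets_eq_imp_space_eq[of \<mu> "unitary_borel n"] by (simp add: haar_def unitary_borel_def)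

lemma haar_entry_measurable:
  fixes \<mu> :: "'a::rc_field mat measure"
  assumes "haar n \<mu>" "i < n" "j < n"
  shows "(\<lambda>U. U $$ (i, j)) \<in> borel_measurable \<mu>"
proof -
  have "(\<lambda>U. \<lambda>ij\<in>{..<n} \<times> {..<n}. U $$ ij) \<in> (unitary_borel n :: 'a mat measure) \<rightarrow>\<^sub>M (\<Pi>\<^sub>M ij\<in>{..<n} \<times> {..<n}. borel)"
    unfolding unitary_borel_def by (rule measurable_vimage_algebra1) (auto simp: space_PiM)
  from measurable_compose[OF this measurable_component_singleton[of "(i, j)"]]
  have "(\<lambda>U. U $$ (i, j)) \<in> borel_measurable (unitary_borel n :: 'a mat measure)"
    using assms by simp
  moreover have "sets \<mu> = sets (unitary_borel n)" using assms by (simp add: haar_def)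
  then have "(borel_measurable \<mu> :: ('a mat \<Rightarrow> 'a) set) = borel_measurable (unitary_borel n)"
    by (rule measurable_cong_sets) (rule refl)
  ultimately show ?thesis by blast
qed

lemma haar_coord_measurable [measurable]:
  fixes \<mu> :: "'a::rc_field mat measure"
  assumes "haar n \<mu>"
  shows "(\<lambda>U. coord (mop U x) k) \<in> borel_measurable \<mu>"
proof (cases "k < n")
  case True
  have "(\<lambda>U. \<Sum>j<n. U $$ (k, j) * coord x j) \<in> borel_measurable \<mu>"
    using haar_entry_measurable[OF assms] True by (intro borel_measurable_sum borel_measurable_times) auto
  then show ?thesis
    by (rule measurable_cong[THEN iffD1, rotated])
      (use True in \<open>auto simp: haar_space[OF assms] unitary_group_def coord_mop[of _ n n]\<close>)
next
  case False
  have "(\<lambda>U. 0) \<in> borel_measurable \<mu>" by simp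
  then show ?thesis
    by (rule measurable_cong[THEN iffD1, rotated])
      (use False in \<open>auto simp: haar_space[OF assms] unitary_group_def coord_mop[of _ n n]\<close>)
qed

text \<open>Invariance in \<open>haar\<close> is stated through \<open>distr\<close>, which can be
  evaluated on sets and in integrals once the translation is known to be measurable.\<close>

lemma haar_translate_measurable:
  fixes \<mu> :: "'a::rc_field mat measure"
  assumes h: "haar n \<mu>" and Q: "Q \<in> unitary_group n"
  shows "(\<lambda>U. Q * U) \<in> \<mu> \<rightarrow>\<^sub>M \<mu>"
proof -
  note Q' = unitary_groupD[OF Q]
  have "(\<lambda>U. Q * U) \<in> \<mu> \<rightarrow>\<^sub>M unitary_borel n"
    unfolding unitary_borel_def
  proof (rule measurable_vimage_algebra2)
    show "(*) Q \<in> space \<mu> \<rightarrow> unitary_group n"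
      by (auto simp: haar_space[OF h] intro!: unitary_group_mult[OF Q])
    show "(\<lambda>U. \<lambda>ij\<in>{..<n} \<times> {..<n}. (Q * U) $$ ij) \<in> \<mu> \<rightarrow>\<^sub>M (\<Pi>\<^sub>M ij\<in>{..<n} \<times> {..<n}. borel)"
    proof (rule measurable_restrict)
      fix ij :: "nat \<times> nat" assume ij: "ij \<in> {..<n} \<times> {..<n}"
      obtain i j where ij': "ij = (i, j)" by (cases ij)
      have "(\<lambda>U. \<Sum>k<n. Q $$ (i, k) * U $$ (k, j)) \<in> borel_measurable \<mu>"
        using haar_entry_measurable[OF h] ij ij' by (intro borel_measurable_sum borel_measurable_times) auto
      then show "(\<lambda>U. (Q * U) $$ ij) \<in> borel_measurable \<mu>"
        by (rule measurable_cong[THEN iffD1, rotated])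
          (use ij ij' Q' in \<open>auto simp: haar_space[OF h] unitary_group_def scalar_prod_def atLeast0LessThan\<close>)
    qed
  qed
  moreover have "sets \<mu> = sets (unitary_borel n)" using h by (simp add: haar_def)
  ultimately show ?thesis using measurable_cong_sets[OF refl] by blast
qed

lemma haar_nn_integral_translate:
  fixes \<mu> :: "'a::rc_field mat measure"
  assumes h: "haar n \<mu>" and Q: "Q \<in> unitary_group n" and f: "f \<in> borel_measurable \<mu>"
  shows "(\<integral>\<^sup>+U. f (Q * U) \<partial>\<mu>) = (\<integral>\<^sup>+U. f U \<partial>\<mu>)"
proof -
  have "(\<integral>\<^sup>+U. f U \<partial>\<mu>) = (\<integral>\<^sup>+U. f U \<partial>distr \<mu> \<mu> (\<lambda>U. Q * U))"
    using h Q by (simp add: haar_def)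
  also have "\<dots> = (\<integral>\<^sup>+U. f (Q * U) \<partial>\<mu>)"
    by (rule nn_integral_distr[OF haar_translate_measurable[OF h Q]]) (use f in simp)
  finally show ?thesis by simp
qed

text \<open>This is \<open>cosh t \<le> exp (t\<^sup>2 / 2)\<close>. For \<open>s \<ge> 0\<close> it
  is the analytic inequality behind Hoeffding's lemma, taken for a fair coin
  (\<open>p = 1 / 2\<close>) and \<open>h = 2 * s\<close>; the other sign follows by
  symmetry.\<close>

lemma exp_add_exp_minus_le: "exp t + exp (- t) \<le> 2 * exp (t\<^sup>2 / 2)" for t :: real
proof -
  have pos: "exp s + exp (- s) \<le> 2 * exp (s\<^sup>2 / 2)" if "0 \<le> s" for s :: real
  proof -
    have "- (2 * s) * (1 / 2) + ln (1 + 1 / 2 * (exp (2 * s) - 1)) \<le> (2 * s)\<^sup>2 / 8"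
      by (rule Hoeffdings_lemma_aux) (use that in auto)
    then have "ln (1 / 2 * (1 + exp (2 * s))) \<le> s + s\<^sup>2 / 2"
      by (simp add: power_mult_distrib algebra_simps)
    then have "1 / 2 * (1 + exp (2 * s)) \<le> exp (s + s\<^sup>2 / 2)"
      using ln_le_cancel_iff[of "1 / 2 * (1 + exp (2 * s))" "exp (s + s\<^sup>2 / 2)"] by (simp add: add_pos_pos)
    then have "exp (- s) * (1 / 2 * (1 + exp (2 * s))) \<le> exp (- s) * exp (s + s\<^sup>2 / 2)"
      by (intro mult_left_mono) auto
    then show ?thesis by (simp add: algebra_simps flip: exp_add)
  qed
  from pos[of "\<bar>t\<bar>"] show ?thesis by (cases "0 \<le> t") (auto simp: add.commute)
qed

text \<open>The sum over all sign patterns factorises into one two-term sum per index, each bounded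
  by the estimate for \<open>cosh\<close>.\<close>

lemma sum_exp_signs_le:
  fixes y :: "'i \<Rightarrow> real"
  assumes "finite I"
  shows "(\<Sum>\<tau>\<in>PiE I (\<lambda>_. {-1, 1}). exp (\<Sum>i\<in>I. \<tau> i * y i)) \<le> 2 ^ card I * exp ((\<Sum>i\<in>I. (y i)\<^sup>2) / 2)"
proof -
  have "(\<Sum>\<tau>\<in>PiE I (\<lambda>_. {-1, 1 :: real}). exp (\<Sum>i\<in>I. \<tau> i * y i)) = (\<Prod>i\<in>I. \<Sum>s\<in>{-1, 1 :: real}. exp (s * y i))"
    using assms by (subst prod_sum_PiE) (auto simp: exp_sum)
  also have "\<dots> \<le> (\<Prod>i\<in>I. 2 * exp ((y i)\<^sup>2 / 2))"
    using exp_add_exp_minus_le[of "y _"] by (intro prod_mono) (auto simp: add.commute)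
  also have "\<dots> = 2 ^ card I * exp ((\<Sum>i\<in>I. (y i)\<^sup>2) / 2)"
    using assms by (simp add: prod.distrib exp_sum sum_divide_distrib)
  finally show ?thesis .
qed

text \<open>
  By invariance \<open>w\<close> may be replaced by any vector of the same norm, in particular by a random one
  with independent random signs as coordinates, for which the integral is elementary.
\<close>

lemma haar_exp_inner_le:
  fixes \<mu> :: "'a::rc_field mat measure"
  assumes h: "haar n \<mu>" and n: "0 < n" and w: "w \<in> fspace n" and a: "a \<in> fspace n"
  shows "(\<integral>\<^sup>+U. ennreal (exp (inner w (mop U a))) \<partial>\<mu>)
    \<le> ennreal (exp ((norm w)\<^sup>2 * (norm a)\<^sup>2 / (2 * real (n * DIM('a)))))"
proof -
  interpret prob_space \<mu> using h by (simp add: haar_def)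
  define I where "I = {..<n} \<times> (Basis :: 'a set)"
  have I: "finite I" "card I = n * DIM('a)" by (auto simp: I_def card_cartesian_product)
  define c where "c = norm w / sqrt (n * DIM('a))"
  have c2: "c\<^sup>2 * (n * DIM('a)) = (norm w)\<^sup>2" using n by (simp add: c_def power_divide)
  define S where "S = PiE I (\<lambda>_. {-1, 1 :: real})"
  have S: "finite S" "card S = 2 ^ card I" using I by (auto simp: S_def finite_PiE card_PiE numeral_2_eq_2)
  define W where "W \<tau> = (basis_fvec n (\<lambda>i. c * \<tau> i) :: 'a fvec)" for \<tau>
  have meas: "(\<lambda>U. inner v (mop U a)) \<in> borel_measurable \<mu>" if "v \<in> fspace n" for v
    unfolding inner_fspace[OF that] using haar_coord_measurable[OF h] by measurable
  have int_eq: "(\<integral>\<^sup>+U. ennreal (exp (inner w (mop U a))) \<partial>\<mu>) = (\<integral>\<^sup>+U. ennreal (exp (inner (W \<tau>) (mop U a))) \<partial>\<mu>)"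
    if "\<tau> \<in> S" for \<tau>
  proof -
    have "(norm (W \<tau>))\<^sup>2 = (\<Sum>i\<in>I. c\<^sup>2)"
      unfolding W_def norm_basis_fvec I_def[symmetric]
      by (rule sum.cong) (use that in \<open>auto simp: S_def power_mult_distrib PiE_iff\<close>)
    then have "(norm (W \<tau>))\<^sup>2 = (norm w)\<^sup>2" using c2 I by (simp add: mult.commute)
    then have "norm (W \<tau>) = norm w" by simp
    then obtain Q where Q: "Q \<in> unitary_group n" "mop Q w = W \<tau>"
      using unitary_transitive[of w n "W \<tau>"] w by (auto simp: W_def)
    have "(\<integral>\<^sup>+U. ennreal (exp (inner (W \<tau>) (mop U a))) \<partial>\<mu>) = (\<integral>\<^sup>+U. ennreal (exp (inner (W \<tau>) (mop (Q * U) a))) \<partial>\<mu>)"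
      by (rule haar_nn_integral_translate[OF h Q(1), symmetric]) (use meas[of "W \<tau>"] in \<open>simp add: W_def\<close>)
    also have "\<dots> = (\<integral>\<^sup>+U. ennreal (exp (inner w (mop U a))) \<partial>\<mu>)"
    proof (rule nn_integral_cong)
      fix U assume "U \<in> space \<mu>"
      then have U: "U \<in> carrier_mat n n" by (simp add: haar_space[OF h] unitary_group_def)
      note Q' = unitary_groupD[OF Q(1)]
      have "inner (W \<tau>) (mop (Q * U) a) = inner (mop Q w) (mop Q (mop U a))"
        using mop_mult[OF Q'(1) U] Q(2) by simp
      also have "\<dots> = inner w (mop U a)"
        using inner_mop_left[OF Q'(1) mop_in_fspace[OF Q'(1)], of w "mop U a"]
          mop_unitary[OF Q'(1,2) mop_in_fspace[OF U]] by simp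
      finally show "ennreal (exp (inner (W \<tau>) (mop (Q * U) a))) = ennreal (exp (inner w (mop U a)))" by simp
    qed
    finally show ?thesis by simp
  qed
  \<comment> \<open>All these integrals are equal, so they may be averaged over the signs. After the
    sum is moved inside, the bound depends on \<open>U\<close> only through the norm of
    \<open>mop U a\<close>, which is the norm of \<open>a\<close>; no property of the distribution
    of \<open>U\<close> is left.\<close>
  have "of_nat (card S) * (\<integral>\<^sup>+U. ennreal (exp (inner w (mop U a))) \<partial>\<mu>)
      = (\<Sum>\<tau>\<in>S. \<integral>\<^sup>+U. ennreal (exp (inner (W \<tau>) (mop U a))) \<partial>\<mu>)"
    using int_eq by (simp flip: sum_constant)
  also have "\<dots> = (\<integral>\<^sup>+U. (\<Sum>\<tau>\<in>S. ennreal (exp (inner (W \<tau>) (mop U a)))) \<partial>\<mu>)"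
    using meas[of "W _"] by (subst nn_integral_sum) (auto simp: W_def)
  also have "\<dots> \<le> (\<integral>\<^sup>+U. ennreal (2 ^ card I * exp (c\<^sup>2 * (norm a)\<^sup>2 / 2)) \<partial>\<mu>)"
  proof (rule nn_integral_mono)
    fix U assume "U \<in> space \<mu>"
    then have U: "U \<in> carrier_mat n n" "mat_adjoint U * U = 1\<^sub>m n"
      by (auto simp: haar_space[OF h] unitary_group_def)
    define y where "y = (\<lambda>(k, b). c * inner (coord (mop U a) k) b)"
    have 1: "inner (W \<tau>) (mop U a) = (\<Sum>i\<in>I. \<tau> i * y i)" for \<tau>
      unfolding W_def inner_basis_fvec I_def by (rule sum.cong) (auto simp: y_def)
    have "(\<Sum>i\<in>I. (y i)\<^sup>2) = c\<^sup>2 * (norm (mop U a))\<^sup>2"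
      unfolding norm_fspace_Basis[OF mop_in_fspace[OF U(1)]] sum_distrib_left I_def
      by (rule sum.cong) (auto simp: y_def power_mult_distrib)
    also have "\<dots> = c\<^sup>2 * (norm a)\<^sup>2" using norm_mop_unitary[OF U a] by simp
    finally have 2: "(\<Sum>i\<in>I. (y i)\<^sup>2) = c\<^sup>2 * (norm a)\<^sup>2" .
    show "(\<Sum>\<tau>\<in>S. ennreal (exp (inner (W \<tau>) (mop U a)))) \<le> ennreal (2 ^ card I * exp (c\<^sup>2 * (norm a)\<^sup>2 / 2))"
      using sum_exp_signs_le[OF I(1), of y] unfolding 1 2 S_def by (simp add: ennreal_leI)
  qed
  also have "\<dots> = of_nat (card S) * ennreal (exp (c\<^sup>2 * (norm a)\<^sup>2 / 2))"
    by (simp add: S emeasure_space_1 ennreal_mult' ennreal_power[symmetric])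
  finally have "(\<integral>\<^sup>+U. ennreal (exp (inner w (mop U a))) \<partial>\<mu>) \<le> ennreal (exp (c\<^sup>2 * (norm a)\<^sup>2 / 2))"
    using S by (subst (asm) ennreal_mult_le_mult_iff) (auto simp: power_eq_top_ennreal)
  also have "c\<^sup>2 * (norm a)\<^sup>2 / 2 = (norm w)\<^sup>2 * (norm a)\<^sup>2 / (2 * real (n * DIM('a)))"
    using n unfolding c2[symmetric] by simp
  finally show ?thesis .
qed

section \<open>Gaussian averages and exponential moments of quadratic forms\<close>

definition std_normal :: "real measure" where
  "std_normal = density lborel (\<lambda>x. ennreal (std_normal_density x))"

lemma prob_space_std_normal: "prob_space std_normal"
  unfolding std_normal_def by (rule prob_space_normal_density) simp

lemma sets_std_normal [measurable_cong, simp]: "sets std_normal = sets borel"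
  by (simp add: std_normal_def)

lemma nn_integral_normal_density: "0 < \<sigma> \<Longrightarrow> (\<integral>\<^sup>+x. ennreal (normal_density m \<sigma> x) \<partial>lborel) = 1"
  using prob_space.emeasure_space_1[OF prob_space_normal_density[of \<sigma> m]]
  by (simp add: emeasure_density)

lemma nn_integral_std_normal_exp_linear:
  "(\<integral>\<^sup>+x. ennreal (exp (\<alpha> * x)) \<partial>std_normal) = ennreal (exp (\<alpha>\<^sup>2 / 2))"
proof -
  have eq: "std_normal_density x * exp (\<alpha> * x) = exp (\<alpha>\<^sup>2 / 2) * normal_density \<alpha> 1 x" for x
    by (simp add: normal_density_def power2_eq_square field_simps flip: exp_add)
  have "(\<integral>\<^sup>+x. ennreal (exp (\<alpha> * x)) \<partial>std_normal)
      = (\<integral>\<^sup>+x. ennreal (exp (\<alpha>\<^sup>2 / 2)) * ennreal (normal_density \<alpha> 1 x) \<partial>lborel)"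
    unfolding std_normal_def by (subst nn_integral_density) (auto simp: eq simp flip: ennreal_mult)
  then show ?thesis by (simp add: nn_integral_cmult nn_integral_normal_density)
qed

lemma nn_integral_std_normal_exp_square:
  assumes "\<beta> < 1 / 2"
  shows "(\<integral>\<^sup>+x. ennreal (exp (\<beta> * x\<^sup>2)) \<partial>std_normal) = ennreal (1 / sqrt (1 - 2 * \<beta>))"
proof -
  define s where "s = 1 / sqrt (1 - 2 * \<beta>)"
  have s: "s > 0" "1 / s\<^sup>2 = 1 - 2 * \<beta>" using assms by (auto simp: s_def power_divide)
  have e: "- (x\<^sup>2) / 2 + \<beta> * x\<^sup>2 = - (x\<^sup>2) / (2 * s\<^sup>2)" for x
  proof -
    have "- (x\<^sup>2) / (2 * s\<^sup>2) = - (x\<^sup>2) / 2 * (1 / s\<^sup>2)" by simp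
    then show ?thesis unfolding s(2) by (simp add: algebra_simps)
  qed
  have eq: "std_normal_density x * exp (\<beta> * x\<^sup>2) = s * normal_density 0 s x" for x
    using s(1) e[of x] by (simp add: normal_density_def real_sqrt_mult flip: exp_add)
  have "(\<integral>\<^sup>+x. ennreal (exp (\<beta> * x\<^sup>2)) \<partial>std_normal)
      = (\<integral>\<^sup>+x. ennreal s * ennreal (normal_density 0 s x) \<partial>lborel)"
    unfolding std_normal_def using s(1)
    by (subst nn_integral_density) (auto simp: eq simp flip: ennreal_mult)
  then show ?thesis using s(1) by (simp add: nn_integral_cmult nn_integral_normal_density flip: s_def)
qed

text \<open>Half of the bound \<open>ln (1 - x) \<ge> - x - 2 * x\<^sup>2\<close> at
  \<open>x = 2 * \<beta>\<close>. The linear term will reproduce the mean of the quadratic form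
  exactly; only the quadratic term is a loss, and it becomes the sub-Gaussian variance.\<close>

lemma inverse_sqrt_le_exp:
  assumes "0 \<le> \<beta>" "\<beta> \<le> 1 / 4"
  shows "1 / sqrt (1 - 2 * \<beta>) \<le> exp (\<beta> + 4 * \<beta>\<^sup>2)"
proof -
  have "- (2 * \<beta>) - 2 * (2 * \<beta>)\<^sup>2 \<le> ln (1 - 2 * \<beta>)"
    using assms by (intro ln_one_minus_pos_lower_bound) auto
  then have "exp (- 2 * (\<beta> + 4 * \<beta>\<^sup>2)) \<le> exp (ln (1 - 2 * \<beta>))" by (simp add: power_mult_distrib)
  also have "\<dots> = 1 - 2 * \<beta>" using assms by simp
  finally have "sqrt (exp (- 2 * (\<beta> + 4 * \<beta>\<^sup>2))) \<le> sqrt (1 - 2 * \<beta>)" by simp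
  also have "sqrt (exp (- 2 * (\<beta> + 4 * \<beta>\<^sup>2))) = exp (- (\<beta> + 4 * \<beta>\<^sup>2))"
    by (rule real_sqrt_unique) (simp_all flip: exp_of_nat_mult)
  finally have "1 / sqrt (1 - 2 * \<beta>) \<le> 1 / exp (- (\<beta> + 4 * \<beta>\<^sup>2))"
    by (intro divide_left_mono mult_pos_pos) (use assms in auto)
  also have "1 / exp (- (\<beta> + 4 * \<beta>\<^sup>2)) = exp (\<beta> + 4 * \<beta>\<^sup>2)"
    by (metis exp_minus inverse_eq_divide inverse_inverse_eq)
  finally show ?thesis .
qed

text \<open>
  A Gaussian integral linearises the exponent (the Hubbard--Stratonovich trick), which reduces the
  claim to the linear functionals of the previous lemma.
\<close>

lemma haar_exp_quadratic_le:
  fixes \<mu> :: "'a::rc_field mat measure"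
  assumes h: "haar n \<mu>" and n: "0 < n" and a: "a \<in> fspace n" "norm a \<le> 1"
    and f: "\<And>k. k < n \<Longrightarrow> 0 \<le> f k" "\<And>k. k < n \<Longrightarrow> f k \<le> b"
    and t: "0 \<le> t" "4 * t * b \<le> n"
  shows "(\<integral>\<^sup>+U. ennreal (exp (t * (\<Sum>k<n. f k * (norm (coord (mop U a) k))\<^sup>2))) \<partial>\<mu>)
    \<le> ennreal (exp (t * (norm a)\<^sup>2 * (\<Sum>k<n. f k) / n + 4 * t\<^sup>2 * b\<^sup>2 / n))"
proof -
  define I where "I = {..<n} \<times> (Basis :: 'a set)"
  have I: "finite I" "card I = n * DIM('a)" by (auto simp: I_def card_cartesian_product)
  define D where "D = real DIM('a)"
  have D: "D \<ge> 1" by (simp add: D_def DIM_positive Suc_leI)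
  define P where "P = PiM I (\<lambda>_. std_normal)"
  interpret \<mu>: prob_space \<mu> using h by (simp add: haar_def)
  interpret pr: product_prob_space "\<lambda>_. std_normal" I
    by (simp add: product_prob_space_def product_prob_space_axioms_def product_sigma_finite_def
        prob_space_std_normal prob_space_imp_sigma_finite)
  interpret P: prob_space P unfolding P_def by (rule prob_space_PiM) (rule prob_space_std_normal)
  interpret pair_sigma_finite \<mu> P ..
  \<comment> \<open>The Gaussian average of \<open>exp (r * x)\<close> is
    \<open>exp (r\<^sup>2 / 2)\<close>. With this weight and \<open>r = s i * y U i\<close>, that is
    the factor of the exponential belonging to the real coordinate \<open>i\<close>. The square root
    is the reason for treating nonnegative weights first.\<close>
  define s where "s i = sqrt (2 * t * f (fst i))" for i :: "nat \<times> 'a"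
  define y where "y U i = inner (coord (mop U a) (fst i)) (snd i)" for U :: "'a mat" and i
  define G where "G U g = (\<Prod>i\<in>I. ennreal (exp (s i * y U i * g i)))" for U :: "'a mat" and g
  define \<beta> where "\<beta> i = t * f (fst i) * (norm a)\<^sup>2 / (n * D)" for i :: "nat \<times> 'a"
  have a2: "(norm a)\<^sup>2 \<le> 1" using a(2) by (simp add: power_le_one)
  have s2: "(s i)\<^sup>2 = 2 * t * f (fst i)" if "i \<in> I" for i
    using f(1)[of "fst i"] t that by (auto simp: s_def I_def)
  have lin: "G U g = ennreal (exp (inner (basis_fvec n (\<lambda>i. s i * g i)) (mop U a)))" for U g
    unfolding G_def inner_basis_fvec
    by (simp add: prod_ennreal I(1) flip: exp_sum I_def)
      (rule sum.cong, auto simp: y_def)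
  have ymeas: "(\<lambda>U. y U i) \<in> borel_measurable \<mu>" for i
    unfolding y_def using haar_coord_measurable[OF h] by measurable
  have gmeas: "(\<lambda>g. g i) \<in> borel_measurable P" if "i \<in> I" for i
    using measurable_component_singleton[OF that, of "\<lambda>_. std_normal"]
    unfolding P_def by (simp cong: measurable_cong_sets)
  have Gmeas: "case_prod G \<in> borel_measurable (\<mu> \<Otimes>\<^sub>M P)"
  proof -
    have "(\<lambda>x. s i * y (fst x) i * snd x i) \<in> borel_measurable (\<mu> \<Otimes>\<^sub>M P)" if "i \<in> I" for i
      by (intro borel_measurable_times borel_measurable_const
          measurable_compose[OF measurable_fst ymeas] measurable_compose[OF measurable_snd gmeas[OF that]])
    then have "(\<lambda>x. \<Prod>i\<in>I. ennreal (exp (s i * y (fst x) i * snd x i))) \<in> borel_measurable (\<mu> \<Otimes>\<^sub>M P)"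
      by (intro borel_measurable_prod_ennreal measurable_compose[OF _ measurable_ennreal]
          measurable_compose[OF _ borel_measurable_exp])
    then show ?thesis by (simp add: G_def case_prod_beta')
  qed
  have "(\<integral>\<^sup>+U. ennreal (exp (t * (\<Sum>k<n. f k * (norm (coord (mop U a) k))\<^sup>2))) \<partial>\<mu>)
      = (\<integral>\<^sup>+U. \<integral>\<^sup>+g. G U g \<partial>P \<partial>\<mu>)"
  proof (rule nn_integral_cong)
    fix U
    have nb: "(norm c)\<^sup>2 = (\<Sum>b\<in>Basis. (inner c b)\<^sup>2)" for c :: 'a
      unfolding power2_norm_eq_inner by (subst euclidean_inner) (simp only: power2_eq_square)
    have "t * (\<Sum>k<n. f k * (norm (coord (mop U a) k))\<^sup>2) = (\<Sum>k<n. \<Sum>b\<in>Basis. t * f k * (inner (coord (mop U a) k) b)\<^sup>2)"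
      by (simp add: nb sum_distrib_left mult.assoc)
    also have "\<dots> = (\<Sum>i\<in>I. (s i * y U i)\<^sup>2 / 2)"
      unfolding I_def sum.cartesian_product
      by (rule sum.cong) (use s2 in \<open>auto simp: power_mult_distrib y_def I_def\<close>)
    finally have "ennreal (exp (t * (\<Sum>k<n. f k * (norm (coord (mop U a) k))\<^sup>2)))
      = (\<Prod>i\<in>I. ennreal (exp ((s i * y U i)\<^sup>2 / 2)))"
      using I(1) by (simp add: exp_sum prod_ennreal)
    also have "\<dots> = (\<Prod>i\<in>I. \<integral>\<^sup>+x. ennreal (exp (s i * y U i * x)) \<partial>std_normal)"
      by (simp only: nn_integral_std_normal_exp_linear)
    also have "\<dots> = (\<integral>\<^sup>+g. G U g \<partial>P)"
      unfolding G_def P_def by (rule pr.product_nn_integral_prod[symmetric]) (use I(1) in auto)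
    finally show "ennreal (exp (t * (\<Sum>k<n. f k * (norm (coord (mop U a) k))\<^sup>2))) = (\<integral>\<^sup>+g. G U g \<partial>P)" .
  qed
  \<comment> \<open>After the interchange the inner integral is over \<open>U\<close>, of the
    exponential of a linear functional with coordinates \<open>s i * g i\<close>. Its bound is the
    exponential of a diagonal quadratic form in \<open>g\<close> with the coefficients
    \<open>\<beta> i\<close>, so the Gaussian integral factorises again.\<close>
  also have "\<dots> = (\<integral>\<^sup>+g. \<integral>\<^sup>+U. G U g \<partial>\<mu> \<partial>P)"
    by (rule Fubini'[OF Gmeas, symmetric])
  also have "\<dots> \<le> (\<integral>\<^sup>+g. (\<Prod>i\<in>I. ennreal (exp (\<beta> i * (g i)\<^sup>2))) \<partial>P)"
  proof (rule nn_integral_mono)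
    fix g
    define w where "w = (basis_fvec n (\<lambda>i. s i * g i) :: 'a fvec)"
    have "(norm w)\<^sup>2 * (norm a)\<^sup>2 / (2 * real (n * DIM('a))) = (\<Sum>i\<in>I. \<beta> i * (g i)\<^sup>2)"
      unfolding w_def norm_basis_fvec I_def[symmetric] sum_distrib_right sum_divide_distrib
      by (rule sum.cong) (auto simp: power_mult_distrib s2 \<beta>_def D_def)
    then show "(\<integral>\<^sup>+U. G U g \<partial>\<mu>) \<le> (\<Prod>i\<in>I. ennreal (exp (\<beta> i * (g i)\<^sup>2)))"
      using haar_exp_inner_le[OF h n _ a(1), of w] I(1)
      by (simp add: lin prod_ennreal exp_sum w_def)
  qed
  also have "\<dots> = (\<Prod>i\<in>I. \<integral>\<^sup>+x. ennreal (exp (\<beta> i * x\<^sup>2)) \<partial>std_normal)"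
    unfolding P_def by (rule pr.product_nn_integral_prod) (use I(1) in auto)
  also have "\<dots> \<le> (\<Prod>i\<in>I. ennreal (exp (\<beta> i + 4 * (\<beta> i)\<^sup>2)))"
  proof (rule prod_mono_ennreal)
    fix i assume i: "i \<in> I"
    have fi: "0 \<le> f (fst i)" "f (fst i) \<le> b" using f i by (auto simp: I_def)
    have 0: "0 \<le> \<beta> i" using fi t n D by (simp add: \<beta>_def)
    have "t * f (fst i) * (norm a)\<^sup>2 \<le> t * b * 1"
      using fi t a2 by (intro mult_mono) auto
    \<comment> \<open>The hypothesis \<open>4 * t * b \<le> n\<close> enters here: it keeps every
      \<open>\<beta> i\<close> at most \<open>1 / 4\<close>, inside the range
      \<open>\<beta> < 1 / 2\<close> in which the Gaussian integral converges.\<close>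
    also have "\<dots> \<le> n / 4" using t by simp
    also have "\<dots> \<le> n * D / 4" using mult_left_mono[OF D, of "real n"] by simp
    finally have 1: "\<beta> i \<le> 1 / 4" using n D by (simp add: \<beta>_def field_simps)
    then have "(\<integral>\<^sup>+x. ennreal (exp (\<beta> i * x\<^sup>2)) \<partial>std_normal) = ennreal (1 / sqrt (1 - 2 * \<beta> i))"
      by (intro nn_integral_std_normal_exp_square) simp
    then show "(\<integral>\<^sup>+x. ennreal (exp (\<beta> i * x\<^sup>2)) \<partial>std_normal) \<le> ennreal (exp (\<beta> i + 4 * (\<beta> i)\<^sup>2))"
      using inverse_sqrt_le_exp[OF 0 1] by (simp add: ennreal_leI)
  qed
  also have "\<dots> = ennreal (exp (\<Sum>i\<in>I. \<beta> i + 4 * (\<beta> i)\<^sup>2))"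
    by (subst exp_sum[OF I(1)]) (simp add: prod_ennreal)
  also have "\<dots> \<le> ennreal (exp (t * (norm a)\<^sup>2 * (\<Sum>k<n. f k) / n + 4 * t\<^sup>2 * b\<^sup>2 / n))"
  proof -
    have "(\<Sum>i\<in>I. \<beta> i) = (\<Sum>k<n. \<Sum>b\<in>(Basis :: 'a set). t * f k * (norm a)\<^sup>2 / (n * D))"
      unfolding I_def sum.cartesian_product by (rule sum.cong) (auto simp: \<beta>_def)
    also have "\<dots> = t * (norm a)\<^sup>2 * (\<Sum>k<n. f k) / n"
    proof -
      have "(\<Sum>b\<in>(Basis :: 'a set). t * f k * (norm a)\<^sup>2 / (n * D)) = t * (norm a)\<^sup>2 / n * f k" for k
        using D by (simp flip: D_def)
      then show ?thesis by (simp add: sum_distrib_left sum_divide_distrib)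
    qed
    finally have 1: "(\<Sum>i\<in>I. \<beta> i) = t * (norm a)\<^sup>2 * (\<Sum>k<n. f k) / n" .
    \<comment> \<open>There are \<open>n * D\<close> terms of size at most
      \<open>4 * (t * b / (n * D))\<^sup>2\<close>, which leaves a single factor
      \<open>1 / n\<close>: this is where the factor \<open>n\<close> in the final exponent comes
      from.\<close>
    have "(\<Sum>i\<in>I. 4 * (\<beta> i)\<^sup>2) \<le> (\<Sum>i\<in>I. 4 * (t * b / (n * D))\<^sup>2)"
    proof (rule sum_mono)
      fix i assume i: "i \<in> I"
      have fi: "0 \<le> f (fst i)" "f (fst i) \<le> b" using f i by (auto simp: I_def)
      have "t * f (fst i) * (norm a)\<^sup>2 \<le> t * b * 1"
        using fi t a2 by (intro mult_mono) auto
      then have "\<beta> i \<le> t * b / (n * D)" "0 \<le> \<beta> i" using n D fi t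
        by (auto simp: \<beta>_def intro!: divide_right_mono)
      then show "4 * (\<beta> i)\<^sup>2 \<le> 4 * (t * b / (n * D))\<^sup>2" by (simp add: power_mono)
    qed
    also have "\<dots> = 4 * t\<^sup>2 * b\<^sup>2 / n / D"
      using n D by (simp add: I power2_eq_square flip: D_def)
    also have "\<dots> \<le> 4 * t\<^sup>2 * b\<^sup>2 / n"
      using divide_left_mono[of 1 D "4 * t\<^sup>2 * b\<^sup>2 / n"] D by simp
    finally have "(\<Sum>i\<in>I. 4 * (\<beta> i)\<^sup>2) \<le> 4 * t\<^sup>2 * b\<^sup>2 / n" .
    then show ?thesis using 1 by (intro ennreal_leI) (simp add: sum.distrib)
  qed
  finally show ?thesis .
qed

section \<open>Tail bounds for a single quadratic form\<close>

lemma haar_quadratic_measurable: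
  fixes \<mu> :: "'a::rc_field mat measure"
  assumes "haar n \<mu>"
  shows "(\<lambda>U. \<Sum>k<n. f k * (norm (coord (mop U a) k))\<^sup>2) \<in> borel_measurable \<mu>"
  using haar_coord_measurable[OF assms] by measurable

lemma haar_quadratic_tail:
  fixes \<mu> :: "'a::rc_field mat measure"
  assumes h: "haar n \<mu>" and n: "0 < n" and a: "a \<in> fspace n" "norm a \<le> 1"
    and f: "\<And>k. k < n \<Longrightarrow> 0 \<le> f k" "\<And>k. k < n \<Longrightarrow> f k \<le> b"
    and e: "0 < e" "e \<le> b"
  shows "measure \<mu> {U \<in> space \<mu>. (\<Sum>k<n. f k * (norm (coord (mop U a) k))\<^sup>2)
      - (\<Sum>k<n. f k) / n * (norm a)\<^sup>2 \<ge> e} \<le> exp (- real n * e\<^sup>2 / (16 * b\<^sup>2))"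
proof -
  interpret prob_space \<mu> using h by (simp add: haar_def)
  define q where "q U = (\<Sum>k<n. f k * (norm (coord (mop U a) k))\<^sup>2)" for U :: "'a mat"
  define m where "m = (\<Sum>k<n. f k) / n * (norm a)\<^sup>2"
  define A where "A = {U \<in> space \<mu>. q U - m \<ge> e}"
  \<comment> \<open>Markov's inequality for \<open>exp (t * q U)\<close> leaves the exponent
    \<open>- t * e + 4 * t\<^sup>2 * b\<^sup>2 / n\<close>, which is smallest at this
    \<open>t\<close>. The condition \<open>e \<le> b\<close> makes this \<open>t\<close> admissible
    in the moment bound.\<close>
  define t where "t = n * e / (8 * b\<^sup>2)"
  have b: "b > 0" using e by simp
  have t0: "0 \<le> t" using e by (simp add: t_def)
  have "4 * t * b = n * e / (2 * b)" using b by (simp add: t_def power2_eq_square)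
  also have "\<dots> \<le> n" using e b n by (simp add: field_simps)
  finally have t1: "4 * t * b \<le> n" .
  have qm: "q \<in> borel_measurable \<mu>"
    unfolding q_def by (rule haar_quadratic_measurable[OF h])
  then have A: "A \<in> sets \<mu>" unfolding A_def by measurable
  have "emeasure \<mu> A = (\<integral>\<^sup>+U. indicator A U \<partial>\<mu>)" using A by simp
  also have "\<dots> \<le> (\<integral>\<^sup>+U. ennreal (exp (- t * (m + e))) * ennreal (exp (t * q U)) \<partial>\<mu>)"
  proof (rule nn_integral_mono)
    fix U
    show "indicator A U \<le> ennreal (exp (- t * (m + e))) * ennreal (exp (t * q U))"
    proof (cases "U \<in> A")
      case True
      then have "t * (m + e) \<le> t * q U" using t0 by (intro mult_left_mono) (auto simp: A_def)
      then have "1 \<le> exp (- t * (m + e) + t * q U)" by simp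
      then show ?thesis using True by (simp flip: ennreal_mult exp_add)
    qed simp
  qed
  also have "\<dots> = ennreal (exp (- t * (m + e))) * (\<integral>\<^sup>+U. ennreal (exp (t * q U)) \<partial>\<mu>)"
    using qm by (intro nn_integral_cmult) measurable
  also have "\<dots> \<le> ennreal (exp (- t * (m + e))) * ennreal (exp (t * (norm a)\<^sup>2 * (\<Sum>k<n. f k) / n + 4 * t\<^sup>2 * b\<^sup>2 / n))"
    unfolding q_def by (intro mult_left_mono haar_exp_quadratic_le[OF h n a f t0 t1]) auto
  also have "\<dots> = ennreal (exp (- real n * e\<^sup>2 / (16 * b\<^sup>2)))"
  proof -
    have "4 * t\<^sup>2 * b\<^sup>2 / n = n * e\<^sup>2 / (16 * b\<^sup>2)" "t * e = n * e\<^sup>2 / (8 * b\<^sup>2)"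
      using n b by (auto simp: t_def power2_eq_square field_simps)
    moreover have "t * (norm a)\<^sup>2 * (\<Sum>k<n. f k) / n = t * m" by (simp add: m_def)
    ultimately have "- t * (m + e) + (t * (norm a)\<^sup>2 * (\<Sum>k<n. f k) / n + 4 * t\<^sup>2 * b\<^sup>2 / n)
      = - real n * e\<^sup>2 / (16 * b\<^sup>2)"
      by (simp add: algebra_simps)
    then show ?thesis by (simp flip: ennreal_mult exp_add)
  qed
  finally have "emeasure \<mu> A \<le> ennreal (exp (- real n * e\<^sup>2 / (16 * b\<^sup>2)))" .
  then have "measure \<mu> A \<le> exp (- real n * e\<^sup>2 / (16 * b\<^sup>2))"
    by (simp add: emeasure_eq_measure)
  then show ?thesis by (simp add: A_def q_def m_def)
qed

text \<open>Adding a constant to all weights does not change the centred form, because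
  \<open>mop U\<close> preserves the norm. Hence the weights \<open>f k + c\<close> and
  \<open>c - f k\<close>, which lie between \<open>0\<close> and \<open>2 * c\<close>, yield the
  upper and the lower tail; \<open>16 * (2 * c)\<^sup>2\<close> is the denominator
  \<open>64 * c\<^sup>2\<close>.\<close>

lemma haar_quadratic_two_sided_tail:
  fixes \<mu> :: "'a::rc_field mat measure"
  assumes h: "haar n \<mu>" and n: "0 < n" and a: "a \<in> fspace n" "norm a \<le> 1"
    and f: "\<And>k. k < n \<Longrightarrow> \<bar>f k\<bar> \<le> c" and e: "0 < e" "e \<le> 2 * c"
  shows "measure \<mu> {U \<in> space \<mu>. \<bar>(\<Sum>k<n. f k * (norm (coord (mop U a) k))\<^sup>2)
      - (\<Sum>k<n. f k) / n * (norm a)\<^sup>2\<bar> \<ge> e} \<le> 2 * exp (- real n * e\<^sup>2 / (64 * c\<^sup>2))"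
proof -
  interpret prob_space \<mu> using h by (simp add: haar_def)
  define q where "q g U = (\<Sum>k<n. g k * (norm (coord (mop U a) k))\<^sup>2) - (\<Sum>k<n. g k) / n * (norm a)\<^sup>2"
    for g and U :: "'a mat"
  define A where "A g = {U \<in> space \<mu>. q g U \<ge> e}" for g
  have A: "A g \<in> sets \<mu>" for g
    unfolding A_def q_def using haar_quadratic_measurable[OF h, of g a] by measurable
  have nrm: "(\<Sum>k<n. (norm (coord (mop U a) k))\<^sup>2) = (norm a)\<^sup>2" if "U \<in> space \<mu>" for U
    using that norm_mop_unitary[of U n n a] norm_fspace[OF mop_in_fspace[of U n n], of a] a
    by (simp add: haar_space[OF h] unitary_group_def)
  have q1: "q (\<lambda>k. f k + c) U = q f U" if "U \<in> space \<mu>" for U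
    using n nrm[OF that] by (simp add: q_def algebra_simps sum.distrib add_divide_distrib flip: sum_distrib_left)
  have q2: "q (\<lambda>k. c - f k) U = - q f U" if "U \<in> space \<mu>" for U
    using n nrm[OF that] by (simp add: q_def algebra_simps sum_subtractf diff_divide_distrib flip: sum_distrib_left)
  have bound: "measure \<mu> (A g) \<le> exp (- real n * e\<^sup>2 / (64 * c\<^sup>2))"
    if "\<And>k. k < n \<Longrightarrow> 0 \<le> g k" "\<And>k. k < n \<Longrightarrow> g k \<le> 2 * c" for g
    using haar_quadratic_tail[OF h n a that e] by (simp add: A_def q_def power_mult_distrib)
  have "{U \<in> space \<mu>. \<bar>q f U\<bar> \<ge> e} \<subseteq> A (\<lambda>k. f k + c) \<union> A (\<lambda>k. c - f k)"
    by (auto simp: A_def q1 q2)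
  then have "measure \<mu> {U \<in> space \<mu>. \<bar>q f U\<bar> \<ge> e} \<le> measure \<mu> (A (\<lambda>k. f k + c) \<union> A (\<lambda>k. c - f k))"
    using A by (intro finite_measure_mono) auto
  also have "\<dots> \<le> measure \<mu> (A (\<lambda>k. f k + c)) + measure \<mu> (A (\<lambda>k. c - f k))"
    using A by (intro measure_Un_le)
  also have "\<dots> \<le> exp (- real n * e\<^sup>2 / (64 * c\<^sup>2)) + exp (- real n * e\<^sup>2 / (64 * c\<^sup>2))"
    using f by (intro add_mono bound) (fastforce simp: abs_le_iff)+
  finally show ?thesis by (simp add: q_def)
qed

section \<open>Uniform concentration on a subspace\<close>

text \<open>Comparison with two geometric series of ratio \<open>1 / 2\<close>, from
  \<open>k\<^sup>2 \<ge> \<bar>k\<bar>\<close> and \<open>exp (- 1) \<le> 1 / 2\<close>. The bound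
  is uniform in \<open>L\<close> and is the cost per real coordinate in the count of lattice
  points.\<close>

lemma sum_exp_neg_square_le: "(\<Sum>k\<in>{- int L..int L}. exp (- (of_int k)\<^sup>2)) \<le> (4 :: real)"
proof -
  have "(\<Sum>k\<in>{- int L..int L}. exp (- (of_int k)\<^sup>2)) \<le> (\<Sum>k\<in>{- int L..int L}. (1 / 2 :: real) ^ nat \<bar>k\<bar>)"
  proof (rule sum_mono)
    fix k :: int
    have r: "real (nat \<bar>k\<bar>) = \<bar>of_int k\<bar>" by simp
    have "nat \<bar>k\<bar> \<le> (nat \<bar>k\<bar>)\<^sup>2" by (simp add: power2_nat_le_imp_le self_le_power)
    then have "real (nat \<bar>k\<bar>) \<le> (real (nat \<bar>k\<bar>))\<^sup>2" by (simp only: flip: of_nat_le_iff of_nat_power)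
    then have *: "real (nat \<bar>k\<bar>) \<le> (of_int k)\<^sup>2" unfolding r by simp
    have "exp (- (of_int k)\<^sup>2) \<le> exp (- real (nat \<bar>k\<bar>))" using * by simp
    also have "\<dots> = exp (- 1) ^ nat \<bar>k\<bar>" by (simp flip: exp_of_nat_mult)
    also have "\<dots> \<le> (1 / 2) ^ nat \<bar>k\<bar>"
    proof (rule power_mono)
      have "2 \<le> exp (1 :: real)" using exp_ge_add_one_self[of 1] by simp
      then show "exp (- 1) \<le> (1 / 2 :: real)" by (simp add: exp_minus field_simps)
    qed simp
    finally show "exp (- (of_int k)\<^sup>2) \<le> (1 / 2 :: real) ^ nat \<bar>k\<bar>" .
  qed
  also have "\<dots> \<le> (\<Sum>k\<in>int ` {..L} \<union> (\<lambda>k. - int k) ` {..L}. (1 / 2 :: real) ^ nat \<bar>k\<bar>)"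
  proof (rule sum_mono2)
    show "{- int L..int L} \<subseteq> int ` {..L} \<union> (\<lambda>k. - int k) ` {..L}"
    proof
      fix k assume "k \<in> {- int L..int L}"
      then have "(0 \<le> k \<and> k = int (nat k) \<and> nat k \<in> {..L}) \<or> (k = - int (nat (- k)) \<and> nat (- k) \<in> {..L})"
        by auto
      then show "k \<in> int ` {..L} \<union> (\<lambda>k. - int k) ` {..L}" by blast
    qed
  qed auto
  also have "\<dots> \<le> (\<Sum>k\<in>int ` {..L}. (1 / 2 :: real) ^ nat \<bar>k\<bar>) + (\<Sum>k\<in>(\<lambda>k. - int k) ` {..L}. (1 / 2 :: real) ^ nat \<bar>k\<bar>)"
    by (subst sum_Un) (auto intro!: sum_nonneg)
  also have "\<dots> = 2 * (\<Sum>k\<le>L. (1 / 2 :: real) ^ k)"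
    by (subst (1 2) sum.reindex) (auto simp: inj_on_def)
  also have "\<dots> \<le> 4"
    using sum_gp[of "1 / 2 :: real" 0 L] by (simp add: atMost_atLeast0)
  finally show ?thesis .
qed

text \<open>
  The net is the part of a scaled integer lattice in the unit ball. Its points correspond to integer
  vectors \<open>\<phi>\<close> with \<open>\<Sum>\<phi>\<^sub>i\<^sup>2 \<le> 16d\<close>, and their number is at most
  \<open>\<Sum>\<^sub>\<phi> exp (16d - \<Sum>\<phi>\<^sub>i\<^sup>2)\<close>, which factorises.
\<close>

lemma unit_ball_net:
  obtains S :: "'a::rc_field fvec set"
  where "finite S" "real (card S) \<le> exp (18 * real (m * DIM('a)))" "S \<subseteq> fspace m"
    "\<And>a. a \<in> S \<Longrightarrow> norm a \<le> 1"
    "\<And>x. x \<in> fspace m \<Longrightarrow> norm x \<le> 1 \<Longrightarrow> \<exists>a\<in>S. norm (x - a) \<le> 1 / 4"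
proof -
  define I where "I = {..<m} \<times> (Basis :: 'a set)"
  define d where "d = m * DIM('a)"
  have I: "finite I" "card I = d" by (auto simp: I_def d_def card_cartesian_product)
  \<comment> \<open>The mesh is chosen so that an error of at most \<open>h\<close> in each of the
    \<open>d\<close> real coordinates has norm at most \<open>h * sqrt d = 1 / 4\<close>. The unit
    ball then corresponds to integer vectors with sum of squares at most
    \<open>16 * d\<close>.\<close>
  define h where "h = 1 / (4 * sqrt d)"
  \<comment> \<open>This cutoff only makes the index set finite: an integer whose square is at most
    \<open>16 * d\<close> has absolute value at most \<open>16 * d\<close>.\<close>
  define L where "L = 16 * d"
  define \<Phi> where "\<Phi> = {\<phi> \<in> PiE I (\<lambda>_. {- int L..int L}). (\<Sum>i\<in>I. (real_of_int (\<phi> i))\<^sup>2) \<le> 16 * d}"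
  define p where "p \<phi> = (basis_fvec m (\<lambda>i. h * of_int (\<phi> i)) :: 'a fvec)" for \<phi>
  have fin: "finite (PiE I (\<lambda>_. {- int L..int L}))" using I by (intro finite_PiE) auto
  then have fin\<Phi>: "finite \<Phi>" unfolding \<Phi>_def by simp
  have hd: "h\<^sup>2 * (16 * d) = 1" if "d > 0" using that by (simp add: h_def power_mult_distrib power_divide)
  have np: "(norm (p \<phi>))\<^sup>2 = h\<^sup>2 * (\<Sum>i\<in>I. (real_of_int (\<phi> i))\<^sup>2)" for \<phi>
    by (simp add: p_def norm_basis_fvec power_mult_distrib sum_distrib_left flip: I_def)
  show ?thesis
  proof (rule that[of "p ` \<Phi>"])
    show "finite (p ` \<Phi>)" "p ` \<Phi> \<subseteq> fspace m" using fin\<Phi> by (auto simp: p_def)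
    have "real (card (p ` \<Phi>)) \<le> real (card \<Phi>)" using card_image_le[OF fin\<Phi>] by simp
    also have "\<dots> = (\<Sum>\<phi>\<in>\<Phi>. 1)" by simp
    also have "\<dots> \<le> (\<Sum>\<phi>\<in>\<Phi>. exp (16 * d) * (\<Prod>i\<in>I. exp (- (real_of_int (\<phi> i))\<^sup>2)))"
    proof (rule sum_mono)
      fix \<phi> assume "\<phi> \<in> \<Phi>"
      then have "1 \<le> exp (16 * d + (\<Sum>i\<in>I. - (real_of_int (\<phi> i))\<^sup>2))"
        by (simp add: \<Phi>_def sum_negf)
      then show "1 \<le> exp (16 * d) * (\<Prod>i\<in>I. exp (- (real_of_int (\<phi> i))\<^sup>2))"
        using I by (simp add: exp_add exp_sum)
    qed
    also have "\<dots> \<le> (\<Sum>\<phi>\<in>PiE I (\<lambda>_. {- int L..int L}). exp (16 * d) * (\<Prod>i\<in>I. exp (- (real_of_int (\<phi> i))\<^sup>2)))"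
      using fin by (intro sum_mono2) (auto simp: \<Phi>_def intro!: mult_nonneg_nonneg prod_nonneg)
    also have "\<dots> = exp (16 * d) * (\<Prod>i\<in>I. \<Sum>k\<in>{- int L..int L}. exp (- (real_of_int k)\<^sup>2))"
      using I by (subst prod_sum_PiE) (auto simp: sum_distrib_left)
    also have "\<dots> \<le> exp (16 * d) * (\<Prod>i\<in>I. 4)"
      using sum_exp_neg_square_le[of L] by (intro mult_left_mono prod_mono) (auto intro!: sum_nonneg)
    also have "\<dots> = exp (16 * d) * 4 ^ d" using I by simp
    also have "\<dots> \<le> exp (16 * d) * exp 2 ^ d"
    proof -
      have "2 \<le> exp (1 :: real)" using exp_ge_add_one_self[of 1] by simp
      then have "2 * 2 \<le> exp (1 :: real) * exp 1" by (intro mult_mono) auto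
      then have "4 \<le> exp (2 :: real)" by (simp flip: exp_add)
      then show ?thesis by (intro mult_left_mono power_mono) auto
    qed
    also have "\<dots> = exp (18 * real (m * DIM('a)))"
      by (simp add: d_def flip: exp_of_nat_mult exp_add)
    finally show "real (card (p ` \<Phi>)) \<le> exp (18 * real (m * DIM('a)))" .
    show "norm a \<le> 1" if "a \<in> p ` \<Phi>" for a
    proof -
      obtain \<phi> where \<phi>: "a = p \<phi>" "\<phi> \<in> \<Phi>" using \<open>a \<in> p ` \<Phi>\<close> by auto
      have "(norm a)\<^sup>2 \<le> 1\<^sup>2"
      proof (cases "d = 0")
        case True
        then have "I = {}" using I by auto
        then show ?thesis by (simp add: \<phi> np)
      next
        case False
        have "(norm a)\<^sup>2 \<le> h\<^sup>2 * (16 * d)"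
          unfolding \<phi>(1) np using \<phi>(2) by (intro mult_left_mono) (auto simp: \<Phi>_def)
        then show ?thesis using hd False by simp
      qed
      then show ?thesis by (rule power2_le_imp_le) simp
    qed
    show "\<exists>a\<in>p ` \<Phi>. norm (x - a) \<le> 1 / 4" if x: "x \<in> fspace m" "norm x \<le> 1" for x
    proof (cases "d = 0")
      case True
      then have "I = {}" using I by auto
      then have "x = 0" using norm_fspace_Basis[OF x(1)] by (simp flip: I_def)
      \<comment> \<open>Without coordinates the extensional product contains just the undefined
        function, and the net consists of the zero vector.\<close>
      moreover have "(\<lambda>_. undefined) \<in> \<Phi>" using \<open>I = {}\<close> by (simp add: \<Phi>_def)
      ultimately show ?thesis
        using np[of "\<lambda>_. undefined"] \<open>I = {}\<close> by (intro bexI[of _ "p (\<lambda>_. undefined)"]) auto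
    next
      case False
      then have h: "h > 0" by (simp add: h_def)
      define y where "y i = inner (coord x (fst i)) (snd i)" for i
      \<comment> \<open>Rounding is towards zero, so that no coordinate grows in absolute value and
        the lattice point stays in the unit ball.\<close>
      define \<phi> where "\<phi> = restrict (\<lambda>i. if 0 \<le> y i then \<lfloor>y i / h\<rfloor> else - \<lfloor>- y i / h\<rfloor>) I"
      have rnd: "\<bar>h * of_int (\<phi> i)\<bar> \<le> \<bar>y i\<bar>" "\<bar>y i - h * of_int (\<phi> i)\<bar> \<le> h" if "i \<in> I" for i
      proof -
        have fl: "0 \<le> h * of_int \<lfloor>z / h\<rfloor> \<and> h * of_int \<lfloor>z / h\<rfloor> \<le> z \<and> z \<le> h * of_int \<lfloor>z / h\<rfloor> + h"
          if "0 \<le> z" for z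
        proof -
          have "of_int \<lfloor>z / h\<rfloor> \<le> z / h" "z / h \<le> of_int \<lfloor>z / h\<rfloor> + 1" "0 \<le> \<lfloor>z / h\<rfloor>"
            using h that of_int_floor_le[of "z / h"] real_of_int_floor_add_one_ge[of "z / h"] by auto
          then have "h * of_int \<lfloor>z / h\<rfloor> \<le> h * (z / h)" "h * (z / h) \<le> h * (of_int \<lfloor>z / h\<rfloor> + 1)"
            "0 \<le> h * of_int \<lfloor>z / h\<rfloor>"
            using h by (simp_all only: mult_le_cancel_left_pos) simp
          then show ?thesis using h by (simp add: algebra_simps)
        qed
        show "\<bar>h * of_int (\<phi> i)\<bar> \<le> \<bar>y i\<bar>" "\<bar>y i - h * of_int (\<phi> i)\<bar> \<le> h"
          using fl[of "y i"] fl[of "- y i"] that by (auto simp: \<phi>_def)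
      qed
      have nx: "(norm x)\<^sup>2 = (\<Sum>i\<in>I. (y i)\<^sup>2)"
        unfolding norm_fspace_Basis[OF x(1)] I_def by (rule sum.cong) (auto simp: y_def)
      have "h\<^sup>2 * (\<Sum>i\<in>I. (real_of_int (\<phi> i))\<^sup>2) = (\<Sum>i\<in>I. (h * of_int (\<phi> i))\<^sup>2)"
        by (simp add: power_mult_distrib sum_distrib_left)
      also have "\<dots> \<le> (\<Sum>i\<in>I. (y i)\<^sup>2)"
        using rnd(1) by (intro sum_mono) (simp add: abs_le_square_iff)
      also have "\<dots> \<le> 1" using x(2) by (simp add: power_le_one flip: nx)
      also have "1 = h\<^sup>2 * (16 * d)" using hd False by simp
      finally have s: "(\<Sum>i\<in>I. (real_of_int (\<phi> i))\<^sup>2) \<le> 16 * d" using h by simp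
      have "\<phi> i \<in> {- int L..int L}" if "i \<in> I" for i
      proof -
        have "(real_of_int (\<phi> i))\<^sup>2 \<le> (\<Sum>i\<in>I. (real_of_int (\<phi> i))\<^sup>2)"
          using I that by (intro member_le_sum) auto
        then have "real_of_int ((\<phi> i)\<^sup>2) \<le> real_of_int (int L)" using s by (simp add: L_def)
        then have "(\<phi> i)\<^sup>2 \<le> int L" by (simp only: of_int_le_iff)
        moreover have "\<bar>\<phi> i\<bar> \<le> (\<phi> i)\<^sup>2"
          using self_le_power[of "\<bar>\<phi> i\<bar>" 2] by (cases "\<phi> i = 0") auto
        ultimately show ?thesis by auto
      qed
      then have \<phi>: "\<phi> \<in> \<Phi>" using s by (auto simp: \<Phi>_def \<phi>_def PiE_iff)
      have "(norm (x - p \<phi>))\<^sup>2 = (\<Sum>i\<in>I. (y i - h * of_int (\<phi> i))\<^sup>2)"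
        unfolding norm_fspace_Basis[OF fspace_closed(2)[OF x(1), of "p \<phi>", unfolded p_def, OF basis_fvec_in_fspace], folded p_def] I_def
        by (rule sum.cong) (auto simp: y_def p_def basis_fvec_def lookup_minus inner_diff_left inner_sum_left_Basis)
      also have "\<dots> \<le> (\<Sum>i\<in>I. h\<^sup>2)"
        using rnd(2) h by (intro sum_mono) (simp add: abs_le_square_iff[symmetric])
      also have "\<dots> = (1 / 4)\<^sup>2" using False by (simp add: I h_def power_divide power_mult_distrib)
      finally have "norm (x - p \<phi>) \<le> 1 / 4" by (rule power2_le_imp_le) simp
      then show ?thesis using \<phi> by blast
    qed
  qed
qed

text \<open>Polarization together with the parallelogram law gives the bound with
  \<open>((norm x)\<^sup>2 + (norm y)\<^sup>2) / 2\<close> in place of the product; rescaling both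
  vectors to norm one turns it into the product.\<close>

lemma bilinear_form_polarization:
  fixes B :: "'e::real_inner \<Rightarrow> 'e \<Rightarrow> real"
  assumes B: "bilinear B" and sym: "\<And>x y. B x y = B y x"
    and S: "Real_Vector_Spaces.subspace S"
    and bound: "\<And>x. x \<in> S \<Longrightarrow> \<bar>B x x\<bar> \<le> s * (norm x)\<^sup>2"
    and xy: "x \<in> S" "y \<in> S"
  shows "\<bar>B x y\<bar> \<le> s * norm x * norm y"
proof (cases "x = 0 \<or> y = 0")
  case True
  then show ?thesis using bilinear_lzero[OF B] bilinear_rzero[OF B] by auto
next
  case False
  have *: "\<bar>B x y\<bar> \<le> s * ((norm x)\<^sup>2 + (norm y)\<^sup>2) / 2" if "x \<in> S" "y \<in> S" for x y
  proof -
    have "B (x + y) (x + y) - B (x - y) (x - y) = 4 * B x y"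
      using sym[of y x] by (simp add: bilinear_ladd[OF B] bilinear_radd[OF B] bilinear_lsub[OF B] bilinear_rsub[OF B])
    moreover have "\<bar>B (x + y) (x + y)\<bar> \<le> s * (norm (x + y))\<^sup>2" "\<bar>B (x - y) (x - y)\<bar> \<le> s * (norm (x - y))\<^sup>2"
      using that S by (auto intro!: bound Real_Vector_Spaces.subspace_add Real_Vector_Spaces.subspace_diff)
    moreover have "s * (norm (x + y))\<^sup>2 + s * (norm (x - y))\<^sup>2 = 2 * (s * ((norm x)\<^sup>2 + (norm y)\<^sup>2))"
      unfolding power2_norm_eq_inner inner_add_left inner_add_right inner_diff_left inner_diff_right
      by (simp add: algebra_simps)
    ultimately show ?thesis by linarith
  qed
  define a where "a = 1 / norm x"
  define b where "b = 1 / norm y"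
  have "\<bar>B (a *\<^sub>R x) (b *\<^sub>R y)\<bar> \<le> s * ((norm (a *\<^sub>R x))\<^sup>2 + (norm (b *\<^sub>R y))\<^sup>2) / 2"
    using xy S by (intro *) (auto intro: Real_Vector_Spaces.subspace_scale)
  also have "\<dots> = s" using False by (simp add: a_def b_def)
  finally have "\<bar>B x y\<bar> / (norm x * norm y) \<le> s"
    by (simp add: bilinear_lmul[OF B] bilinear_rmul[OF B] a_def b_def abs_mult mult.commute)
  then show ?thesis using False by (simp add: field_simps)
qed

text \<open>If \<open>s\<close> is the supremum of the form on the unit ball and \<open>a\<close> is
  a net point near \<open>u\<close>, then \<open>B u u - B a a = B (u - a) (u + a)\<close> is at
  most \<open>s * (1 / 4) * 2\<close>, so \<open>s \<le> \<eta> + s / 2\<close>. The bound with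
  \<open>K\<close> only ensures that the supremum is finite.\<close>

lemma bilinear_form_net_bound:
  fixes B :: "'e::real_inner \<Rightarrow> 'e \<Rightarrow> real"
  assumes B: "bilinear B" and sym: "\<And>x y. B x y = B y x"
    and S: "Real_Vector_Spaces.subspace S"
    and K: "\<And>x. x \<in> S \<Longrightarrow> \<bar>B x x\<bar> \<le> K * (norm x)\<^sup>2"
    and N: "N \<subseteq> S" "\<And>a. a \<in> N \<Longrightarrow> norm a \<le> 1" "\<And>a. a \<in> N \<Longrightarrow> \<bar>B a a\<bar> \<le> \<eta>"
      "\<And>x. x \<in> S \<Longrightarrow> norm x \<le> 1 \<Longrightarrow> \<exists>a\<in>N. norm (x - a) \<le> 1 / 4"
    and x: "x \<in> S"
  shows "\<bar>B x x\<bar> \<le> 2 * \<eta> * (norm x)\<^sup>2"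
proof -
  define T where "T = {x \<in> S. norm x \<le> 1}"
  define s where "s = (SUP x\<in>T. \<bar>B x x\<bar>)"
  have 0: "0 \<in> T" using S by (simp add: T_def Real_Vector_Spaces.subspace_0)
  have "\<bar>B x x\<bar> \<le> \<bar>K\<bar>" if "x \<in> T" for x
  proof -
    have "\<bar>B x x\<bar> \<le> K * (norm x)\<^sup>2" using K that by (simp add: T_def)
    also have "\<dots> \<le> \<bar>K\<bar> * 1" using that by (intro mult_mono) (auto simp: T_def power_le_one)
    finally show ?thesis by simp
  qed
  then have bdd: "bdd_above ((\<lambda>x. \<bar>B x x\<bar>) ` T)" by (intro bdd_aboveI2)
  have le_s: "\<bar>B x x\<bar> \<le> s" if "x \<in> T" for x
    unfolding s_def by (rule cSUP_upper[OF that bdd])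
  have s: "\<bar>B x x\<bar> \<le> s * (norm x)\<^sup>2" if "x \<in> S" for x
  proof (cases "x = 0")
    case False
    have "(1 / norm x) *\<^sub>R x \<in> T"
      using False that S by (auto simp: T_def intro: Real_Vector_Spaces.subspace_scale)
    from le_s[OF this] show ?thesis using False
      by (simp add: bilinear_lmul[OF B] bilinear_rmul[OF B] field_simps power2_eq_square abs_mult)
  qed (simp add: bilinear_lzero[OF B])
  have "s \<le> \<eta> + s / 2"
    unfolding s_def
  proof (rule cSUP_least)
    fix u assume u: "u \<in> T"
    then obtain a where a: "a \<in> N" "norm (u - a) \<le> 1 / 4" using N(4) by (auto simp: T_def)
    have uS: "u \<in> S" "norm u \<le> 1" and aS: "a \<in> S" "norm a \<le> 1" using u a N by (auto simp: T_def)
    have "B u u - B a a = B (u - a) (u + a)"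
      using sym[of u a] by (simp add: bilinear_ladd[OF B] bilinear_radd[OF B] bilinear_lsub[OF B] bilinear_rsub[OF B])
    moreover have "\<bar>B (u - a) (u + a)\<bar> \<le> s * norm (u - a) * norm (u + a)"
      using uS aS S by (intro bilinear_form_polarization[OF B sym S s])
        (auto intro: Real_Vector_Spaces.subspace_add Real_Vector_Spaces.subspace_diff)
    moreover have "s * norm (u - a) * norm (u + a) \<le> s * (1 / 4) * 2"
    proof (intro mult_mono)
      show "norm (u + a) \<le> 2" using norm_triangle_ineq[of u a] uS aS by simp
      show "0 \<le> s" using le_s[OF 0] by simp
      then show "0 \<le> s * (1 / 4)" by simp
    qed (use a in auto)
    moreover have "\<bar>B a a\<bar> \<le> \<eta>" using a N by simp
    ultimately show "\<bar>B u u\<bar> \<le> \<eta> + (SUP x\<in>T. \<bar>B x x\<bar>) / 2" unfolding s_def[symmetric] by linarith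
  qed (use 0 in auto)
  then have "s \<le> 2 * \<eta>" by simp
  then have "s * (norm x)\<^sup>2 \<le> 2 * \<eta> * (norm x)\<^sup>2" by (intro mult_right_mono) auto
  then show ?thesis using s[OF x] by simp
qed

text \<open>A union bound over the net, with error \<open>e / 2\<close> at the net points because
  passing to all vectors doubles it; this turns \<open>64\<close> into \<open>256\<close>. The event
  is the complement of finitely many measurable sets, so no measurability of the supremum over all
  \<open>x\<close> has to be shown. The matrix \<open>Q\<close> will be the adjoint of an eigenbasis
  of \<open>H\<close>, which makes the form diagonal.\<close>

lemma haar_compression_event:
  fixes \<mu> :: "'a::rc_field mat measure"
  assumes h: "haar n \<mu>" and n: "0 < n" and Q: "Q \<in> unitary_group n"
    and V: "V \<in> carrier_mat n m" "mat_adjoint V * V = 1\<^sub>m m"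
    and f: "\<And>k. k < n \<Longrightarrow> \<bar>f k\<bar> \<le> c" and e: "0 < e" "e \<le> 4 * c"
  obtains E where "E \<in> sets \<mu>"
    "measure \<mu> E \<ge> 1 - 2 * exp (18 * real (m * DIM('a)) - real n * e\<^sup>2 / (256 * c\<^sup>2))"
    "\<And>U x. U \<in> E \<Longrightarrow> x \<in> fspace m \<Longrightarrow>
      \<bar>(\<Sum>k<n. f k * (norm (coord (mop (Q * U) (mop V x)) k))\<^sup>2) - (\<Sum>k<n. f k) / n * (norm x)\<^sup>2\<bar> \<le> e * (norm x)\<^sup>2"
proof -
  interpret prob_space \<mu> using h by (simp add: haar_def)
  obtain S :: "'a fvec set" where S: "finite S" "real (card S) \<le> exp (18 * real (m * DIM('a)))"
    "S \<subseteq> fspace m" "\<And>a. a \<in> S \<Longrightarrow> norm a \<le> 1"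
    "\<And>x. x \<in> fspace m \<Longrightarrow> norm x \<le> 1 \<Longrightarrow> \<exists>a\<in>S. norm (x - a) \<le> 1 / 4"
    using unit_ball_net[of m] by metis
  define q where "q a U = (\<Sum>k<n. f k * (norm (coord (mop U (mop V a)) k))\<^sup>2) - (\<Sum>k<n. f k) / n * (norm a)\<^sup>2"
    for a and U :: "'a mat"
  define bad where "bad a = {U \<in> space \<mu>. \<bar>q a U\<bar> \<ge> e / 2}" for a
  \<comment> \<open>By left invariance this event has the probability of \<open>bad a\<close>, to
    which the tail bound applies.\<close>
  define bad' where "bad' a = {U \<in> space \<mu>. \<bar>q a (Q * U)\<bar> \<ge> e / 2}" for a
  have qm: "q a \<in> borel_measurable \<mu>" for a
    unfolding q_def using haar_quadratic_measurable[OF h, of f "mop V a"] by measurable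
  then have bad: "bad a \<in> sets \<mu>" for a unfolding bad_def by measurable
  have pre: "bad' a = (\<lambda>U. Q * U) -` bad a \<inter> space \<mu>" for a
    using unitary_group_mult[OF Q] by (auto simp: bad'_def bad_def haar_space[OF h])
  have bad': "bad' a \<in> sets \<mu>" for a
    unfolding pre by (rule measurable_sets[OF haar_translate_measurable[OF h Q] bad])
  have "measure \<mu> (bad' a) \<le> 2 * exp (- real n * e\<^sup>2 / (256 * c\<^sup>2))" if a: "a \<in> S" for a
  proof -
    have aS: "a \<in> fspace m" using a S by auto
    have na: "norm (mop V a) = norm a" by (rule norm_mop_unitary[OF V aS])
    have "measure \<mu> (bad a) = measure (distr \<mu> \<mu> (\<lambda>U. Q * U)) (bad a)"
      using h Q by (simp add: haar_def)
    also have "\<dots> = measure \<mu> (bad' a)"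
      unfolding pre by (rule measure_distr[OF haar_translate_measurable[OF h Q] bad])
    finally have "measure \<mu> (bad' a) = measure \<mu> (bad a)" by simp
    also have "\<dots> \<le> 2 * exp (- real n * (e / 2)\<^sup>2 / (64 * c\<^sup>2))"
      unfolding bad_def q_def na[symmetric]
      by (rule haar_quadratic_two_sided_tail[OF h n mop_in_fspace[OF V(1)] _ f]) (use S(4)[OF a] na e in auto)
    finally show ?thesis by (simp add: power_divide)
  qed
  then have "measure \<mu> (\<Union>a\<in>S. bad' a) \<le> (\<Sum>a\<in>S. 2 * exp (- real n * e\<^sup>2 / (256 * c\<^sup>2)))"
    using S(1) bad' by (intro order_trans[OF measure_UNION_le] sum_mono) auto
  also have "\<dots> = real (card S) * (2 * exp (- real n * e\<^sup>2 / (256 * c\<^sup>2)))" by simp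
  also have "\<dots> \<le> exp (18 * real (m * DIM('a))) * (2 * exp (- real n * e\<^sup>2 / (256 * c\<^sup>2)))"
    using S(2) by (intro mult_right_mono) auto
  also have "\<dots> = 2 * exp (18 * real (m * DIM('a)) - real n * e\<^sup>2 / (256 * c\<^sup>2))"
    by (simp add: exp_diff exp_minus field_simps)
  finally have meas: "measure \<mu> (\<Union>a\<in>S. bad' a) \<le> 2 * exp (18 * real (m * DIM('a)) - real n * e\<^sup>2 / (256 * c\<^sup>2))" .
  have UN: "(\<Union>a\<in>S. bad' a) \<in> sets \<mu>" using S(1) bad' by auto
  show ?thesis
  proof (rule that[of "space \<mu> - (\<Union>a\<in>S. bad' a)"])
    show "space \<mu> - (\<Union>a\<in>S. bad' a) \<in> sets \<mu>" using UN by auto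
    show "1 - 2 * exp (18 * real (m * DIM('a)) - real n * e\<^sup>2 / (256 * c\<^sup>2)) \<le> measure \<mu> (space \<mu> - (\<Union>a\<in>S. bad' a))"
      using meas prob_compl[OF UN] by simp
    fix U x assume U: "U \<in> space \<mu> - (\<Union>a\<in>S. bad' a)" and x: "x \<in> (fspace m :: 'a fvec set)"
    have Ug: "Q * U \<in> unitary_group n" using U unitary_group_mult[OF Q] by (auto simp: haar_space[OF h])
    note W = unitary_groupD[OF Ug]
    define L where "L x = mop (Q * U) (mop V x)" for x
    define M where "M = (\<Sum>k<n. f k) / n"
    define B where "B x y = (\<Sum>k<n. f k * inner (coord (L x) k) (coord (L y) k)) - M * inner x y" for x y
    have L: "L (x + y) = L x + L y" "L (r *\<^sub>R x) = r *\<^sub>R L x" for x y r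
      by (simp_all add: L_def mop_add mop_scaleR)
    have Lx: "L x \<in> fspace n" for x unfolding L_def by (rule mop_in_fspace[OF W(1)])
    have nL: "norm (L x) = norm x" if "x \<in> fspace m" for x
      using norm_mop_unitary[OF W(1,2) mop_in_fspace[OF V(1)]] norm_mop_unitary[OF V that] by (simp add: L_def)
    have bil: "bilinear B"
      unfolding bilinear_def
      by (intro conjI allI linearI)
        (simp_all add: B_def L lookup_add inner_add_left inner_add_right algebra_simps sum.distrib sum_distrib_left)
    have Bxx: "B x x = (\<Sum>k<n. f k * (norm (coord (L x) k))\<^sup>2) - M * (norm x)\<^sup>2" for x
      by (simp add: B_def power2_norm_eq_inner)
    have "\<bar>B x x\<bar> \<le> 2 * (e / 2) * (norm x)\<^sup>2"
    proof (rule bilinear_form_net_bound[OF bil _ subspace_fspace _ S(3,4) _ S(5) x])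
      show "B x y = B y x" for x y by (simp add: B_def inner_commute)
      show "\<bar>B x x\<bar> \<le> (\<bar>c\<bar> + \<bar>M\<bar>) * (norm x)\<^sup>2" if "x \<in> fspace m" for x
      proof -
        have "\<bar>\<Sum>k<n. f k * (norm (coord (L x) k))\<^sup>2\<bar> \<le> (\<Sum>k<n. \<bar>c\<bar> * (norm (coord (L x) k))\<^sup>2)"
          using f by (intro order_trans[OF sum_abs] sum_mono) (fastforce simp: abs_mult intro!: mult_right_mono)
        also have "\<dots> = \<bar>c\<bar> * (norm x)\<^sup>2"
          by (simp add: norm_fspace[OF Lx] flip: sum_distrib_left nL[OF that])
        finally have "\<bar>\<Sum>k<n. f k * (norm (coord (L x) k))\<^sup>2\<bar> \<le> \<bar>c\<bar> * (norm x)\<^sup>2" .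
        moreover have "\<bar>M * (norm x)\<^sup>2\<bar> = \<bar>M\<bar> * (norm x)\<^sup>2" by (simp add: abs_mult)
        ultimately show ?thesis unfolding Bxx by (simp add: distrib_right)
      qed
      show "\<bar>B a a\<bar> \<le> e / 2" if "a \<in> S" for a
        using U that by (auto simp: Bxx bad'_def q_def L_def M_def)
    qed
    then show "\<bar>(\<Sum>k<n. f k * (norm (coord (mop (Q * U) (mop V x)) k))\<^sup>2) - (\<Sum>k<n. f k) / n * (norm x)\<^sup>2\<bar> \<le> e * (norm x)\<^sup>2"
      by (simp add: Bxx L_def M_def)
  qed
qed

section \<open>The deterministic spiked model\<close>

text \<open>Each equation may come from its own matrix. This is the form needed for intersecting a
  spectral subspace with a coordinate subspace of the range of \<open>V\<close>.\<close>

lemma homogeneous_mop_system: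
  fixes C :: "nat \<Rightarrow> 'a::rc_field mat"
  assumes k: "k < n" and C: "\<And>r. r < n \<Longrightarrow> r \<noteq> k \<Longrightarrow> C r \<in> carrier_mat (d r) n"
  obtains x where "x \<in> fspace n" "x \<noteq> 0" "\<And>r. r < n \<Longrightarrow> r \<noteq> k \<Longrightarrow> coord (mop (C r) x) (i r) = 0"
proof -
  obtain x where x: "x \<in> fspace n" "x \<noteq> 0"
    "\<And>r. r < n \<Longrightarrow> r \<noteq> k \<Longrightarrow> (\<Sum>j<n. C r $$ (i r, j) * coord x j) = 0"
    using homogeneous_system_nontrivial[OF k, of "\<lambda>r j. C r $$ (i r, j)"] by metis
  show ?thesis
  proof (rule that[OF x(1,2)])
    show "coord (mop (C r) x) (i r) = 0" if "r < n" "r \<noteq> k" for r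
      using x(3)[OF that] by (simp add: coord_mop[OF C[OF that]])
  qed
qed

definition fdiag :: "nat \<Rightarrow> (nat \<Rightarrow> real) \<Rightarrow> 'a::rc_field fvec \<Rightarrow> 'a fvec" where
  "fdiag n f x = fvec n (\<lambda>k. f k *\<^sub>R coord x k)"

lemma mop_mat_diag_of_real: "mop (mat_diag n (\<lambda>k. of_real (f k))) x = fdiag n f x"
  by (simp add: mop_mat_diag fdiag_def scaleR_conv_of_real)

lemma fdiag_in_fspace [simp]: "fdiag n f x \<in> fspace n"
  by (simp add: fdiag_def)

lemma coord_fdiag [simp]: "coord (fdiag n f x) k = (if k < n then f k *\<^sub>R coord x k else 0)"
  by (simp add: fdiag_def)

lemma fdiag_fdiag: "fdiag n f (fdiag n g x) = fdiag n (\<lambda>k. f k * g k) x"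
  by (rule fvec_eqI) simp

lemma fdiag_one: "(\<And>k. k < n \<Longrightarrow> f k = 1) \<Longrightarrow> x \<in> fspace n \<Longrightarrow> fdiag n f x = x"
  by (rule fvec_eqI) (auto simp: fspace_def)

lemma inner_fdiag: "inner x (fdiag n f y) = (\<Sum>k<n. f k * inner (coord x k) (coord y k))"
proof -
  have "inner x (fdiag n f y) = inner (fdiag n f y) x" by (rule inner_commute)
  also have "\<dots> = (\<Sum>k<n. f k * inner (coord y k) (coord x k))"
    by (simp add: inner_fspace[OF fdiag_in_fspace])
  also have "\<dots> = (\<Sum>k<n. f k * inner (coord x k) (coord y k))"
    by (intro sum.cong refl arg_cong2[of _ _ _ _ "(*)"] inner_commute)
  finally show ?thesis .
qed

lemma norm_fdiag_le:
  assumes "\<And>k. k < n \<Longrightarrow> \<bar>f k\<bar> \<le> K" "x \<in> fspace n"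
  shows "norm (fdiag n f x) \<le> K * norm x"
proof (cases "n = 0")
  case True
  then have "fdiag n f x = 0" "x = 0" using assms(2) by (auto intro!: fvec_eqI simp: fspace_def)
  then show ?thesis by simp
next
  case False
  then have K: "0 \<le> K" using assms(1)[of 0] by auto
  have "(norm (fdiag n f x))\<^sup>2 \<le> (\<Sum>k<n. (K * norm (coord x k))\<^sup>2)"
    unfolding norm_fspace[OF fdiag_in_fspace]
    by (intro sum_mono power_mono) (auto intro!: mult_right_mono assms(1))
  also have "\<dots> = (K * norm x)\<^sup>2"
    by (simp add: power_mult_distrib norm_fspace[OF assms(2)] sum_distrib_left)
  finally show ?thesis by (rule power2_le_imp_le) (use K in simp)
qed

text \<open>
  For \<open>Y = Q\<^sup>*U\<close> with \<open>H = Q diag(ls) Q\<^sup>*\<close>, the matrix \<open>fc f\<close> is \<open>f(U\<^sup>*HU)\<close>. Likewise \<open>bump d\<close> acts on the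
  columns of \<open>V\<close> by the factors \<open>d\<close> and is the identity on their orthogonal complement, so that
  \<open>bump root\<close> is \<open>(1 + P)\<^sup>1\<^sup>/\<^sup>2\<close> and \<open>Wop\<close> is the operator of \<open>W\<close>.
\<close>

locale spiked_model =
  fixes n m :: nat and Y V :: "'a::rc_field mat" and ls \<theta> :: "nat \<Rightarrow> real"
  assumes Y: "Y \<in> unitary_group n"
    and V: "V \<in> carrier_mat n m" "mat_adjoint V * V = 1\<^sub>m m"
    and \<theta>_gt: "\<And>j. j < m \<Longrightarrow> -1 < \<theta> j"
begin

definition fc :: "(nat \<Rightarrow> real) \<Rightarrow> 'a mat" where
  "fc f = mat_adjoint Y * (mat_diag n (\<lambda>k. of_real (f k)) * Y)"

definition bump :: "(nat \<Rightarrow> real) \<Rightarrow> 'a mat" where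
  "bump d = 1\<^sub>m n + V * (mat_diag m (\<lambda>j. of_real (d j - 1)) * mat_adjoint V)"

definition root :: "nat \<Rightarrow> real" where "root j = sqrt (1 + \<theta> j)"

abbreviation Vo :: "'a fvec \<Rightarrow> 'a fvec" where "Vo \<equiv> mop V"
abbreviation Vs :: "'a fvec \<Rightarrow> 'a fvec" where "Vs \<equiv> mop (mat_adjoint V)"

definition Wop :: "'a fvec \<Rightarrow> 'a fvec" where
  "Wop v = mop (bump root) (mop (fc ls) (mop (bump root) v))"

lemmas Yc = unitary_groupD[OF Y]

lemma Vadj: "mat_adjoint V \<in> carrier_mat m n" using V(1) by simp

lemma fc_carrier: "fc f \<in> carrier_mat n n"
  unfolding fc_def
  by (rule mult_carrier_mat[OF mat_adjoint_carrier[OF Yc(1)] mult_carrier_mat[OF mat_diag_dim Yc(1)]])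

lemma bump_carrier: "bump d \<in> carrier_mat n n"
  unfolding bump_def
  by (rule add_carrier_mat[OF mult_carrier_mat[OF V(1) mult_carrier_mat[OF mat_diag_dim Vadj]]])

lemma Vo_in [simp]: "Vo x \<in> fspace n" by (rule mop_in_fspace[OF V(1)])
lemma Vs_in [simp]: "Vs x \<in> fspace m" by (rule mop_in_fspace[OF Vadj])
lemma fc_in [simp]: "mop (fc f) x \<in> fspace n" by (rule mop_in_fspace[OF fc_carrier])
lemma bump_in [simp]: "mop (bump d) x \<in> fspace n" by (rule mop_in_fspace[OF bump_carrier])
lemma Y_in [simp]: "mop Y x \<in> fspace n" by (rule mop_in_fspace[OF Yc(1)])

lemma mop_fc: "mop (fc f) x = mop (mat_adjoint Y) (fdiag n f (mop Y x))"
  unfolding fc_def mop_mult[OF mat_adjoint_carrier[OF Yc(1)] mult_carrier_mat[OF mat_diag_dim Yc(1)]]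
    mop_mult[OF mat_diag_dim Yc(1)] mop_mat_diag_of_real ..

lemma Y_fc: "mop Y (mop (fc f) x) = fdiag n f (mop Y x)"
proof -
  have "mop Y (mop (mat_adjoint Y) y) = y" if "y \<in> fspace n" for y
    using mop_mult[OF Yc(1) mat_adjoint_carrier[OF Yc(1)], of y] Yc(3) that by (simp add: mop_one)
  then show ?thesis by (simp add: mop_fc)
qed

lemma fc_fc: "mop (fc f) (mop (fc g) x) = mop (fc (\<lambda>k. f k * g k)) x"
  by (simp add: mop_fc[of f "mop (fc g) x"] Y_fc fdiag_fdiag) (simp add: mop_fc)

lemma fc_one: "(\<And>k. k < n \<Longrightarrow> f k = 1) \<Longrightarrow> x \<in> fspace n \<Longrightarrow> mop (fc f) x = x"
  by (simp add: mop_fc fdiag_one mop_unitary[OF Yc(1,2)])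

lemma inner_fc:
  assumes "x \<in> fspace n"
  shows "inner x (mop (fc f) y) = (\<Sum>k<n. f k * inner (coord (mop Y x) k) (coord (mop Y y) k))"
proof -
  have "inner x (mop (fc f) y) = inner (mop Y x) (fdiag n f (mop Y y))"
    unfolding mop_fc by (rule inner_mop_left[OF Yc(1) fdiag_in_fspace, symmetric])
  then show ?thesis by (simp add: inner_fdiag)
qed

lemma inner_fc_self:
  "x \<in> fspace n \<Longrightarrow> inner x (mop (fc f) x) = (\<Sum>k<n. f k * (norm (coord (mop Y x) k))\<^sup>2)"
  by (simp add: inner_fc power2_norm_eq_inner)

lemma fc_sym: "x \<in> fspace n \<Longrightarrow> y \<in> fspace n \<Longrightarrow> inner (mop (fc f) x) y = inner x (mop (fc f) y)"
proof -
  assume x: "x \<in> fspace n" and y: "y \<in> fspace n"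
  have "inner (mop (fc f) x) y = inner y (mop (fc f) x)" by (rule inner_commute)
  also have "\<dots> = inner x (mop (fc f) y)"
    unfolding inner_fc[OF x] inner_fc[OF y]
    by (intro sum.cong refl arg_cong2[of _ _ _ _ "(*)"] inner_commute)
  finally show ?thesis .
qed

lemma fc_shift: "x \<in> fspace n \<Longrightarrow> mop (fc (\<lambda>k. z - f k)) x = z *\<^sub>R x - mop (fc f) x"
proof -
  assume x: "x \<in> fspace n"
  have "fdiag n (\<lambda>k. z - f k) (mop Y x) = z *\<^sub>R mop Y x - fdiag n f (mop Y x)"
    using Y_in[of x] by (intro fvec_eqI) (auto simp: lookup_minus scaleR_diff_left fspace_def)
  then show ?thesis
    by (simp add: mop_fc mop_diff mop_scaleR mop_unitary[OF Yc(1,2) x])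
qed

lemma norm_fc_le:
  assumes "\<And>k. k < n \<Longrightarrow> \<bar>f k\<bar> \<le> K" "x \<in> fspace n"
  shows "norm (mop (fc f) x) \<le> K * norm x"
proof -
  have "norm (mop (fc f) x) = norm (fdiag n f (mop Y x))"
    unfolding mop_fc using Yc(1,3)
    by (intro norm_mop_unitary[of _ n n]) auto
  also have "\<dots> \<le> K * norm (mop Y x)" by (rule norm_fdiag_le[OF assms(1)]) auto
  also have "norm (mop Y x) = norm x" by (rule norm_mop_unitary[OF Yc(1,2) assms(2)])
  finally show ?thesis .
qed

lemma Vs_Vo: "x \<in> fspace m \<Longrightarrow> Vs (Vo x) = x"
  by (rule mop_unitary[OF V])

lemma inner_Vo: "y \<in> fspace n \<Longrightarrow> inner (Vo x) y = inner x (Vs y)"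
  by (rule inner_mop_left[OF V(1)])

lemma norm_Vo: "x \<in> fspace m \<Longrightarrow> norm (Vo x) = norm x"
  by (rule norm_mop_unitary[OF V])

lemma Vs_perp: "x \<in> fspace n \<Longrightarrow> Vs (x - Vo (Vs x)) = 0"
  by (simp add: mop_diff Vs_Vo)

lemma perp_pythagoras: "x \<in> fspace n \<Longrightarrow> (norm x)\<^sup>2 = (norm (x - Vo (Vs x)))\<^sup>2 + (norm (Vs x))\<^sup>2"
proof -
  assume x: "x \<in> fspace n"
  define u where "u = x - Vo (Vs x)"
  define w where "w = Vo (Vs x)"
  have "inner w u = 0"
    using x unfolding u_def w_def by (subst inner_Vo) (auto simp: Vs_perp fspace_closed)
  then have "inner u w = 0" by (subst inner_commute)
  have "x = u + w" by (simp add: u_def w_def)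
  then have "(norm x)\<^sup>2 = (norm u)\<^sup>2 + (norm w)\<^sup>2"
    using \<open>inner w u = 0\<close> \<open>inner u w = 0\<close> by (simp add: power2_norm_eq_inner inner_add_left inner_add_right)
  then show ?thesis by (simp add: u_def w_def norm_Vo)
qed

lemma norm_Vs_le: "x \<in> fspace n \<Longrightarrow> norm (Vs x) \<le> norm x"
  by (rule power2_le_imp_le) (simp_all add: perp_pythagoras)

lemma norm_perp_le: "x \<in> fspace n \<Longrightarrow> norm (x - Vo (Vs x)) \<le> norm x"
  by (rule power2_le_imp_le) (simp_all only: perp_pythagoras[of x] le_add_same_cancel1 zero_le_power2 norm_ge_zero)

lemma mop_bump: "x \<in> fspace n \<Longrightarrow> mop (bump d) x = x + Vo (fdiag m (\<lambda>j. d j - 1) (Vs x))"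
proof -
  assume x: "x \<in> fspace n"
  define D where "D = (mat_diag m (\<lambda>j. of_real (d j - 1)) :: 'a mat)"
  have D: "D \<in> carrier_mat m m" by (simp add: D_def)
  have DV: "D * mat_adjoint V \<in> carrier_mat m n" by (rule mult_carrier_mat[OF D Vadj])
  have "mop (bump d) x = x + Vo (mop D (Vs x))"
    unfolding bump_def D_def[symmetric] mop_mat_add[OF one_carrier_mat mult_carrier_mat[OF V(1) DV]]
      mop_one[OF x] mop_mult[OF V(1) DV] mop_mult[OF D Vadj] ..
  then show ?thesis by (simp only: D_def mop_mat_diag_of_real)
qed

text \<open>A vector \<open>x\<close> of \<open>fspace n\<close> is determined by
  \<open>Vs x\<close> and the remainder \<open>x - Vo (Vs x)\<close>. \<open>bump d\<close> is
  diagonal on the former and the identity on the latter; composition, inversion and norms of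
  \<open>bump\<close> are read off from these two facts.\<close>

lemma Vs_bump: "x \<in> fspace n \<Longrightarrow> Vs (mop (bump d) x) = fdiag m d (Vs x)"
proof -
  assume "x \<in> fspace n"
  then have "Vs (mop (bump d) x) = Vs x + fdiag m (\<lambda>j. d j - 1) (Vs x)"
    by (simp add: mop_bump mop_add Vs_Vo)
  also have "\<dots> = fdiag m d (Vs x)"
    using Vs_in[of x] by (intro fvec_eqI) (auto simp: lookup_add fspace_def algebra_simps)
  finally show ?thesis .
qed

lemma perp_bump:
  "x \<in> fspace n \<Longrightarrow> mop (bump d) x - Vo (Vs (mop (bump d) x)) = x - Vo (Vs x)"
  by (simp add: mop_bump mop_add Vs_Vo)

lemma bump_sym: "x \<in> fspace n \<Longrightarrow> y \<in> fspace n \<Longrightarrow> inner (mop (bump d) x) y = inner x (mop (bump d) y)"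
proof -
  assume x: "x \<in> fspace n" and y: "y \<in> fspace n"
  have "inner x (Vo w) = inner (Vs x) w" for w
    unfolding inner_commute[of x "Vo w"] inner_commute[of "Vs x" w] by (rule inner_Vo[OF x])
  moreover have "inner (fdiag m f u) w = inner u (fdiag m f w)" for f and u w :: "'a fvec"
  proof -
    have "inner (fdiag m f u) w = inner w (fdiag m f u)" by (rule inner_commute)
    also have "\<dots> = inner u (fdiag m f w)"
      unfolding inner_fdiag by (intro sum.cong refl arg_cong2[of _ _ _ _ "(*)"] inner_commute)
    finally show ?thesis .
  qed
  ultimately show ?thesis
    by (simp add: mop_bump x y inner_add_left inner_add_right inner_Vo)
qed

lemma bump_bump:
  assumes "\<And>j. j < m \<Longrightarrow> d j * e j = 1" "x \<in> fspace n"
  shows "mop (bump d) (mop (bump e) x) = x"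
proof -
  let ?y = "mop (bump d) (mop (bump e) x)"
  have "Vs ?y = Vs x" using assms by (simp add: Vs_bump fdiag_fdiag fdiag_one)
  moreover have "?y - Vo (Vs ?y) = x - Vo (Vs x)" using assms by (simp add: perp_bump)
  ultimately show ?thesis by simp
qed

lemma norm_bump: "x \<in> fspace n \<Longrightarrow> (norm (mop (bump d) x))\<^sup>2 = (norm x)\<^sup>2 - (norm (Vs x))\<^sup>2 + (norm (fdiag m d (Vs x)))\<^sup>2"
  using perp_pythagoras[of x] perp_pythagoras[of "mop (bump d) x"] perp_bump[of x d]
  by (simp add: Vs_bump)

lemma inner_Wop: "x \<in> fspace n \<Longrightarrow> inner x (Wop x) = inner (mop (bump root) x) (mop (fc ls) (mop (bump root) x))"
  unfolding Wop_def by (subst bump_sym[symmetric]) auto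

lemma norm_fdiag_root: "(norm (fdiag m root x))\<^sup>2 = (\<Sum>j<m. (1 + \<theta> j) * (norm (coord x j))\<^sup>2)"
  unfolding norm_fspace[OF fdiag_in_fspace]
proof (rule sum.cong)
  fix j assume j: "j \<in> {..<m}"
  then have "0 \<le> 1 + \<theta> j" using \<theta>_gt[of j] by simp
  then show "(norm (coord (fdiag m root x) j))\<^sup>2 = (1 + \<theta> j) * (norm (coord x j))\<^sup>2"
    using j by (simp add: root_def power_mult_distrib)
qed simp

end

text \<open>Linear arithmetic for either sign. In its application \<open>Y\<close> is the form of
  \<open>L\<close>, \<open>G\<close> its approximation by \<open>1 / g\<close> times the squared
  norm of \<open>a\<close>, and \<open>A\<close> the form of \<open>W - z\<close>.\<close>

lemma sign_cases_upper:
  fixes \<sigma> :: real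
  assumes "\<sigma> = 1 \<or> \<sigma> = -1" "\<sigma> * G - E \<le> \<sigma> * Y" "A = - Y + Z - T" "S = Z - G"
  shows "\<sigma> * A \<le> \<sigma> * (S - T) + E"
  using assms by auto

lemma sign_cases_lower:
  fixes \<sigma> :: real
  assumes "\<sigma> = 1 \<or> \<sigma> = -1" "\<sigma> * C \<le> \<sigma> * G + E" "A = - C + Z - T" "S = Z - G"
  shows "\<sigma> * (S - T) - E \<le> \<sigma> * A"
  using assms by auto

text \<open>
  The sign \<open>\<sigma>\<close> is that of the spike \<open>\<theta>\<^sub>i\<close>, which decides on which side of the spectrum of \<open>H\<close> the
  point \<open>z\<close> lies; it allows both cases to be treated together.
\<close>

locale spiked_estimate = spiked_model +
  fixes z g g2 s \<epsilon> K \<sigma> :: real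
  assumes K: "1 \<le> K"
    and \<theta>_le: "\<And>j. j < m \<Longrightarrow> 1 + \<theta> j \<le> K"
    and sep: "\<And>k. k < n \<Longrightarrow> \<bar>z - ls k\<bar> \<le> K" "\<And>k. k < n \<Longrightarrow> 1 \<le> K * \<bar>z - ls k\<bar>"
    and \<sigma>: "\<sigma> = 1 \<or> \<sigma> = -1" "\<And>k. k < n \<Longrightarrow> 0 < \<sigma> * (z - ls k)"
    and z: "\<bar>z\<bar> \<le> K"
    and g: "1 \<le> K * \<bar>g\<bar>"
    and s: "s = z - 1 / g" "1 \<le> K * s"
    and \<epsilon>: "0 \<le> \<epsilon>" "2 * K * \<epsilon> \<le> 1"
    and G_form: "\<And>x. x \<in> fspace m \<Longrightarrow>
      \<bar>(\<Sum>k<n. 1 / (z - ls k) * (norm (coord (mop Y (Vo x)) k))\<^sup>2) - g * (norm x)\<^sup>2\<bar> \<le> \<epsilon> * (norm x)\<^sup>2"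
    and G2_form: "\<And>x. x \<in> fspace m \<Longrightarrow>
      \<bar>(\<Sum>k<n. (1 / (z - ls k))\<^sup>2 * (norm (coord (mop Y (Vo x)) k))\<^sup>2) - g2 * (norm x)\<^sup>2\<bar> \<le> \<epsilon> * (norm x)\<^sup>2"
begin

definition X :: "'a mat" where "X = fc (\<lambda>k. 1 / (z - ls k))"
definition L :: "'a mat" where "L = fc (\<lambda>k. z - ls k)"

lemma X_in [simp]: "mop X y \<in> fspace n" and L_in [simp]: "mop L y \<in> fspace n"
  by (simp_all add: X_def L_def)

lemma z_neq: "k < n \<Longrightarrow> z - ls k \<noteq> 0"
  using \<sigma>(2)[of k] by auto

lemma X_L: "y \<in> fspace n \<Longrightarrow> mop X (mop L y) = y"
  unfolding X_def L_def fc_fc by (rule fc_one) (use z_neq in auto)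

lemma L_X: "y \<in> fspace n \<Longrightarrow> mop L (mop X y) = y"
  unfolding X_def L_def fc_fc by (rule fc_one) (use z_neq in auto)

lemma X_sym: "x \<in> fspace n \<Longrightarrow> y \<in> fspace n \<Longrightarrow> inner (mop X x) y = inner x (mop X y)"
  unfolding X_def by (rule fc_sym)

lemma L_sym: "x \<in> fspace n \<Longrightarrow> y \<in> fspace n \<Longrightarrow> inner (mop L x) y = inner x (mop L y)"
  unfolding L_def by (rule fc_sym)

lemma norm_X_le: "y \<in> fspace n \<Longrightarrow> norm (mop X y) \<le> K * norm y"
  unfolding X_def
proof (rule norm_fc_le)
  fix k assume k: "k < n"
  then have "0 < \<bar>z - ls k\<bar>" using z_neq by simp
  then show "\<bar>1 / (z - ls k)\<bar> \<le> K" using sep(2)[OF k] by (simp add: divide_le_eq)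
qed

lemma norm_L_le: "y \<in> fspace n \<Longrightarrow> norm (mop L y) \<le> K * norm y"
  unfolding L_def by (rule norm_fc_le) (use sep(1) in auto)

lemma L_definite: "0 \<le> \<sigma> * inner y (mop L y)" if "y \<in> fspace n"
proof -
  have "\<sigma> * inner y (mop L y) = (\<Sum>k<n. \<sigma> * (z - ls k) * (norm (coord (mop Y y) k))\<^sup>2)"
    unfolding L_def inner_fc_self[OF that] sum_distrib_left by (simp add: mult.assoc)
  also have "\<dots> \<ge> 0" using \<sigma>(2) by (intro sum_nonneg mult_nonneg_nonneg[OF less_imp_le]) auto
  finally show ?thesis .
qed

lemma inner_X: "x \<in> fspace m \<Longrightarrow> \<bar>inner (Vo x) (mop X (Vo x)) - g * (norm x)\<^sup>2\<bar> \<le> \<epsilon> * (norm x)\<^sup>2"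
  using G_form[of x] by (simp add: X_def inner_fc_self)

lemma inner_X2: "x \<in> fspace m \<Longrightarrow> \<bar>(norm (mop X (Vo x)))\<^sup>2 - g2 * (norm x)\<^sup>2\<bar> \<le> \<epsilon> * (norm x)\<^sup>2"
proof -
  assume x: "x \<in> fspace m"
  have "(norm (mop X (Vo x)))\<^sup>2 = inner (Vo x) (mop X (mop X (Vo x)))"
    by (simp add: power2_norm_eq_inner X_sym)
  also have "\<dots> = (\<Sum>k<n. (1 / (z - ls k))\<^sup>2 * (norm (coord (mop Y (Vo x)) k))\<^sup>2)"
    unfolding X_def fc_fc inner_fc_self[OF Vo_in] by (simp add: power2_eq_square)
  finally show ?thesis using G2_form[OF x] by simp
qed

text \<open>Polarization of the form bound, tested on the residual \<open>w\<close> itself, for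
  which \<open>B w x = (norm w)\<^sup>2\<close>. A bound on the form thus becomes a bound on the
  operator.\<close>

lemma G_op:
  assumes x: "x \<in> fspace m"
  shows "norm (Vs (mop X (Vo x)) - g *\<^sub>R x) \<le> \<epsilon> * norm x"
proof -
  define B where "B x y = inner (Vo x) (mop X (Vo y)) - g * inner x y" for x y
  define w where "w = Vs (mop X (Vo x)) - g *\<^sub>R x"
  have w: "w \<in> fspace m" unfolding w_def by (intro fspace_closed x) simp
  have sym: "B x y = B y x" for x y
  proof -
    have "inner (Vo x) (mop X (Vo y)) = inner (mop X (Vo x)) (Vo y)" by (simp add: X_sym)
    also have "\<dots> = inner (Vo y) (mop X (Vo x))" by (rule inner_commute)
    finally show ?thesis unfolding B_def by (simp add: inner_commute[of x y])
  qed
  have bil: "bilinear B"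
    unfolding bilinear_def
    by (intro conjI allI linearI)
      (simp_all add: B_def mop_add mop_scaleR inner_add_left inner_add_right algebra_simps)
  have "\<bar>B w x\<bar> \<le> \<epsilon> * norm w * norm x"
  proof (rule bilinear_form_polarization[OF bil sym subspace_fspace _ w x])
    show "\<bar>B y y\<bar> \<le> \<epsilon> * (norm y)\<^sup>2" if "y \<in> fspace m" for y
      using inner_X[OF that] by (simp add: B_def power2_norm_eq_inner)
  qed
  moreover have "B w x = (norm w)\<^sup>2"
  proof -
    have "B w x = inner w (Vs (mop X (Vo x)) - g *\<^sub>R x)"
      by (simp add: B_def inner_Vo inner_diff_right)
    then show ?thesis by (simp add: power2_norm_eq_inner flip: w_def)
  qed
  ultimately have "norm w * norm w \<le> norm w * (\<epsilon> * norm x)" by (simp add: power2_eq_square ac_simps)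
  then have "norm w \<le> \<epsilon> * norm x" using \<epsilon>(1) by (cases "norm w = 0") (auto simp: mult_le_cancel_left)
  then show ?thesis by (simp add: w_def)
qed

lemma g_pos: "0 < \<bar>g\<bar>" "1 / \<bar>g\<bar> \<le> K"
proof -
  show "0 < \<bar>g\<bar>" using g K by auto
  then show "1 / \<bar>g\<bar> \<le> K" using g by (simp add: divide_le_eq mult.commute)
qed

lemma s_pos: "0 < s" "1 / s \<le> K"
proof -
  show "0 < s"
  proof (rule ccontr)
    assume "\<not> 0 < s"
    then have "K * s \<le> 0" using K by (simp add: mult_nonneg_nonpos)
    then show False using s(2) by simp
  qed
  then show "1 / s \<le> K" using s(2) by (simp add: divide_le_eq mult.commute)
qed

text \<open>Substituting \<open>y\<close> splits the form of \<open>W - z\<close> into the form of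
  \<open>L\<close>, which has a definite sign, and a part that sees only the components in the range
  of \<open>V\<close>, because \<open>bump root\<close> leaves the remainder unchanged.\<close>

lemma Wop_form:
  assumes v: "v \<in> fspace n"
  defines "y \<equiv> mop (bump root) v"
  shows "inner v (Wop v) - z * (norm v)\<^sup>2 = - inner y (mop L y) + z * (norm (Vs y))\<^sup>2 - z * (norm (Vs v))\<^sup>2"
proof -
  have y: "y \<in> fspace n" by (simp add: y_def)
  have "inner v (Wop v) = inner y (mop (fc ls) y)" unfolding y_def by (rule inner_Wop[OF v])
  also have "\<dots> = z * (norm y)\<^sup>2 - inner y (mop L y)"
    by (simp add: L_def fc_shift[OF y] inner_diff_right power2_norm_eq_inner)
  also have "(norm y)\<^sup>2 = (norm v)\<^sup>2 - (norm (Vs v))\<^sup>2 + (norm (Vs y))\<^sup>2"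
    unfolding y_def norm_bump[OF v] Vs_bump[OF v] ..
  finally show ?thesis by (simp add: algebra_simps)
qed

lemma s_form: "s * r = z * r - r / g"
  by (simp add: s(1) left_diff_distrib)

text \<open>Completing the square: among all \<open>y\<close> with \<open>Vs y = a\<close>, the
  definite form of \<open>L\<close> is extremal at \<open>mop X (Vo c)\<close>, where
  \<open>c\<close> solves \<open>Vs (mop X (Vo c)) = a\<close>. Dropping the definite square gives
  one inequality without further conditions on \<open>v\<close>.\<close>

lemma Wop_form_upper:
  assumes v: "v \<in> fspace n"
  defines "a \<equiv> fdiag m root (Vs v)"
  shows "\<sigma> * (inner v (Wop v) - z * (norm v)\<^sup>2)
    \<le> \<sigma> * (s * (norm a)\<^sup>2 - z * (norm (Vs v))\<^sup>2) + \<epsilon> * K\<^sup>2 * (norm a)\<^sup>2"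
proof -
  define y where "y = mop (bump root) v"
  have y: "y \<in> fspace n" by (simp add: y_def)
  have a: "Vs y = a" "a \<in> fspace m" by (simp_all add: y_def a_def Vs_bump[OF v])
  \<comment> \<open>The exact solution would require the inverse of the compression of
    \<open>X\<close>. Any \<open>c\<close> gives a valid lower bound for the definite form, and this
    approximate solution loses only a term proportional to \<epsilon>.\<close>
  define c where "c = (1 / g) *\<^sub>R a"
  have c: "c \<in> fspace m" unfolding c_def by (intro fspace_closed a)
  define u where "u = mop X (Vo c)"
  have u: "u \<in> fspace n" "mop L u = Vo c" by (simp_all add: u_def L_X)
  have yc: "inner y (Vo c) = (norm a)\<^sup>2 / g"
  proof -
    have "inner y (Vo c) = inner (Vo c) y" by (rule inner_commute)
    also have "\<dots> = inner c a" by (simp add: inner_Vo[OF y] a)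
    also have "\<dots> = (norm a)\<^sup>2 / g" by (simp add: c_def power2_norm_eq_inner)
    finally show ?thesis .
  qed
  have eq: "inner (y - u) (mop L (y - u)) = inner y (mop L y) - 2 * inner y (Vo c) + inner u (Vo c)"
  proof -
    have "inner u (mop L y) = inner y (Vo c)"
      using L_sym[OF u(1) y] u(2) by (simp add: inner_commute)
    then show ?thesis by (simp add: mop_diff u(2) inner_diff_left inner_diff_right)
  qed
  have "0 \<le> \<sigma> * inner (y - u) (mop L (y - u))" by (intro L_definite fspace_closed y u)
  then have 1: "\<sigma> * (2 * inner y (Vo c) - inner u (Vo c)) \<le> \<sigma> * inner y (mop L y)"
    unfolding eq by (simp add: algebra_simps)
  have nc: "(norm c)\<^sup>2 = (norm a)\<^sup>2 / g\<^sup>2" by (simp add: c_def power_divide)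
  have g0: "g \<noteq> 0" using g_pos by simp
  have "\<bar>inner u (Vo c) - (norm a)\<^sup>2 / g\<bar> \<le> \<epsilon> * ((norm a)\<^sup>2 / g\<^sup>2)"
  proof -
    have "g * (norm c)\<^sup>2 = (norm a)\<^sup>2 / g" using g0 by (simp add: nc power2_eq_square[of g])
    then show ?thesis using inner_X[OF c] by (simp add: u_def inner_commute[of "mop X (Vo c)"] flip: nc)
  qed
  also have "\<dots> \<le> \<epsilon> * ((norm a)\<^sup>2 * K\<^sup>2)"
  proof (rule mult_left_mono[OF _ \<epsilon>(1)])
    have "(1 / \<bar>g\<bar>)\<^sup>2 \<le> K\<^sup>2" using g_pos by (intro power_mono) auto
    then have "(norm a)\<^sup>2 * (1 / g\<^sup>2) \<le> (norm a)\<^sup>2 * K\<^sup>2"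
      by (intro mult_left_mono) (auto simp: power_divide)
    then show "(norm a)\<^sup>2 / g\<^sup>2 \<le> (norm a)\<^sup>2 * K\<^sup>2" by simp
  qed
  finally have "\<sigma> * inner u (Vo c) \<le> \<sigma> * ((norm a)\<^sup>2 / g) + \<epsilon> * ((norm a)\<^sup>2 * K\<^sup>2)"
    using \<sigma>(1) by (auto simp: abs_le_iff)
  moreover define q where "q = (norm a)\<^sup>2 / g"
  ultimately have 2: "\<sigma> * inner u (Vo c) \<le> \<sigma> * q + \<epsilon> * K\<^sup>2 * (norm a)\<^sup>2"
    by (simp add: ac_simps)
  have "\<sigma> * q - \<epsilon> * K\<^sup>2 * (norm a)\<^sup>2 \<le> \<sigma> * inner y (mop L y)"
    using 1 2 unfolding yc q_def[symmetric] by (simp add: algebra_simps)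
  moreover have "inner v (Wop v) - z * (norm v)\<^sup>2 = - inner y (mop L y) + z * (norm a)\<^sup>2 - z * (norm (Vs v))\<^sup>2"
    using Wop_form[OF v] by (simp add: a flip: y_def)
  ultimately show ?thesis
    by (rule sign_cases_upper[OF \<sigma>(1)]) (simp add: s_form q_def)
qed

text \<open>The compression of \<open>X\<close> differs from \<open>g\<close> by at most \<epsilon>
  in norm. As \<open>2 * K * \<epsilon> \<le> 1\<close>, the error is absorbed in the left-hand
  side, which bounds \<open>c\<close> by \<open>a\<close> without forming an inverse.\<close>

lemma G_inverse:
  assumes c: "c \<in> fspace m"
  defines "a \<equiv> Vs (mop X (Vo c))"
  shows "norm c \<le> 2 * K * norm a" "\<bar>inner c a - (norm a)\<^sup>2 / g\<bar> \<le> 2 * \<epsilon> * K\<^sup>2 * (norm a)\<^sup>2"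
proof -
  have d: "norm (a - g *\<^sub>R c) \<le> \<epsilon> * norm c" using G_op[OF c] by (simp add: a_def)
  have "\<bar>g\<bar> * norm c = norm (g *\<^sub>R c)" by simp
  also have "\<dots> \<le> norm a + norm (a - g *\<^sub>R c)" by (metis norm_minus_commute norm_triangle_sub)
  also have "\<dots> \<le> norm a + \<epsilon> * norm c" using d by simp
  finally have "K * (\<bar>g\<bar> * norm c) \<le> K * (norm a + \<epsilon> * norm c)" using K by (intro mult_left_mono) auto
  moreover have "1 * norm c \<le> (K * \<bar>g\<bar>) * norm c" using g by (intro mult_right_mono) auto
  moreover have "K * \<epsilon> * norm c \<le> 1 / 2 * norm c" using \<epsilon>(2) by (intro mult_right_mono) auto
  ultimately show nc: "norm c \<le> 2 * K * norm a" by (simp add: algebra_simps)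
  have g0: "g \<noteq> 0" using g_pos by simp
  have "inner c a - (norm a)\<^sup>2 / g = - (1 / g) * inner (a - g *\<^sub>R c) a"
    using g0 by (simp add: inner_diff_left power2_norm_eq_inner field_simps)
  then have "\<bar>inner c a - (norm a)\<^sup>2 / g\<bar> = 1 / \<bar>g\<bar> * \<bar>inner (a - g *\<^sub>R c) a\<bar>"
    by (simp add: abs_mult)
  also have "\<dots> \<le> K * (norm (a - g *\<^sub>R c) * norm a)"
    using g_pos Cauchy_Schwarz_ineq2[of "a - g *\<^sub>R c" a] K by (intro mult_mono) auto
  also have "\<dots> \<le> K * ((\<epsilon> * (2 * K * norm a)) * norm a)"
    using K \<epsilon> d nc by (intro mult_left_mono mult_right_mono order_trans[OF d]) auto
  finally show "\<bar>inner c a - (norm a)\<^sup>2 / g\<bar> \<le> 2 * \<epsilon> * K\<^sup>2 * (norm a)\<^sup>2"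
    by (simp add: power2_eq_square ac_simps)
qed

text \<open>Here \<open>bump root\<close> maps \<open>v\<close> to \<open>mop X (Vo c)\<close>, so
  \<open>L\<close> maps the latter back to \<open>Vo c\<close> and its form is exactly
  \<open>inner c a\<close>. No square is dropped, and the inequality in the opposite direction holds
  on these vectors.\<close>

lemma Wop_form_lower:
  assumes c: "c \<in> fspace m"
  defines "v \<equiv> mop (bump (\<lambda>j. 1 / root j)) (mop X (Vo c))"
  defines "a \<equiv> fdiag m root (Vs v)"
  shows "\<sigma> * (s * (norm a)\<^sup>2 - z * (norm (Vs v))\<^sup>2) - 2 * \<epsilon> * K\<^sup>2 * (norm a)\<^sup>2
    \<le> \<sigma> * (inner v (Wop v) - z * (norm v)\<^sup>2)"
proof -
  define y where "y = mop X (Vo c)"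
  have r0: "root j \<noteq> 0" if "j < m" for j using \<theta>_gt[OF that] by (simp add: root_def)
  have v: "v \<in> fspace n" by (simp add: v_def)
  have y: "y \<in> fspace n" "mop L y = Vo c" by (simp_all add: y_def L_X)
  have yv: "mop (bump root) v = y" unfolding v_def y_def by (rule bump_bump) (use r0 in auto)
  have a: "Vs y = a" unfolding a_def yv[symmetric] by (rule Vs_bump[OF v])
  have "inner y (mop L y) = inner (Vo c) y" by (simp add: y(2) inner_commute)
  also have "\<dots> = inner c a" by (simp add: inner_Vo[OF y(1)] a)
  finally have "inner v (Wop v) - z * (norm v)\<^sup>2 = - inner c a + z * (norm a)\<^sup>2 - z * (norm (Vs v))\<^sup>2"
    using Wop_form[OF v] by (simp add: yv a)
  moreover have "\<bar>inner c a - (norm a)\<^sup>2 / g\<bar> \<le> 2 * \<epsilon> * K\<^sup>2 * (norm a)\<^sup>2"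
    using G_inverse(2)[OF c] by (simp add: a flip: y_def)
  then have "\<sigma> * inner c a \<le> \<sigma> * ((norm a)\<^sup>2 / g) + 2 * \<epsilon> * K\<^sup>2 * (norm a)\<^sup>2"
    using \<sigma>(1) by (auto simp: abs_le_iff)
  ultimately show ?thesis
    by (intro sign_cases_lower[OF \<sigma>(1)]) (auto simp: s_form)
qed

lemma norm_fdiag_root_le: "x \<in> fspace m \<Longrightarrow> (norm (fdiag m root x))\<^sup>2 \<le> K * (norm x)\<^sup>2"
  unfolding norm_fdiag_root norm_fspace sum_distrib_left
  using \<theta>_le by (intro sum_mono mult_right_mono) auto

lemma spike_form: "x \<in> fspace m \<Longrightarrow> s * (norm (fdiag m root x))\<^sup>2 - z * (norm x)\<^sup>2
    = (\<Sum>j<m. (s * (1 + \<theta> j) - z) * (norm (coord x j))\<^sup>2)"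
  unfolding norm_fdiag_root norm_fspace sum_distrib_left
  by (simp add: algebra_simps sum_subtractf sum.distrib)

end

lemma norm_square_diff_le: "\<bar>(norm x)\<^sup>2 - (norm y)\<^sup>2\<bar> \<le> norm (x - y) * (norm x + norm y)"
  for x y :: "'e::real_normed_vector"
proof -
  have "\<bar>(norm x)\<^sup>2 - (norm y)\<^sup>2\<bar> = \<bar>norm x - norm y\<bar> * (norm x + norm y)"
    by (simp add: power2_eq_square square_diff_square_factored abs_mult mult.commute)
  also have "\<dots> \<le> norm (x - y) * (norm x + norm y)"
    by (intro mult_right_mono norm_triangle_ineq3) simp
  finally show ?thesis .
qed

section \<open>Location of the outlier and shape of its eigenvectors\<close>

context spiked_estimate
begin

text \<open>By \<open>s * (1 + t) = z\<close> the coefficients are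
  \<open>s * (\<theta> j - t)\<close> with \<open>s > 0\<close>. The factor \<open>\<tau>\<close> is
  \<open>\<sigma>\<close> for one bound and \<open>- \<sigma>\<close> for the other.\<close>

lemma spike_form_sign:
  assumes x: "x \<in> fspace m" and t: "s * (1 + t) = z"
    and le: "\<And>j. j < m \<Longrightarrow> coord x j \<noteq> 0 \<Longrightarrow> \<tau> * \<theta> j \<le> \<tau> * t"
  shows "\<tau> * (s * (norm (fdiag m root x))\<^sup>2 - z * (norm x)\<^sup>2) \<le> 0"
proof -
  have "\<tau> * (s * (norm (fdiag m root x))\<^sup>2 - z * (norm x)\<^sup>2)
    = (\<Sum>j<m. s * (\<tau> * \<theta> j - \<tau> * t) * (norm (coord x j))\<^sup>2)"
    unfolding spike_form[OF x] sum_distrib_left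
    by (rule sum.cong) (auto simp: algebra_simps simp flip: t)
  also have "\<dots> \<le> 0"
  proof (rule sum_nonpos)
    fix j assume j: "j \<in> {..<m}"
    show "s * (\<tau> * \<theta> j - \<tau> * t) * (norm (coord x j))\<^sup>2 \<le> 0"
    proof (cases "coord x j = 0")
      case False
      then have "s * (\<tau> * \<theta> j - \<tau> * t) \<le> 0" using le[of j] j s_pos by (intro mult_nonneg_nonpos) auto
      then show ?thesis by (rule mult_nonpos_nonneg) simp
    qed simp
  qed
  finally show ?thesis .
qed

lemma eps_root_le:
  assumes "v \<in> fspace n"
  shows "\<epsilon> * K\<^sup>2 * (norm (fdiag m root (Vs v)))\<^sup>2 \<le> \<epsilon> * K ^ 3 * (norm v)\<^sup>2"
proof -
  have "(norm (fdiag m root (Vs v)))\<^sup>2 \<le> K * (norm (Vs v))\<^sup>2" by (rule norm_fdiag_root_le) simp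
  also have "\<dots> \<le> K * (norm v)\<^sup>2"
    using norm_Vs_le[OF assms] K by (intro mult_left_mono power_mono) auto
  finally have "\<epsilon> * K\<^sup>2 * (norm (fdiag m root (Vs v)))\<^sup>2 \<le> \<epsilon> * K\<^sup>2 * (K * (norm v)\<^sup>2)"
    using \<epsilon> K by (intro mult_left_mono) auto
  then show ?thesis by (simp add: power3_eq_cube power2_eq_square ac_simps)
qed

text \<open>
  Both bounds intersect eigenspaces of \<open>W\<close> with subspaces on which its form is controlled; the
  intersections are nontrivial by counting linear equations. For the first bound any vector will do.
  For the second one the vectors are of the form \<open>(1 + P)\<^sup>-\<^sup>1\<^sup>/\<^sup>2XVc\<close>, on which the estimate by the
  Schur complement is nearly an equality.
\<close>

lemma outlier_location:
  fixes Z :: "'a mat"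
  assumes Z: "Z \<in> unitary_group n"
    and W: "\<And>v. v \<in> fspace n \<Longrightarrow> Wop v = mop (mat_adjoint Z) (fdiag n l (mop Z v))"
    and l: "\<And>i j. i \<le> j \<Longrightarrow> j < n \<Longrightarrow> l j \<le> l i"
    and \<theta>_dec: "\<And>i j. i \<le> j \<Longrightarrow> j < m \<Longrightarrow> \<theta> j \<le> \<theta> i"
    and i: "i < m" "s * (1 + \<theta> i) = z" and mn: "m \<le> n"
    and p: "p = (if \<sigma> = 1 then i else n - m + i)"
  shows "\<bar>l p - z\<bar> \<le> 2 * \<epsilon> * K ^ 3"
proof -
  note Z' = unitary_groupD[OF Z]
  have pn: "p < n" using i mn by (auto simp: p)
  have nZ: "(norm v)\<^sup>2 = (\<Sum>k<n. (norm (coord (mop Z v) k))\<^sup>2)" if "v \<in> fspace n" for v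
    using norm_fspace[OF mop_in_fspace[OF Z'(1)], of v] norm_mop_unitary[OF Z'(1,2) that] by simp
  have WZ: "inner v (Wop v) = (\<Sum>k<n. l k * (norm (coord (mop Z v) k))\<^sup>2)" if "v \<in> fspace n" for v
  proof -
    have "inner v (Wop v) = inner (mop Z v) (fdiag n l (mop Z v))"
      unfolding W[OF that] by (rule inner_mop_left[OF Z'(1) fdiag_in_fspace, symmetric])
    then show ?thesis by (simp add: inner_fdiag power2_norm_eq_inner)
  qed
  \<comment> \<open>One half of the min-max principle: a vector without components at eigenvalues on
    the wrong side of \<open>l p\<close> has its form on the right side.\<close>
  have spec: "\<tau> * (l p - z) * (norm v)\<^sup>2 \<le> \<tau> * (inner v (Wop v) - z * (norm v)\<^sup>2)"
    if v: "v \<in> fspace n" and le: "\<And>k. k < n \<Longrightarrow> coord (mop Z v) k \<noteq> 0 \<Longrightarrow> \<tau> * l p \<le> \<tau> * l k" for v \<tau>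
  proof -
    have "\<tau> * (l p - z) * (norm v)\<^sup>2 = (\<Sum>k<n. (\<tau> * l p - \<tau> * z) * (norm (coord (mop Z v) k))\<^sup>2)"
      by (simp add: nZ[OF v] right_diff_distrib flip: sum_distrib_left)
    also have "\<dots> \<le> (\<Sum>k<n. (\<tau> * l k - \<tau> * z) * (norm (coord (mop Z v) k))\<^sup>2)"
    proof (rule sum_mono)
      fix k assume "k \<in> {..<n}"
      then show "(\<tau> * l p - \<tau> * z) * (norm (coord (mop Z v) k))\<^sup>2 \<le> (\<tau> * l k - \<tau> * z) * (norm (coord (mop Z v) k))\<^sup>2"
        using le[of k] by (cases "coord (mop Z v) k = 0") (auto intro!: mult_right_mono)
    qed
    also have "\<dots> = \<tau> * (inner v (Wop v) - z * (norm v)\<^sup>2)"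
      unfolding WZ[OF v] nZ[OF v]
      by (simp add: sum_distrib_left sum_subtractf left_diff_distrib right_diff_distrib mult.assoc)
    finally show ?thesis .
  qed
  have cancel: "c \<le> d" if "c * (norm v)\<^sup>2 \<le> d * (norm v)\<^sup>2" "v \<noteq> 0" for c d and v :: "'a fvec"
    using that by simp
  have up: "\<sigma> * (l p - z) \<le> \<epsilon> * K ^ 3"
  proof -
    obtain v where v: "v \<in> fspace n" "v \<noteq> 0"
      "\<And>k. k < n \<Longrightarrow> coord (mop Z v) k \<noteq> 0 \<Longrightarrow> \<sigma> * l p \<le> \<sigma> * l k"
      "\<And>j. j < m \<Longrightarrow> coord (Vs v) j \<noteq> 0 \<Longrightarrow> \<sigma> * \<theta> j \<le> \<sigma> * \<theta> i"
    proof (cases "\<sigma> = 1")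
      case True
      then have pi: "p = i" using p by simp
      \<comment> \<open>The equations before the gap remove the coordinates along spikes listed
        before \<open>\<theta> i\<close>; those after the gap remove the components at eigenvalues
        listed after \<open>l p\<close>.\<close>
      obtain v where v: "v \<in> fspace n" "v \<noteq> 0"
        "\<And>r. r < n \<Longrightarrow> r \<noteq> p \<Longrightarrow> coord (mop (if r < p then mat_adjoint V else Z) v) r = 0"
        by (rule homogeneous_mop_system[where C = "\<lambda>r. if r < p then mat_adjoint V else Z" and d = "\<lambda>r. if r < p then m else n"
            and i = "\<lambda>r. r", OF pn]) (use Vadj Z'(1) in simp, rule that)
      have Zz: "coord (mop Z v) k = 0" if "k < n" "p < k" for k using v(3)[of k] that by simp
      have Vz: "coord (Vs v) j = 0" if "j < p" for j using v(3)[of j] that pn by simp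
      show ?thesis
      proof (rule that[OF v(1,2)])
        fix k assume "k < n" "coord (mop Z v) k \<noteq> 0"
        then have "k \<le> p" using Zz[of k] by (meson not_le)
        then show "\<sigma> * l p \<le> \<sigma> * l k" using l[OF _ pn] True by simp
      next
        fix j assume "j < m" "coord (Vs v) j \<noteq> 0"
        then have "i \<le> j" using Vz[of j] pi by (meson not_le)
        then show "\<sigma> * \<theta> j \<le> \<sigma> * \<theta> i" using \<theta>_dec \<open>j < m\<close> True by simp
      qed
    next
      case False
      then have \<sigma>': "\<sigma> = -1" "p = n - m + i" using \<sigma>(1) p by auto
      \<comment> \<open>For a negative spike the two families change places. As
        \<open>p = n - m + i\<close>, the numbers \<open>r > p\<close> correspond to the spikes
        \<open>r - (n - m) > i\<close>, and \<open>r < p\<close> to the eigenvalues before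
        \<open>l p\<close>.\<close>
      obtain v where v: "v \<in> fspace n" "v \<noteq> 0"
        "\<And>r. r < n \<Longrightarrow> r \<noteq> p \<Longrightarrow> coord (mop (if p < r then mat_adjoint V else Z) v) (if p < r then r - (n - m) else r) = 0"
        by (rule homogeneous_mop_system[where C = "\<lambda>r. if p < r then mat_adjoint V else Z" and d = "\<lambda>r. if p < r then m else n"
            and i = "\<lambda>r. if p < r then r - (n - m) else r", OF pn]) (use Vadj Z'(1) in simp, rule that)
      have Zz: "coord (mop Z v) k = 0" if "k < p" for k using v(3)[of k] that pn by simp
      have Vz: "coord (Vs v) j = 0" if "i < j" "j < m" for j
      proof -
        define r where "r = n - m + j"
        have "r < n" "r \<noteq> p" "p < r" "r - (n - m) = j" using that mn \<sigma>'(2) by (auto simp: r_def)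
        then show ?thesis using v(3)[of r] by simp
      qed
      show ?thesis
      proof (rule that[OF v(1,2)])
        fix k assume "k < n" "coord (mop Z v) k \<noteq> 0"
        then have "p \<le> k" using Zz[of k] by (meson not_le)
        then show "\<sigma> * l p \<le> \<sigma> * l k" using l \<open>k < n\<close> \<sigma>' by simp
      next
        fix j assume "j < m" "coord (Vs v) j \<noteq> 0"
        then have "j \<le> i" using Vz[of j] by (meson not_le)
        then show "\<sigma> * \<theta> j \<le> \<sigma> * \<theta> i" using \<theta>_dec i \<sigma>' by simp
      qed
    qed
    have "\<sigma> * (l p - z) * (norm v)\<^sup>2 \<le> \<sigma> * (inner v (Wop v) - z * (norm v)\<^sup>2)"
      by (rule spec[OF v(1,3)])
    also have "\<dots> \<le> \<sigma> * (s * (norm (fdiag m root (Vs v)))\<^sup>2 - z * (norm (Vs v))\<^sup>2)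
        + \<epsilon> * K\<^sup>2 * (norm (fdiag m root (Vs v)))\<^sup>2"
      by (rule Wop_form_upper[OF v(1)])
    also have "\<dots> \<le> 0 + \<epsilon> * K ^ 3 * (norm v)\<^sup>2"
      by (intro add_mono spike_form_sign[OF _ i(2)] eps_root_le v) simp
    finally have "\<sigma> * (l p - z) * (norm v)\<^sup>2 \<le> \<epsilon> * K ^ 3 * (norm v)\<^sup>2" by simp
    then show ?thesis by (rule cancel[OF _ v(2)])
  qed
  have lo: "- 2 * \<epsilon> * K ^ 3 \<le> \<sigma> * (l p - z)"
  proof -
    \<comment> \<open>The unknown is now a vector \<open>c\<close> of length \<open>m\<close>, which
      keeps \<open>mop T c\<close> among the vectors of the near-equality. This leaves
      \<open>m - 1\<close> equations, and the gap is at \<open>i\<close>.\<close>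
    define T where "T = bump (\<lambda>j. 1 / root j) * (X * V)"
    have XV: "X * V \<in> carrier_mat n m" unfolding X_def by (rule mult_carrier_mat[OF fc_carrier V(1)])
    have T: "T \<in> carrier_mat n m" unfolding T_def by (rule mult_carrier_mat[OF bump_carrier XV])
    have ZT: "Z * T \<in> carrier_mat n m" by (rule mult_carrier_mat[OF Z'(1) T])
    have VT: "mat_adjoint V * T \<in> carrier_mat m m" by (rule mult_carrier_mat[OF Vadj T])
    have mT: "mop T c = mop (bump (\<lambda>j. 1 / root j)) (mop X (Vo c))" for c
      unfolding T_def mop_mult[OF bump_carrier XV] unfolding X_def mop_mult[OF fc_carrier V(1)] ..
    have mZT: "mop (Z * T) c = mop Z (mop T c)" "mop (mat_adjoint V * T) c = Vs (mop T c)" for c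
      by (rule mop_mult[OF Z'(1) T], rule mop_mult[OF Vadj T])
    obtain c where c: "c \<in> fspace m" "c \<noteq> 0"
      "\<And>k. k < n \<Longrightarrow> coord (mop Z (mop T c)) k \<noteq> 0 \<Longrightarrow> (- \<sigma>) * l p \<le> (- \<sigma>) * l k"
      "\<And>j. j < m \<Longrightarrow> coord (Vs (mop T c)) j \<noteq> 0 \<Longrightarrow> (- \<sigma>) * \<theta> j \<le> (- \<sigma>) * \<theta> i"
    proof (cases "\<sigma> = 1")
      case True
      \<comment> \<open>The first \<open>i\<close> equations remove the largest eigenvalues, up to
        the one before \<open>l i\<close>; the remaining ones remove the spikes after
        \<open>\<theta> i\<close>.\<close>
      obtain c where c: "c \<in> fspace m" "c \<noteq> 0"
        "\<And>r. r < m \<Longrightarrow> r \<noteq> i \<Longrightarrow> coord (mop (if i < r then mat_adjoint V * T else Z * T) c) r = 0"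
        by (rule homogeneous_mop_system[where C = "\<lambda>r. if i < r then mat_adjoint V * T else Z * T" and d = "\<lambda>r. if i < r then m else n"
            and i = "\<lambda>r. r", OF i(1)]) (use VT ZT in simp, rule that)
      have Zz: "coord (mop Z (mop T c)) k = 0" if "k < i" for k using c(3)[of k] that i by (simp add: mZT)
      have Vz: "coord (Vs (mop T c)) j = 0" if "j < m" "i < j" for j using c(3)[of j] that by (simp add: mZT)
      show ?thesis
      proof (rule that[OF c(1,2)])
        fix k assume k: "k < n" "coord (mop Z (mop T c)) k \<noteq> 0"
        then have "i \<le> k" using Zz[of k] by (meson not_le)
        then show "- \<sigma> * l p \<le> - \<sigma> * l k" using l[OF _ k(1)] True p by simp
      next
        fix j assume "j < m" "coord (Vs (mop T c)) j \<noteq> 0"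
        then have "j \<le> i" using Vz[of j] by (meson not_le)
        then show "- \<sigma> * \<theta> j \<le> - \<sigma> * \<theta> i" using \<theta>_dec i True by simp
      qed
    next
      case False
      then have \<sigma>': "\<sigma> = -1" "p = n - m + i" using \<sigma>(1) p by auto
      \<comment> \<open>For \<open>r > i\<close> the equation removes the eigenvalue at
        \<open>n - m + r\<close>, which runs through the positions after \<open>p\<close>; for
        \<open>r < i\<close> it removes a spike before \<open>\<theta> i\<close>.\<close>
      obtain c where c: "c \<in> fspace m" "c \<noteq> 0"
        "\<And>r. r < m \<Longrightarrow> r \<noteq> i \<Longrightarrow> coord (mop (if r < i then mat_adjoint V * T else Z * T) c) (if r < i then r else n - m + r) = 0"
        by (rule homogeneous_mop_system[where C = "\<lambda>r. if r < i then mat_adjoint V * T else Z * T" and d = "\<lambda>r. if r < i then m else n"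
            and i = "\<lambda>r. if r < i then r else n - m + r", OF i(1)]) (use VT ZT in simp, rule that)
      have Zz: "coord (mop Z (mop T c)) k = 0" if "p < k" "k < n" for k
      proof -
        define r where "r = k - (n - m)"
        have "r < m" "r \<noteq> i" "\<not> r < i" "n - m + r = k" using that mn \<sigma>'(2) i(1) by (auto simp: r_def)
        then show ?thesis using c(3)[of r] by (simp add: mZT)
      qed
      have Vz: "coord (Vs (mop T c)) j = 0" if "j < i" for j using c(3)[of j] that i by (simp add: mZT)
      show ?thesis
      proof (rule that[OF c(1,2)])
        fix k assume k: "k < n" "coord (mop Z (mop T c)) k \<noteq> 0"
        then have "k \<le> p" using Zz[of k] by (meson not_le)
        then show "- \<sigma> * l p \<le> - \<sigma> * l k" using l[OF _ pn] \<sigma>' by simp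
      next
        fix j assume j: "j < m" "coord (Vs (mop T c)) j \<noteq> 0"
        then have "i \<le> j" using Vz[of j] by (meson not_le)
        then show "- \<sigma> * \<theta> j \<le> - \<sigma> * \<theta> i" using \<theta>_dec[OF _ j(1)] \<sigma>' by simp
      qed
    qed
    define v where "v = mop T c"
    have v: "v \<in> fspace n" unfolding v_def by (rule mop_in_fspace[OF T])
    have v0: "v \<noteq> 0"
    proof
      assume "v = 0"
      have r0: "root j \<noteq> 0" if "j < m" for j using \<theta>_gt[OF that] by (simp add: root_def)
      have "mop (bump root) v = mop X (Vo c)"
        unfolding v_def mT by (rule bump_bump) (use r0 in auto)
      then have "mop X (Vo c) = 0" using \<open>v = 0\<close> by simp
      then have "Vo c = 0" using L_X[of "Vo c"] by simp
      then show False using Vs_Vo[OF c(1)] c(2) by simp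
    qed
    have sign: "(- \<sigma>) * (s * (norm (fdiag m root (Vs v)))\<^sup>2 - z * (norm (Vs v))\<^sup>2) \<le> 0"
      by (rule spike_form_sign[OF Vs_in i(2)]) (use c(4) in \<open>simp add: v_def\<close>)
    have "(- \<sigma>) * (l p - z) * (norm v)\<^sup>2 \<le> (- \<sigma>) * (inner v (Wop v) - z * (norm v)\<^sup>2)"
      by (rule spec[OF v]) (use c(3) in \<open>simp add: v_def\<close>)
    also have "\<dots> \<le> (- \<sigma>) * (s * (norm (fdiag m root (Vs v)))\<^sup>2 - z * (norm (Vs v))\<^sup>2)
        + 2 * (\<epsilon> * K\<^sup>2 * (norm (fdiag m root (Vs v)))\<^sup>2)"
      using Wop_form_lower[OF c(1)] unfolding mT[symmetric] v_def[symmetric] by (simp add: algebra_simps)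
    also have "\<dots> \<le> 0 + 2 * (\<epsilon> * K ^ 3 * (norm v)\<^sup>2)"
      by (intro add_mono mult_left_mono sign eps_root_le v) simp
    finally have "(- \<sigma>) * (l p - z) * (norm v)\<^sup>2 \<le> 2 * (\<epsilon> * K ^ 3) * (norm v)\<^sup>2" by simp
    then have "(- \<sigma>) * (l p - z) \<le> 2 * (\<epsilon> * K ^ 3)" by (rule cancel[OF _ v0])
    then show ?thesis by simp
  qed
  have "0 \<le> \<epsilon> * K ^ 3" using \<epsilon> K by simp
  then show ?thesis using up lo \<sigma>(1) by auto
qed

text \<open>The vector \<open>y\<close> is nearly \<open>mop X (Vo c)\<close>, since the eigenvalue
  is nearly \<open>z\<close>. Hence \<open>a\<close> is nearly \<open>g *\<^sub>R c\<close>, which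
  makes the component of the equation along \<open>V\<close> an approximate equation for
  \<open>Vs v\<close> alone. Expressing the squared norm of \<open>y\<close> in two ways then
  determines the norm of \<open>Vs v\<close>.\<close>

lemma outlier_eigenvector:
  assumes v: "v \<in> fspace n" "norm v = 1" and W: "Wop v = l *\<^sub>R v"
    and l: "\<bar>l - z\<bar> \<le> 2 * \<epsilon> * K ^ 3"
    and t: "s * (1 + t) = z" "-1 < t"
    and g2: "g\<^sup>2 \<le> g2" "g2 \<le> K\<^sup>2"
  shows "norm (fdiag m \<theta> (Vs v) - t *\<^sub>R Vs v) \<le> 5 * K ^ 7 * \<epsilon>" (is ?A)
    and "\<bar>(norm (Vs v))\<^sup>2 - 1 / (1 + (1 + t) * (g2 / g\<^sup>2 - 1))\<bar> \<le> 16 * K ^ 11 * \<epsilon>" (is ?B)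
proof -
  have Kpow: "K ^ i \<le> K ^ j" if "i \<le> j" for i j using power_increasing[OF that K] .
  have K0: "0 \<le> K" using K by simp
  define y where "y = mop (bump root) v"
  define vt where "vt = Vs v"
  define a where "a = Vs y"
  define c where "c = Vs (mop L y)"
  define b where "b = v - Vo (Vs v)"
  define x where "x = mop X (Vo c)"
  have y: "y \<in> fspace n" by (simp add: y_def)
  have vt: "vt \<in> fspace m" by (simp add: vt_def)
  have a: "a \<in> fspace m" "a = fdiag m root vt" by (simp_all add: a_def y_def vt_def Vs_bump[OF v(1)])
  have c: "c \<in> fspace m" by (simp add: c_def)
  have b: "b \<in> fspace n" unfolding b_def by (intro fspace_closed v) simp
  have nvt: "norm vt \<le> 1" using norm_Vs_le[OF v(1)] v(2) by (simp add: vt_def)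
  have nb: "norm b \<le> 1" using norm_perp_le[OF v(1)] v(2) by (simp add: b_def)
  have na2: "(norm a)\<^sup>2 \<le> K * (norm vt)\<^sup>2" unfolding a(2) by (rule norm_fdiag_root_le[OF vt])
  have ny2: "(norm y)\<^sup>2 = 1 - (norm vt)\<^sup>2 + (norm a)\<^sup>2"
    unfolding y_def norm_bump[OF v(1)] a(2) vt_def v(2) by simp
  have ny: "norm y \<le> K"
  proof -
    have "(norm y)\<^sup>2 \<le> 1 + (K - 1) * (norm vt)\<^sup>2" using ny2 na2 by (simp add: algebra_simps)
    also have "\<dots> \<le> 1 + (K - 1) * 1" using K nvt by (intro add_left_mono mult_left_mono) (auto simp: power_le_one)
    also have "\<dots> \<le> K\<^sup>2" using Kpow[of 1 2] by simp
    finally show ?thesis by (rule power2_le_imp_le[OF _ K0])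
  qed
  have na: "norm a \<le> K" using norm_Vs_le[OF y] ny by (simp add: a_def)
  have nL: "norm (mop L y) \<le> K * K"
    using norm_L_le[OF y] mult_left_mono[OF ny K0] by simp
  have nc: "norm c \<le> K\<^sup>2"
    using norm_Vs_le[OF L_in, of y] nL by (simp add: c_def power2_eq_square)
  have nx: "norm x \<le> K ^ 3"
  proof -
    have "norm x \<le> K * norm c" unfolding x_def using norm_X_le[OF Vo_in, of c] by (simp add: norm_Vo[OF c])
    also have "\<dots> \<le> K * K\<^sup>2" using nc K0 by (intro mult_left_mono)
    finally show ?thesis by (simp add: power3_eq_cube power2_eq_square)
  qed
  define u where "u = mop (fc ls) y"
  have u: "u \<in> fspace n" by (simp add: u_def)
  have Lu: "mop L y = z *\<^sub>R y - u" unfolding L_def u_def by (rule fc_shift[OF y])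
  have bu: "mop (bump root) u = l *\<^sub>R v" using W unfolding Wop_def y_def[symmetric] u_def .
  have root_u: "fdiag m root (Vs u) = l *\<^sub>R vt"
    using Vs_bump[OF u, of root] unfolding bu by (simp add: mop_scaleR vt_def)
  have perp_u: "u - Vo (Vs u) = l *\<^sub>R b"
    using perp_bump[OF u, of root] unfolding bu by (simp add: mop_scaleR b_def scaleR_diff_right)
  have perp_y: "y - Vo (Vs y) = b" unfolding y_def b_def by (rule perp_bump[OF v(1)])
  have cza: "c = z *\<^sub>R a - Vs u" unfolding c_def Lu by (simp add: mop_diff mop_scaleR a_def)
  \<comment> \<open>Across the range of \<open>V\<close> the matrix \<open>bump root\<close> is the
    identity, so \<open>u\<close> is there \<open>l\<close> times \<open>v\<close>. What remains of
    \<open>L y\<close> outside the range is therefore \<open>z - l\<close> times \<open>b\<close>,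
    which is small by the location of the eigenvalue.\<close>
  have "mop L y - Vo c = z *\<^sub>R (y - Vo (Vs y)) - (u - Vo (Vs u))"
    unfolding Lu cza by (simp add: a_def mop_diff mop_scaleR scaleR_diff_right)
  then have Lb: "mop L y = Vo c + (z - l) *\<^sub>R b"
    unfolding perp_y perp_u by (simp add: algebra_simps)
  have yx: "y = x + (z - l) *\<^sub>R mop X b"
    using X_L[OF y] unfolding Lb by (simp add: mop_add mop_scaleR x_def)
  have nXb: "norm (mop X b) \<le> K"
    using norm_X_le[OF b] mult_left_mono[OF nb K0] by simp
  have nzl: "norm ((z - l) *\<^sub>R mop X b) \<le> 2 * \<epsilon> * K ^ 3 * K"
    using l nXb by (auto simp: abs_minus_commute intro!: mult_mono)
  have e1: "norm (a - g *\<^sub>R c) \<le> 3 * \<epsilon> * K ^ 4"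
  proof -
    have "a - g *\<^sub>R c = (Vs x - g *\<^sub>R c) + Vs ((z - l) *\<^sub>R mop X b)"
      unfolding a_def by (subst yx) (simp add: mop_add)
    then have "norm (a - g *\<^sub>R c) \<le> norm (Vs x - g *\<^sub>R c) + norm (Vs ((z - l) *\<^sub>R mop X b))"
      by (simp only: norm_triangle_ineq)
    also have "\<dots> \<le> \<epsilon> * norm c + 2 * \<epsilon> * K ^ 3 * K"
      by (intro add_mono order_trans[OF norm_Vs_le nzl] G_op[OF c, folded x_def] fspace_closed) simp
    also have "\<dots> \<le> \<epsilon> * K ^ 4 + 2 * \<epsilon> * K ^ 4"
      using nc Kpow[of 2 4] \<epsilon>(1) by (intro add_mono mult_left_mono) (auto simp: power_numeral_reduce)
    finally show ?thesis by simp
  qed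
  have g0: "g \<noteq> 0" using g_pos by simp
  have e2: "norm (c - (1 / g) *\<^sub>R a) \<le> 3 * \<epsilon> * K ^ 5"
  proof -
    have "c - (1 / g) *\<^sub>R a = - (1 / g) *\<^sub>R (a - g *\<^sub>R c)" using g0 by (simp add: scaleR_diff_right)
    then have "norm (c - (1 / g) *\<^sub>R a) = 1 / \<bar>g\<bar> * norm (a - g *\<^sub>R c)" by simp
    also have "\<dots> \<le> K * (3 * \<epsilon> * K ^ 4)" using g_pos e1 K0 by (intro mult_mono) auto
    finally show ?thesis by (simp add: power_numeral_reduce ac_simps)
  qed
  have nroot: "norm (fdiag m root w) \<le> K * norm w" if "w \<in> fspace m" for w
  proof -
    have "(norm (fdiag m root w))\<^sup>2 \<le> K * (norm w)\<^sup>2" by (rule norm_fdiag_root_le[OF that])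
    also have "\<dots> \<le> K\<^sup>2 * (norm w)\<^sup>2" using Kpow[of 1 2] by (intro mult_right_mono) auto
    also have "\<dots> = (K * norm w)\<^sup>2" by (simp add: power_mult_distrib)
    finally show ?thesis by (rule power2_le_imp_le) (use K0 in simp)
  qed
  have fd: "fdiag m root (w - w') = fdiag m root w - fdiag m root w'"
    "fdiag m root (r *\<^sub>R w) = r *\<^sub>R fdiag m root w" for w w' r
    by (auto intro!: fvec_eqI simp: lookup_minus scaleR_diff_right)
  \<comment> \<open>Along the range of \<open>V\<close> the equation is exact up to replacing
    \<open>c\<close> by \<open>a / g\<close> and \<open>l\<close> by \<open>z\<close>. Since
    \<open>root\<close> is applied twice, the vector on the left has the coordinates of
    \<open>vt\<close> multiplied by \<open>s * (1 + \<theta> j) - z\<close>, that is by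
    \<open>s * (\<theta> j - t)\<close>.\<close>
  have e3: "norm (s *\<^sub>R fdiag m root a - z *\<^sub>R vt) \<le> 5 * \<epsilon> * K ^ 6"
  proof -
    have "s *\<^sub>R fdiag m root a - z *\<^sub>R vt = (l - z) *\<^sub>R vt + fdiag m root (c - (1 / g) *\<^sub>R a)"
    proof -
      have "fdiag m root c = z *\<^sub>R fdiag m root a - l *\<^sub>R vt"
        unfolding cza fd root_u ..
      then show ?thesis by (simp add: fd s(1) algebra_simps)
    qed
    then have "norm (s *\<^sub>R fdiag m root a - z *\<^sub>R vt) \<le> \<bar>l - z\<bar> * norm vt + norm (fdiag m root (c - (1 / g) *\<^sub>R a))"
      by (metis norm_triangle_ineq norm_scaleR)
    also have "\<dots> \<le> 2 * \<epsilon> * K ^ 3 * 1 + K * (3 * \<epsilon> * K ^ 5)"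
      using l nvt e2 K0 \<epsilon>
      by (intro add_mono mult_mono order_trans[OF nroot] mult_left_mono fspace_closed c a) auto
    also have "K * (3 * \<epsilon> * K ^ 5) = 3 * \<epsilon> * K ^ 6" by (simp add: power_numeral_reduce)
    also have "2 * \<epsilon> * K ^ 3 * 1 \<le> 2 * \<epsilon> * K ^ 6"
      using mult_left_mono[OF Kpow[of 3 6], of "2 * \<epsilon>"] \<epsilon>(1) by simp
    finally show ?thesis by simp
  qed
  define w where "w = fdiag m \<theta> vt - t *\<^sub>R vt"
  have w: "w \<in> fspace m" unfolding w_def by (intro fspace_closed vt) simp
  have "s *\<^sub>R fdiag m root a - z *\<^sub>R vt = s *\<^sub>R w"
  proof (rule fvec_eqI)
    fix j
    have "root j * root j = 1 + \<theta> j" if "j < m" using \<theta>_gt[OF that] by (simp add: root_def)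
    then show "coord (s *\<^sub>R fdiag m root a - z *\<^sub>R vt) j = coord (s *\<^sub>R w) j"
      using vt unfolding t(1)[symmetric] w_def a(2)
      by (auto simp: lookup_minus lookup_add fspace_def not_less algebra_simps)
  qed
  then have "s * norm w \<le> 5 * \<epsilon> * K ^ 6" using e3 s_pos by simp
  then have "norm w \<le> (1 / s) * (5 * \<epsilon> * K ^ 6)" using s_pos by (simp add: field_simps)
  also have "\<dots> \<le> K * (5 * \<epsilon> * K ^ 6)" using s_pos \<epsilon> K0 by (intro mult_right_mono) auto
  finally have nw: "norm w \<le> 5 * K ^ 7 * \<epsilon>" by (simp add: power_numeral_reduce ac_simps)
  then show ?A by (simp add: w_def vt_def)
  define N where "N = (norm vt)\<^sup>2"
  define r1 where "r1 = (norm a)\<^sup>2 - (1 + t) * N"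
  define r2 where "r2 = (norm x)\<^sup>2 - g2 * (norm c)\<^sup>2"
  define r3 where "r3 = (norm y)\<^sup>2 - (norm x)\<^sup>2"
  define r4 where "r4 = (norm c)\<^sup>2 - (norm a)\<^sup>2 / g\<^sup>2"
  have N: "0 \<le> N" by (simp add: N_def)
  have r1: "\<bar>r1\<bar> \<le> 5 * K ^ 7 * \<epsilon>"
  proof -
    have "(norm a)\<^sup>2 = N + inner vt (fdiag m \<theta> vt)"
    proof -
      have "(norm a)\<^sup>2 = (\<Sum>j<m. (1 + \<theta> j) * (norm (coord vt j))\<^sup>2)" unfolding a(2) by (rule norm_fdiag_root)
      then show ?thesis
        by (simp add: N_def norm_fspace[OF vt] inner_fdiag distrib_right sum.distrib flip: power2_norm_eq_inner)
    qed
    then have "r1 = inner vt w"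
      by (simp add: r1_def w_def N_def inner_diff_right power2_norm_eq_inner algebra_simps)
    then have "\<bar>r1\<bar> \<le> norm vt * norm w" using Cauchy_Schwarz_ineq2 by simp
    also have "\<dots> \<le> 1 * norm w" using nvt by (intro mult_right_mono) auto
    finally show ?thesis using nw by simp
  qed
  have r2: "\<bar>r2\<bar> \<le> K ^ 4 * \<epsilon>"
  proof -
    have "\<bar>r2\<bar> \<le> \<epsilon> * (norm c)\<^sup>2" unfolding r2_def x_def by (rule inner_X2[OF c])
    also have "\<dots> \<le> \<epsilon> * (K\<^sup>2)\<^sup>2" using nc \<epsilon> by (intro mult_left_mono power_mono) auto
    finally show ?thesis by (simp add: mult.commute)
  qed
  have r3: "\<bar>r3\<bar> \<le> 4 * K ^ 7 * \<epsilon>"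
  proof -
    have "\<bar>r3\<bar> \<le> norm (y - x) * (norm y + norm x)" unfolding r3_def by (rule norm_square_diff_le)
    also have "\<dots> \<le> (2 * \<epsilon> * K ^ 3 * K) * (K ^ 3 + K ^ 3)"
      using nzl ny nx Kpow[of 1 3] \<epsilon> K0 by (intro mult_mono add_mono) (auto simp: yx)
    finally show ?thesis by (simp add: power_numeral_reduce ac_simps)
  qed
  have r4: "\<bar>r4\<bar> \<le> 6 * K ^ 7 * \<epsilon>"
  proof -
    have nag: "norm ((1 / g) *\<^sub>R a) \<le> K\<^sup>2"
    proof -
      have "norm ((1 / g) *\<^sub>R a) = 1 / \<bar>g\<bar> * norm a" by simp
      also have "\<dots> \<le> K * K" using g_pos na K0 by (intro mult_mono) auto
      finally show ?thesis by (simp add: power2_eq_square)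
    qed
    have "r4 = (norm c)\<^sup>2 - (norm ((1 / g) *\<^sub>R a))\<^sup>2" by (simp add: r4_def power_divide)
    then have "\<bar>r4\<bar> \<le> norm (c - (1 / g) *\<^sub>R a) * (norm c + norm ((1 / g) *\<^sub>R a))"
      using norm_square_diff_le by metis
    also have "\<dots> \<le> (3 * \<epsilon> * K ^ 5) * (K\<^sup>2 + K\<^sup>2)"
      using e2 nc nag \<epsilon> K0 by (intro mult_mono add_mono) auto
    finally show ?thesis by (simp add: power_numeral_reduce ac_simps)
  qed
  define h where "h = g2 / g\<^sup>2"
  define q where "q = 1 + (1 + t) * (h - 1)"
  have g20: "0 < g\<^sup>2" using g0 by simp
  have h: "1 \<le> h" "h - 1 \<le> K ^ 4"
  proof -
    show "1 \<le> h" using g2(1) g20 by (simp add: h_def le_divide_eq)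
    have "h = g2 * (1 / \<bar>g\<bar>)\<^sup>2" by (simp add: h_def power_divide)
    also have "\<dots> \<le> K\<^sup>2 * K\<^sup>2"
      using g2 g20 g_pos K0 by (intro mult_mono power_mono) auto
    finally show "h - 1 \<le> K ^ 4" by (simp add: power_numeral_reduce)
  qed
  have q: "1 \<le> q" using h(1) t(2) by (simp add: q_def)
  \<comment> \<open>An exact identity with four error terms: it follows
    \<open>(norm y)\<^sup>2\<close> through \<open>(norm x)\<^sup>2\<close> and
    \<open>g2 * (norm c)\<^sup>2\<close> to \<open>h * (norm a)\<^sup>2\<close>, and expresses
    \<open>(norm a)\<^sup>2\<close> by \<open>N\<close>.\<close>
  have main: "1 - q * N = (h - 1) * r1 + g2 * r4 + r2 + r3"
  proof -
    have A: "(norm a)\<^sup>2 = (1 + t) * N + r1" by (simp add: r1_def)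
    have "1 - N + (norm a)\<^sup>2 = g2 * (norm c)\<^sup>2 + r2 + r3" using ny2 by (simp add: r2_def r3_def N_def)
    also have "g2 * (norm c)\<^sup>2 = h * (norm a)\<^sup>2 + g2 * r4" by (simp add: r4_def h_def right_diff_distrib)
    finally have "1 - N + (norm a)\<^sup>2 = h * (norm a)\<^sup>2 + g2 * r4 + r2 + r3" .
    then show ?thesis unfolding A q_def by (simp add: algebra_simps)
  qed
  have "\<bar>(h - 1) * r1\<bar> \<le> K ^ 4 * (5 * K ^ 7 * \<epsilon>)"
    unfolding abs_mult using h r1 K0 by (intro mult_mono) auto
  moreover have "\<bar>g2 * r4\<bar> \<le> K\<^sup>2 * (6 * K ^ 7 * \<epsilon>)"
    unfolding abs_mult using g2(2) order_trans[OF zero_le_power2 g2(1)] r4 K0 by (intro mult_mono) auto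
  moreover have "K ^ 4 * (5 * K ^ 7 * \<epsilon>) = 5 * (K ^ 11 * \<epsilon>)" "K\<^sup>2 * (6 * K ^ 7 * \<epsilon>) = 6 * (K ^ 9 * \<epsilon>)"
    by (simp_all add: power_numeral_reduce)
  moreover have "K ^ 9 * \<epsilon> \<le> K ^ 11 * \<epsilon>" "K ^ 4 * \<epsilon> \<le> K ^ 11 * \<epsilon>" "K ^ 7 * \<epsilon> \<le> K ^ 11 * \<epsilon>"
    using Kpow \<epsilon>(1) by (auto intro!: mult_right_mono)
  \<comment> \<open>The four errors contribute \<open>5 + 6 + 1 + 4 = 16\<close>. Dividing by
    \<open>q\<close> costs nothing, as \<open>q \<ge> 1\<close>.\<close>
  ultimately have "\<bar>1 - q * N\<bar> \<le> 16 * (K ^ 11 * \<epsilon>)" unfolding main using r2 r3 by linarith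
  moreover have "N - 1 / q = - (1 - q * N) / q" using q by (simp add: field_simps)
  then have "\<bar>N - 1 / q\<bar> = \<bar>1 - q * N\<bar> / q" using q by simp
  then have "\<bar>N - 1 / q\<bar> \<le> \<bar>1 - q * N\<bar>" using q by (simp add: divide_le_eq mult_le_cancel_left1)
  ultimately show ?B by (simp add: N_def q_def h_def vt_def)
qed

end

section \<open>Square roots, rank and eigenbases\<close>

lemma emb_smult: "v \<in> carrier_vec n \<Longrightarrow> emb (of_real r \<cdot>\<^sub>v v) = r *\<^sub>R emb v"
  by (rule fvec_eqI) (simp add: coord_emb[of _ n] scaleR_conv_of_real)

lemma emb_minus: "v \<in> carrier_vec n \<Longrightarrow> w \<in> carrier_vec n \<Longrightarrow> emb (v - w) = emb v - emb w"
  by (rule fvec_eqI) (simp add: coord_emb[of _ n] lookup_minus)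

lemma cscalar_prod_eq_cdot:
  "v \<in> carrier_vec n \<Longrightarrow> w \<in> carrier_vec n \<Longrightarrow> v \<bullet>c w = cdot n (emb w) (emb v)"
  by (simp add: scalar_prod_def cdot_def coord_emb[of _ n] atLeast0LessThan mult.commute)

lemma eigenvector_emb:
  assumes "A \<in> carrier_mat n n" "eigenvector A v (of_real l)"
  shows "v \<in> carrier_vec n" "emb v \<in> fspace n" "mop A (emb v) = l *\<^sub>R emb v"
  using assms by (auto simp: eigenvector_def mop_emb emb_smult emb_in_fspace)

lemma eigenvector_of_mop:
  assumes A: "A \<in> carrier_mat n n" and x: "x \<in> fspace n" "x \<noteq> 0" "mop A x = l *\<^sub>R x"
  obtains v where "eigenvector A v (of_real l)" "emb v = x"
proof -
  obtain v where v: "v \<in> carrier_vec n" "x = emb v" using fspace_obtain_vec[OF x(1)] by metis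
  have "emb (0\<^sub>v n) = (0 :: 'a fvec)" by (rule fvec_eqI) (simp add: coord_emb[of _ n])
  then have "v \<noteq> 0\<^sub>v n" using x(2) v(2) by auto
  moreover have "emb (A *\<^sub>v v) = emb (of_real l \<cdot>\<^sub>v v)"
    using x(3) v by (simp add: mop_emb[OF A, symmetric] emb_smult)
  then have "A *\<^sub>v v = of_real l \<cdot>\<^sub>v v"
    using emb_eq_iff[of "A *\<^sub>v v" n "of_real l \<cdot>\<^sub>v v"] A v(1) by simp
  ultimately have "eigenvector A v (of_real l)" using A v by (auto simp: eigenvector_def)
  then show ?thesis using that v by blast
qed

lemma mop_spectral:
  assumes "Q \<in> unitary_group n" "A = Q * mat_diag n (\<lambda>k. of_real (f k)) * mat_adjoint Q"
  shows "mop A x = mop Q (fdiag n f (mop (mat_adjoint Q) x))"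
  using unitary_groupD[OF assms(1)] unfolding assms(2)
  by (simp add: mop_mult[of _ n n _ n] mop_mat_diag_of_real mult_carrier_mat[of _ n n])

lemma mop_adjoint_unitary:
  assumes "Q \<in> unitary_group n" "x \<in> fspace n"
  shows "mop Q (mop (mat_adjoint Q) x) = x"
  using mop_mult[OF unitary_groupD(1)[OF assms(1)] mat_adjoint_carrier[OF unitary_groupD(1)[OF assms(1)]], of x]
    unitary_groupD(3)[OF assms(1)] assms(2) by (simp add: mop_one)

lemma eigvals_unit_eigenvector:
  fixes A :: "'a::rc_field mat"
  assumes A: "hermitian n A" and k: "k < n"
  obtains x where "x \<in> fspace n" "norm x = 1" "mop A x = (eigvals A ! k) *\<^sub>R x"
proof -
  obtain Q where Q: "Q \<in> unitary_group n" "length (eigvals A) = n"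
    "A = Q * mat_diag n (\<lambda>k. of_real (eigvals A ! k)) * mat_adjoint Q"
    using spectral_eigvals[OF A] by metis
  note Q' = unitary_groupD[OF Q(1)]
  define e where "e = (fvec n (\<lambda>j. if j = k then 1 else 0) :: 'a fvec)"
  have e: "e \<in> fspace n" by (simp add: e_def)
  have "(norm e)\<^sup>2 = (\<Sum>j<n. if j = k then 1 else 0)"
    unfolding norm_fspace[OF e] by (rule sum.cong) (auto simp: e_def)
  then have "(norm e)\<^sup>2 = 1" using k by simp
  then have ne: "norm e = 1" using norm_ge_zero[of e] unfolding power2_eq_1_iff by auto
  show ?thesis
  proof (rule that[of "mop Q e"])
    show "mop Q e \<in> fspace n" by (rule mop_in_fspace[OF Q'(1)])
    show "norm (mop Q e) = 1" using norm_mop_unitary[OF Q'(1,2) e] ne by simp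
    have "fdiag n (\<lambda>k. eigvals A ! k) e = (eigvals A ! k) *\<^sub>R e" by (rule fvec_eqI) (auto simp: e_def)
    then show "mop A (mop Q e) = (eigvals A ! k) *\<^sub>R mop Q e"
      using mop_spectral[OF Q(1,3), of "mop Q e"] mop_unitary[OF Q'(1,2) e] by (simp add: mop_scaleR)
  qed
qed

section \<open>Operator norm and positivity of eigenvalues\<close>

lemma norm_mop_le_opnorm:
  assumes A: "A \<in> carrier_mat n m" and x: "x \<in> fspace m" "norm x \<le> 1"
  shows "norm (mop A x) \<le> opnorm A"
proof -
  obtain K where K: "\<And>y. norm (mop A y) \<le> norm y * K" "K > 0"
    using bounded_linear.pos_bounded[OF bounded_linear_mop[of A]] by blast
  obtain v where v: "v \<in> carrier_vec m" "x = emb v" using fspace_obtain_vec[OF x(1)] by metis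
  \<comment> \<open>A real supremum bounds the members of a set only when the set is bounded above,
    so boundedness of the operator comes first.\<close>
  have "bdd_above {vnorm (A *\<^sub>v x) |x. x \<in> carrier_vec (dim_col A) \<and> vnorm x \<le> 1}"
  proof (rule bdd_aboveI[of _ K])
    fix r assume "r \<in> {vnorm (A *\<^sub>v x) |x. x \<in> carrier_vec (dim_col A) \<and> vnorm x \<le> 1}"
    then obtain w where w: "r = vnorm (A *\<^sub>v w)" "w \<in> carrier_vec m" "vnorm w \<le> 1" using A by auto
    have "r = norm (mop A (emb w))" using w A by (simp add: mop_emb[OF A] norm_emb)
    also have "\<dots> \<le> norm (emb w) * K" by (rule K)
    also have "\<dots> \<le> 1 * K" using w K(2) by (intro mult_right_mono) (auto simp: norm_emb)
    finally show "r \<le> K" by simp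
  qed
  moreover have "norm (mop A x) \<in> {vnorm (A *\<^sub>v x) |x. x \<in> carrier_vec (dim_col A) \<and> vnorm x \<le> 1}"
    using A v x by (auto simp: mop_emb[OF A] norm_emb intro!: exI[of _ v])
  ultimately show ?thesis unfolding opnorm_def by (rule cSup_upper[rotated])
qed

lemma abs_eigvals_le_opnorm:
  assumes "hermitian n A" "k < n"
  shows "\<bar>eigvals A ! k\<bar> \<le> opnorm (A :: 'a::rc_field mat)"
proof -
  obtain x where x: "x \<in> fspace n" "norm x = 1" "mop A x = (eigvals A ! k) *\<^sub>R x"
    using eigvals_unit_eigenvector[OF assms] .
  then show ?thesis
    using norm_mop_le_opnorm[of A n n x] assms(1) by (simp add: hermitian_def)
qed

lemma psd_inner_nonneg:
  assumes A: "psd n A" and x: "x \<in> fspace n"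
  shows "0 \<le> inner (mop A x) x"
proof -
  have Ac: "A \<in> carrier_mat n n" using A by (simp add: psd_def hermitian_def)
  obtain v where v: "v \<in> carrier_vec n" "x = emb v" using fspace_obtain_vec[OF x] by metis
  have "0 \<le> (A *\<^sub>v v) \<bullet>c v" using A v by (simp add: psd_def)
  also have "(A *\<^sub>v v) \<bullet>c v = cdot n x (mop A x)"
    using Ac v by (simp add: cscalar_prod_eq_cdot[of _ n] mop_emb[OF Ac])
  finally have "0 \<le> inner (cdot n x (mop A x)) 1" by (rule inner_one_nonneg)
  then have "0 \<le> inner x (mop A x)" by (simp only: inner_eq_cdot[OF x])
  then show ?thesis by (subst inner_commute)
qed

lemma psd_eigvals_nonneg:
  assumes "psd n A" "k < n"
  shows "0 \<le> eigvals (A :: 'a::rc_field mat) ! k"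
proof -
  have "hermitian n A" using assms(1) by (simp add: psd_def)
  then obtain x where x: "x \<in> fspace n" "norm x = 1" "mop A x = (eigvals A ! k) *\<^sub>R x"
    using eigvals_unit_eigenvector[OF _ assms(2)] by blast
  then show ?thesis using psd_inner_nonneg[OF assms(1) x(1)] by (simp add: norm_eq_1)
qed

lemma eigvals_eq_0_imp_zero:
  fixes A :: "'a::rc_field mat"
  assumes A: "hermitian n A" and 0: "\<And>k. k < n \<Longrightarrow> eigvals A ! k = 0"
  shows "A = 0\<^sub>m n n"
proof (rule mat_eq_mopI)
  obtain Q where Q: "Q \<in> unitary_group n" "length (eigvals A) = n"
    "A = Q * mat_diag n (\<lambda>k. of_real (eigvals A ! k)) * mat_adjoint Q"
    using spectral_eigvals[OF A] by metis
  have "fdiag n (\<lambda>k. eigvals A ! k) y = (0 :: 'a fvec)" for y by (rule fvec_eqI) (simp add: 0)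
  moreover have "mop (0\<^sub>m n n) x = (0 :: 'a fvec)" for x by (rule fvec_eqI) (simp add: coord_mop[of _ n n])
  ultimately show "mop A x = mop (0\<^sub>m n n) x" for x using mop_spectral[OF Q(1,3), of x] by simp
qed (use A in \<open>auto simp: hermitian_def\<close>)

text \<open>Symmetry for the real inner product suffices for complex matrices too, because the real
  adjoint of \<open>mop A\<close> is already the operator of the conjugate transpose.\<close>

lemma hermitian_mopI:
  assumes A: "A \<in> carrier_mat n n"
    and sym: "\<And>x y. x \<in> fspace n \<Longrightarrow> y \<in> fspace n \<Longrightarrow> inner (mop A x) y = inner x (mop A y)"
  shows "hermitian n A"
proof -
  have "mat_adjoint A = A"
  proof (rule mat_eq_mopI[OF mat_adjoint_carrier[OF A] A])
    fix x :: "'a fvec" assume x: "x \<in> fspace n"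
    define d where "d = mop (mat_adjoint A) x - mop A x"
    have d: "d \<in> fspace n"
      unfolding d_def by (intro fspace_closed mop_in_fspace[OF A] mop_in_fspace[OF mat_adjoint_carrier[OF A]])
    have "inner d (mop (mat_adjoint A) x) = inner d (mop A x)"
      using inner_mop_left[OF A x, of d] sym[OF d x] by simp
    then have "inner d d = 0" by (subst (2) d_def) (simp add: inner_diff_right)
    then show "mop (mat_adjoint A) x = mop A x" by (simp add: d_def)
  qed
  then show ?thesis using A by (simp add: hermitian_def)
qed

lemma mop_mat_minus:
  assumes "A \<in> carrier_mat n m" "B \<in> carrier_mat n m"
  shows "mop (A - B) x = mop A x - mop B x"
  by (rule fvec_eqI) (use assms in \<open>auto simp: mop_def lookup_minus sum_subtractf algebra_simps\<close>)

text \<open>If \<open>x\<close> is a unit eigenvector of \<open>S - R\<close> with eigenvalue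
  \<open>c\<close>, comparing the norms of \<open>S x\<close> and \<open>R x\<close> gives
  \<open>c * (2 * inner (mop R x) x + c) = 0\<close>. The second factor is positive because
  \<open>S\<close> is positive semi-definite and \<open>R\<close> positive definite, so every
  eigenvalue of the difference vanishes.\<close>

lemma mat_sqrt_eqI:
  fixes R :: "'a::rc_field mat"
  assumes R: "psd n R" and sq: "R * R = A"
    and pos: "\<And>x. x \<in> fspace n \<Longrightarrow> x \<noteq> 0 \<Longrightarrow> 0 < inner (mop R x) x"
  shows "mat_sqrt A = R"
proof -
  have Rc: "R \<in> carrier_mat n n" and Rh: "hermitian n R" using R by (auto simp: psd_def hermitian_def)
  have dim: "dim_row A = n" using Rc sq by auto
  show ?thesis
    unfolding mat_sqrt_def dim
  proof (rule the_equality)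
    show "psd n R \<and> R * R = A" using R sq by simp
    fix S assume S: "psd n S \<and> S * S = A"
    then have Sc: "S \<in> carrier_mat n n" and Sh: "hermitian n S" by (auto simp: psd_def hermitian_def)
    have Dc: "S - R \<in> carrier_mat n n" by (rule minus_carrier_mat[OF Rc])
    have D: "mop (S - R) x = mop S x - mop R x" for x by (rule mop_mat_minus[OF Sc Rc])
    have Dh: "hermitian n (S - R)"
      by (rule hermitian_mopI[OF Dc])
        (simp add: D inner_diff_left inner_diff_right inner_mop_hermitian[OF Sh] inner_mop_hermitian[OF Rh])
    have "eigvals (S - R) ! k = 0" if k: "k < n" for k
    proof -
      define c where "c = eigvals (S - R) ! k"
      obtain x where x: "x \<in> fspace n" "norm x = 1" "mop (S - R) x = c *\<^sub>R x"
        using eigvals_unit_eigenvector[OF Dh k] unfolding c_def by blast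
      have Sx: "mop S x = mop R x + c *\<^sub>R x" using x(3) unfolding D by (simp add: algebra_simps)
      have "mop S (mop S x) = mop R (mop R x)"
        using mop_mult[OF Sc Sc, of x] mop_mult[OF Rc Rc, of x] S sq by simp
      then have "inner (mop S x) (mop S x) = inner (mop R x) (mop R x)"
        using inner_mop_hermitian[OF Sh x(1), of "mop S x"] inner_mop_hermitian[OF Rh x(1), of "mop R x"] by simp
      then have "c * (2 * inner (mop R x) x + c) = 0"
        using x(2) unfolding Sx
        by (simp add: inner_add_left inner_add_right inner_commute[of x "mop R x"] norm_eq_1 algebra_simps)
      moreover have "0 \<le> inner (mop S x) x" using psd_inner_nonneg[of n S x] S x(1) by simp
      then have "0 \<le> inner (mop R x) x + c" using x(2) unfolding Sx by (simp add: inner_add_left norm_eq_1)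
      moreover have "x \<noteq> 0" using x(2) by auto
      then have "0 < inner (mop R x) x" using pos[OF x(1)] by simp
      ultimately show ?thesis unfolding c_def by auto
    qed
    then have "S - R = 0\<^sub>m n n" by (rule eigvals_eq_0_imp_zero[OF Dh])
    then have "mop S x = mop R x" for x
      using D[of x] by (simp add: mop_def fvec_def)
    then show "S = R" by (intro mat_eq_mopI[OF Sc Rc])
  qed
qed

lemma of_real_nonneg: "0 \<le> r \<Longrightarrow> 0 \<le> (of_real r :: 'a::rc_field)"
  using conjugate_square_positive[of "of_real (sqrt r) :: 'a"] by (simp flip: of_real_mult)

text \<open>The columns of an eigenbasis at nonzero eigenvalues are kept in their order, so that
  column \<open>j\<close> of \<open>C\<close> belongs to \<open>nz ! j\<close>.\<close>

lemma hermitian_compact_decomposition: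
  fixes A :: "'a::rc_field mat"
  assumes A: "hermitian n A"
  defines "nz \<equiv> filter (\<lambda>x. x \<noteq> 0) (eigvals A)"
  obtains C where "C \<in> carrier_mat n (length nz)" "mat_adjoint C * C = 1\<^sub>m (length nz)"
    "A = C * (mat_diag (length nz) (\<lambda>j. of_real (nz ! j)) * mat_adjoint C)"
proof -
  obtain Q where Q: "Q \<in> unitary_group n" "length (eigvals A) = n"
    "A = Q * mat_diag n (\<lambda>k. of_real (eigvals A ! k)) * mat_adjoint Q"
    using spectral_eigvals[OF A] by metis
  note Q' = unitary_groupD[OF Q(1)]
  have Ac: "A \<in> carrier_mat n n" using A by (simp add: hermitian_def)
  define ls where "ls = eigvals A"
  define r where "r = length nz"
  define ks where "ks = filter (\<lambda>k. ls ! k \<noteq> 0) [0..<n]"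
  have "nz = filter (\<lambda>x. x \<noteq> 0) (map ((!) ls) [0..<n])"
    using Q(2) by (simp add: nz_def ls_def) (metis map_nth)
  then have nz: "nz = map ((!) ls) ks" by (simp add: filter_map o_def ks_def)
  have lk: "length ks = r" by (simp add: r_def nz)
  have ks: "ks ! j < n" if "j < r" for j using nth_mem[of j ks] that lk by (auto simp: ks_def)
  have dk: "distinct ks" by (simp add: ks_def)
  have nzj: "nz ! j = ls ! (ks ! j)" if "j < r" for j using that lk by (simp add: nz)
  define C where "C = mat n r (\<lambda>(i, j). Q $$ (i, ks ! j))"
  have C: "C \<in> carrier_mat n r" by (simp add: C_def)
  have Cij: "C $$ (i, j) = Q $$ (i, ks ! j)" if "i < n" "j < r" for i j using that by (simp add: C_def)
  note C' = mat_adjoint_carrier[OF C]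
  have CC: "mat_adjoint C * C = 1\<^sub>m r"
  proof (rule eq_matI)
    fix i j assume "i < dim_row (1\<^sub>m r)" "j < dim_col (1\<^sub>m r)"
    then have ij: "i < r" "j < r" by auto
    have "(mat_adjoint C * C) $$ (i, j) = (mat_adjoint Q * Q) $$ (ks ! i, ks ! j)"
      using ij ks C Q'(1) by (simp add: scalar_prod_def mat_adjoint_index[OF C] mat_adjoint_index[OF Q'(1)])
        (simp add: C_def)
    also have "\<dots> = 1\<^sub>m r $$ (i, j)"
      unfolding Q'(2) using ij ks dk lk by (simp add: nth_eq_iff_index_eq)
    finally show "(mat_adjoint C * C) $$ (i, j) = 1\<^sub>m r $$ (i, j)" .
  qed (use C in auto)
  have Cx: "coord (mop (mat_adjoint C) x) j = coord (mop (mat_adjoint Q) x) (ks ! j)" if "j < r" for x j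
    using that ks[OF that] by (simp add: coord_mop[OF C'] coord_mop[OF mat_adjoint_carrier[OF Q'(1)]]
        mat_adjoint_index[OF C] mat_adjoint_index[OF Q'(1)]) (simp add: C_def)
  define D where "D = (mat_diag r (\<lambda>j. of_real (nz ! j)) :: 'a mat)"
  have D: "D \<in> carrier_mat r r" by (simp add: D_def)
  have DC: "D * mat_adjoint C \<in> carrier_mat r n" by (rule mult_carrier_mat[OF D C'])
  have "A = C * (D * mat_adjoint C)"
  proof (rule mat_eq_mopI[OF Ac mult_carrier_mat[OF C DC]])
    fix x :: "'a fvec"
    define w where "w = mop (mat_adjoint Q) x"
    show "mop A x = mop (C * (D * mat_adjoint C)) x"
    proof (rule fvec_eqI)
      fix i
      have "coord (mop A x) i = (if i < n then \<Sum>k<n. Q $$ (i, k) * ((ls ! k) *\<^sub>R coord w k) else 0)"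
        unfolding mop_spectral[OF Q(1,3)] by (simp add: coord_mop[OF Q'(1)] w_def ls_def)
      also have "(\<Sum>k<n. Q $$ (i, k) * ((ls ! k) *\<^sub>R coord w k)) = (\<Sum>k\<in>set ks. Q $$ (i, k) * ((ls ! k) *\<^sub>R coord w k))"
        by (rule sum.mono_neutral_right) (auto simp: ks_def)
      also have "\<dots> = (\<Sum>j<r. Q $$ (i, ks ! j) * ((ls ! (ks ! j)) *\<^sub>R coord w (ks ! j)))"
        using sum.reindex_bij_betw[OF bij_betw_nth[OF dk refl refl], of "\<lambda>k. Q $$ (i, k) * ((ls ! k) *\<^sub>R coord w k)"]
        by (simp add: lk)
      also have "(if i < n then \<dots> else 0) = coord (mop (C * (D * mat_adjoint C)) x) i"
        unfolding mop_mult[OF C DC] mop_mult[OF D C'] coord_mop[OF C]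
        unfolding D_def mop_mat_diag_of_real
        by (auto simp: Cx nzj w_def Cij intro!: sum.cong)
      finally show "coord (mop A x) i = coord (mop (C * (D * mat_adjoint C)) x) i" .
    qed
  qed
  then show ?thesis using that C CC unfolding D_def r_def by blast
qed

lemma col_space_mult_subset:
  fixes A :: "'a::field mat"
  assumes "A \<in> carrier_mat n m" "B \<in> carrier_mat m p"
  shows "vec_space.col_space n (A * B) \<subseteq> vec_space.col_space n A"
proof -
  interpret vec_space "TYPE('a)" n .
  show ?thesis
    using col_space_eq[OF assms(1)] col_space_eq[OF mult_carrier_mat[OF assms]] assms
    by (auto intro!: bexI[of _ "B *\<^sub>v _"])
qed

text \<open>\<open>A\<close> and \<open>C\<close> are right multiples of each other and thus have
  the same column space, and the orthonormal columns of \<open>C\<close> are linearly independent.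
  This identifies the rank with the number of entries that \<open>nz_eigval\<close>
  enumerates.\<close>

lemma rank_hermitian:
  fixes A :: "'a::rc_field mat"
  assumes A: "hermitian n A"
  shows "vec_space.rank n A = length (filter (\<lambda>x. x \<noteq> 0) (eigvals A))"
proof -
  interpret vec_space "TYPE('a)" n .
  define nz where "nz = filter (\<lambda>x. x \<noteq> 0) (eigvals A)"
  define r where "r = length nz"
  obtain C where C: "C \<in> carrier_mat n r" and CC: "mat_adjoint C * C = 1\<^sub>m r"
    and AC: "A = C * (mat_diag r (\<lambda>j. of_real (nz ! j)) * mat_adjoint C)"
    using hermitian_compact_decomposition[OF A] unfolding nz_def r_def by blast
  have Ac: "A \<in> carrier_mat n n" using A by (simp add: hermitian_def)
  note C' = mat_adjoint_carrier[OF C]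
  define D where "D = (mat_diag r (\<lambda>j. of_real (nz ! j)) :: 'a mat)"
  define E where "E = (mat_diag r (\<lambda>j. of_real (1 / nz ! j)) :: 'a mat)"
  have DE: "D \<in> carrier_mat r r" "E \<in> carrier_mat r r" by (simp_all add: D_def E_def)
  have nz0: "nz ! j \<noteq> 0" if "j < r" for j
    using nth_mem[of j nz] that unfolding r_def nz_def by auto
  have DEid: "D * E = 1\<^sub>m r"
    unfolding D_def E_def mat_diag_diag
    by (rule eq_matI) (auto simp: mat_diag_def nz0)
  have "C = A * (C * E)"
  proof (rule mat_eq_mopI[OF C])
    show "A * (C * E) \<in> carrier_mat n r" using Ac C DE by simp
    fix x :: "'a fvec" assume x: "x \<in> fspace r"
    have "mop (A * (C * E)) x = mop A (mop C (mop E x))"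
      using mop_mult[OF Ac mult_carrier_mat[OF C DE(2)]] mop_mult[OF C DE(2)] by simp
    also have "\<dots> = mop C (mop D (mop (mat_adjoint C) (mop C (mop E x))))"
      unfolding AC D_def[symmetric] mop_mult[OF C mult_carrier_mat[OF DE(1) C']] mop_mult[OF DE(1) C'] ..
    also have "\<dots> = mop C (mop D (mop E x))"
      by (simp add: mop_unitary[OF C CC] mop_in_fspace[OF DE(2)])
    also have "\<dots> = mop C x"
      using mop_mult[OF DE, of x] x by (simp add: DEid mop_one)
    finally show "mop C x = mop (A * (C * E)) x" by simp
  qed
  then have "col_space C \<subseteq> col_space A"
    using col_space_mult_subset[OF Ac mult_carrier_mat[OF C DE(2)]] by simp
  moreover have "col_space A \<subseteq> col_space C"
    using col_space_mult_subset[OF C mult_carrier_mat[OF DE(1) C']] AC by (simp add: D_def)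
  ultimately have "rank A = rank C" by (simp add: rank_def col_space_def)
  also have "rank C = r"
  proof (rule lin_indpt_full_rank[OF C])
    show dist: "distinct (cols C)"
      unfolding distinct_conv_nth
    proof (intro allI impI notI)
      fix i j assume ij: "i < length (cols C)" "j < length (cols C)" "i \<noteq> j" "cols C ! i = cols C ! j"
      then have "i < r" "j < r" "col C i = col C j" using C by auto
      then have "(mat_adjoint C * C) $$ (i, i) = (mat_adjoint C * C) $$ (i, j)" using C by simp
      then show False using CC ij(3) \<open>i < r\<close> \<open>j < r\<close> by simp
    qed
    show "lin_indpt (set (cols C))"
    proof
      assume "lin_dep (set (cols C))"
      then obtain v where v: "v \<in> carrier_vec r" "v \<noteq> 0\<^sub>v r" "C *\<^sub>v v = 0\<^sub>v n"
        using lin_depE[OF C _ dist] by blast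
      have "mat_adjoint C *\<^sub>v (C *\<^sub>v v) = v"
        using C v(1) CC by (simp flip: assoc_mult_mat_vec[OF C' C])
      moreover have "mat_adjoint C *\<^sub>v 0\<^sub>v n = 0\<^sub>v r"
        using C' by (intro eq_vecI) (auto simp: scalar_prod_def)
      ultimately show False using v by simp
    qed
  qed
  finally show ?thesis by (simp add: r_def nz_def)
qed

text \<open>
  Both \<open>C\<close> and \<open>V\<close> have orthonormal columns in the range of \<open>P\<close>, so that \<open>C\<^sup>*V\<close> is a square isometry
  and \<open>VV\<^sup>* = CC\<^sup>*\<close>.
\<close>

lemma nz_eigenbasis_decomposition:
  fixes P V :: "'a::rc_field mat"
  assumes P: "hermitian n P" and M: "vec_space.rank n P = m" and V: "nz_eigenbasis n m P V"
  shows "P = V * (mat_diag m (\<lambda>j. of_real (nz_eigval P (j + 1))) * mat_adjoint V)"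
proof -
  define nz where "nz = filter (\<lambda>x. x \<noteq> 0) (eigvals P)"
  have lm: "length nz = m" using rank_hermitian[OF P] M by (simp add: nz_def)
  have \<theta>: "nz_eigval P (j + 1) = nz ! j" for j by (simp add: nz_eigval_def nz_def)
  have nz0: "nz ! j \<noteq> 0" if "j < m" for j
    using nth_mem[of j nz] that unfolding lm by (auto simp: nz_def)
  obtain C where C: "C \<in> carrier_mat n m" and CC: "mat_adjoint C * C = 1\<^sub>m m"
    and PC: "P = C * (mat_diag m (\<lambda>j. of_real (nz ! j)) * mat_adjoint C)"
    using hermitian_compact_decomposition[OF P] unfolding nz_def[symmetric] lm by blast
  have Pc: "P \<in> carrier_mat n n" using P by (simp add: hermitian_def)
  have Vc: "V \<in> carrier_mat n m" and VV: "mat_adjoint V * V = 1\<^sub>m m"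
    and Ve: "\<And>j. j < m \<Longrightarrow> eigenvector P (col V j) (of_real (nz ! j))"
    using V unfolding nz_eigenbasis_def
    by (auto simp: nz_eigval_def nz_def dest!: bspec[of _ _ "Suc _"])
  note C' = mat_adjoint_carrier[OF C] and V' = mat_adjoint_carrier[OF Vc]
  define D where "D = (mat_diag m (\<lambda>j. of_real (nz ! j)) :: 'a mat)"
  have D: "D \<in> carrier_mat m m" by (simp add: D_def)
  have mP: "mop P x = mop C (mop D (mop (mat_adjoint C) x))" for x
    unfolding PC D_def[symmetric] mop_mult[OF C mult_carrier_mat[OF D C']] mop_mult[OF D C'] ..
  have PV: "P * V = V * D"
  proof (rule eq_matI)
    fix i j assume "i < dim_row (V * D)" "j < dim_col (V * D)"
    then have ij: "i < n" "j < m" using Vc D by auto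
    have "(P * V) $$ (i, j) = (P *\<^sub>v col V j) $ i" using ij Pc Vc by simp
    also have "P *\<^sub>v col V j = of_real (nz ! j) \<cdot>\<^sub>v col V j" using Ve[OF ij(2)] by (simp add: eigenvector_def)
    also have "\<dots> $ i = (V * D) $$ (i, j)"
      using ij Vc unfolding D_def mat_diag_mult_right[OF Vc] by simp
    finally show "(P * V) $$ (i, j) = (V * D) $$ (i, j)" .
  qed (use Pc Vc D in auto)
  define E where "E = (mat_diag m (\<lambda>j. of_real (1 / nz ! j)) :: 'a mat)"
  have E: "E \<in> carrier_mat m m" by (simp add: E_def)
  have DE: "D * E = 1\<^sub>m m"
    unfolding D_def E_def mat_diag_diag by (rule eq_matI) (auto simp: mat_diag_def nz0)
  \<comment> \<open>All eigenvalues in \<open>D\<close> are nonzero, so every vector in the range of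
    \<open>V\<close> is an image under \<open>P\<close> and hence lies in the range of
    \<open>C\<close>.\<close>
  have proj: "mop C (mop (mat_adjoint C) (mop V x)) = mop V x" if x: "x \<in> fspace m" for x
  proof -
    define y where "y = mop E x"
    have "mop D y = x" using mop_mult[OF D E, of x] x by (simp add: DE mop_one y_def)
    then have "mop V x = mop V (mop D y)" by simp
    also have "\<dots> = mop P (mop V y)"
      using mop_mult[OF Vc D, of y] mop_mult[OF Pc Vc, of y] PV by simp
    finally have "mop V x = mop C (mop D (mop (mat_adjoint C) (mop V y)))" by (simp only: mP)
    then show ?thesis using mop_unitary[OF C CC mop_in_fspace[OF D]] by simp
  qed
  define G where "G = mat_adjoint C * V"
  have G: "G \<in> carrier_mat m m" unfolding G_def by (rule mult_carrier_mat[OF C' Vc])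
  have mG: "mop G x = mop (mat_adjoint C) (mop V x)" for x unfolding G_def by (rule mop_mult[OF C' Vc])
  have "mat_adjoint G * G = 1\<^sub>m m"
  proof (rule mat_eq_mopI[OF mult_carrier_mat[OF mat_adjoint_carrier[OF G] G] one_carrier_mat])
    fix x :: "'a fvec" assume x: "x \<in> fspace m"
    define d where "d = mop (mat_adjoint G * G) x - x"
    have d: "d \<in> fspace m"
      unfolding d_def by (intro fspace_closed x mop_in_fspace[OF mult_carrier_mat[OF mat_adjoint_carrier[OF G] G]])
    have "inner (mop (mat_adjoint G * G) x) d = inner (mop G x) (mop G d)"
      using inner_mop_left[OF mat_adjoint_carrier[OF G] d, of "mop G x"]
      by (simp add: mop_mult[OF mat_adjoint_carrier[OF G] G])
    also have "\<dots> = inner (mop V x) (mop V d)"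
      using inner_mop_left[OF C mop_in_fspace[OF Vc], of "mop (mat_adjoint C) (mop V x)" d] proj[OF x]
      by (simp add: mG)
    also have "\<dots> = inner x d"
      using inner_mop_left[OF Vc mop_in_fspace[OF Vc], of x d] mop_unitary[OF Vc VV d] by simp
    finally have "inner d d = 0" by (subst d_def) (simp add: inner_diff_left)
    then show "mop (mat_adjoint G * G) x = mop (1\<^sub>m m) x" using x by (simp add: d_def mop_one)
  qed
  then have "G \<in> unitary_group m" using G by (simp add: unitary_group_def)
  \<comment> \<open>A square isometry is also a right inverse of its adjoint. This reverses the
    inclusion of ranges, which is where the equality of the two numbers of columns is used.\<close>
  then have GG: "mop G (mop (mat_adjoint G) y) = y" if "y \<in> fspace m" for y
    using mop_adjoint_unitary that by blast
  have G': "mop (mat_adjoint G) y = mop (mat_adjoint V) (mop C y)" if y: "y \<in> fspace m" for y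
  proof -
    define d where "d = mop (mat_adjoint G) y - mop (mat_adjoint V) (mop C y)"
    have d: "d \<in> fspace m" unfolding d_def
      by (intro fspace_closed mop_in_fspace[OF V'] mop_in_fspace[OF mat_adjoint_carrier[OF G]])
    have "inner d (mop (mat_adjoint G) y) = inner (mop (mat_adjoint C) (mop V d)) y"
      using inner_mop_left[OF G y, of d] by (simp add: mG)
    also have "\<dots> = inner (mop V d) (mop C y)"
      using inner_mop_left[OF C' y, of "mop V d"] by simp
    also have "\<dots> = inner d (mop (mat_adjoint V) (mop C y))"
      by (rule inner_mop_left[OF Vc mop_in_fspace[OF C]])
    finally have "inner d d = 0" by (subst (2) d_def) (simp add: inner_diff_right)
    then show ?thesis by (simp add: d_def)
  qed
  have VC: "mop V (mop (mat_adjoint V) (mop C y)) = mop C y" if y: "y \<in> fspace m" for y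
  proof -
    have "mop C y = mop C (mop G (mop (mat_adjoint G) y))" using GG[OF y] by simp
    also have "\<dots> = mop V (mop (mat_adjoint V) (mop C y))"
      unfolding G'[OF y] mG by (rule proj[OF mop_in_fspace[OF V']])
    finally show ?thesis by simp
  qed
  show ?thesis
    unfolding \<theta> D_def[symmetric]
  proof (rule mat_eq_mopI[OF Pc mult_carrier_mat[OF Vc mult_carrier_mat[OF D V']]])
    fix x :: "'a fvec" assume x: "x \<in> fspace n"
    have VP: "mop (mat_adjoint V) (mop P x) = mop D (mop (mat_adjoint V) x)"
    proof -
      define d where "d = mop (mat_adjoint V) (mop P x) - mop D (mop (mat_adjoint V) x)"
      have d: "d \<in> fspace m" unfolding d_def by (intro fspace_closed mop_in_fspace[OF V'] mop_in_fspace[OF D])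
      have sD: "inner (mop D u) w = inner u (mop D w)" for u w :: "'a fvec"
      proof -
        have "inner (mop D u) w = inner w (mop D u)" by (rule inner_commute)
        also have "\<dots> = inner u (mop D w)"
          unfolding D_def mop_mat_diag_of_real inner_fdiag
          by (intro sum.cong refl arg_cong2[of _ _ _ _ "(*)"] inner_commute)
        finally show ?thesis .
      qed
      have "inner d (mop (mat_adjoint V) (mop P x)) = inner (mop P (mop V d)) x"
        using inner_mop_left[OF Vc mop_in_fspace[OF Pc], of d x] inner_mop_hermitian[OF P x, of "mop V d"] by simp
      also have "mop P (mop V d) = mop V (mop D d)"
        using mop_mult[OF Vc D, of d] mop_mult[OF Pc Vc, of d] PV by simp
      also have "inner (mop V (mop D d)) x = inner d (mop D (mop (mat_adjoint V) x))"
        using inner_mop_left[OF Vc x, of "mop D d"] sD by simp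
      finally have "inner d d = 0" by (subst (2) d_def) (simp add: inner_diff_right)
      then show ?thesis by (simp add: d_def)
    qed
    have "mop P x = mop V (mop (mat_adjoint V) (mop P x))"
      unfolding mP by (rule VC[symmetric, OF mop_in_fspace[OF D]])
    also have "\<dots> = mop (V * (D * mat_adjoint V)) x"
      unfolding VP mop_mult[OF Vc mult_carrier_mat[OF D V']] mop_mult[OF D V'] ..
    finally show "mop P x = mop (V * (D * mat_adjoint V)) x" .
  qed
qed

section \<open>The square root of the identity plus the spikes\<close>

context spiked_model
begin

lemma hermitian_bump: "hermitian n (bump d)"
  by (rule hermitian_mopI[OF bump_carrier bump_sym])

lemma bump_mult: "mop (bump d) (mop (bump e) x) = mop (bump (\<lambda>j. d j * e j)) x" if "x \<in> fspace n"
proof -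
  let ?y = "mop (bump d) (mop (bump e) x)" and ?w = "mop (bump (\<lambda>j. d j * e j)) x"
  have "Vs ?y = Vs ?w" using that by (simp add: Vs_bump fdiag_fdiag)
  moreover have "?y - Vo (Vs ?y) = ?w - Vo (Vs ?w)" using that by (simp add: perp_bump)
  ultimately show ?thesis by simp
qed

lemma mat_sqrt_bump:
  assumes P: "P = V * (mat_diag m (\<lambda>j. of_real (\<theta> j)) * mat_adjoint V)"
  shows "mat_sqrt (1\<^sub>m n + P) = bump root"
proof (rule mat_sqrt_eqI)
  \<comment> \<open>A square root of the candidate: it writes the form of \<open>bump root\<close>
    as the squared norm of \<open>mop T x\<close>. It is invertible, whence the strict positivity
    required for uniqueness.\<close>
  define T where "T = bump (\<lambda>j. sqrt (root j))"
  have T: "T \<in> carrier_mat n n" "hermitian n T" by (simp_all add: T_def bump_carrier hermitian_bump)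
  have r: "0 < root j" if "j < m" for j using \<theta>_gt[OF that] by (simp add: root_def)
  have bump_cong: "mop (bump d) x = mop (bump e) x" if "\<And>j. j < m \<Longrightarrow> d j = e j" "x \<in> fspace n" for d e x
  proof -
    have "fdiag m (\<lambda>j. d j - 1) (Vs x) = fdiag m (\<lambda>j. e j - 1) (Vs x)"
      by (rule fvec_eqI) (simp add: that(1))
    then show ?thesis by (simp add: mop_bump that(2))
  qed
  have TT: "mop (bump root) x = mop T (mop T x)" if "x \<in> fspace n" for x
    unfolding T_def bump_mult[OF that] by (rule bump_cong[OF _ that]) (use r in \<open>simp add: less_imp_le\<close>)
  show "psd n (bump root)"
    unfolding psd_def
  proof (intro conjI hermitian_bump ballI)
    fix v :: "'a vec" assume v: "v \<in> carrier_vec n"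
    define x where "x = emb v"
    have x: "x \<in> fspace n" by (simp add: x_def emb_in_fspace[OF v])
    have "(bump root *\<^sub>v v) \<bullet>c v = cdot n x (mop (bump root) x)"
      using v bump_carrier[of root] by (simp add: cscalar_prod_eq_cdot[of _ n] mop_emb[OF bump_carrier] x_def)
    also have "\<dots> = cdot n (mop T x) (mop T x)"
      unfolding TT[OF x] using cdot_mop_left[OF T(1), of x "mop T x"] T(2) by (simp add: hermitian_def)
    also have "\<dots> = of_real ((norm (mop T x))\<^sup>2)" by (rule cdot_self[OF mop_in_fspace[OF T(1)]])
    finally show "0 \<le> (bump root *\<^sub>v v) \<bullet>c v" using of_real_nonneg[of "(norm (mop T x))\<^sup>2", where ?'a = 'a] by simp
  qed
  show "bump root * bump root = 1\<^sub>m n + P"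
  proof (rule mat_eq_mopI[OF mult_carrier_mat[OF bump_carrier bump_carrier]])
    have Dc: "mat_diag m (\<lambda>j. of_real (\<theta> j)) * mat_adjoint V \<in> carrier_mat m n"
      by (rule mult_carrier_mat[OF mat_diag_dim Vadj])
    have Pc: "P \<in> carrier_mat n n" unfolding P by (rule mult_carrier_mat[OF V(1) Dc])
    then show "1\<^sub>m n + P \<in> carrier_mat n n" by simp
    fix x :: "'a fvec" assume x: "x \<in> fspace n"
    have "mop (bump root * bump root) x = mop (bump (\<lambda>j. 1 + \<theta> j)) x"
      unfolding mop_mult[OF bump_carrier bump_carrier] bump_mult[OF x]
    proof (rule bump_cong[OF _ x])
      show "root j * root j = 1 + \<theta> j" if "j < m" for j using \<theta>_gt[OF that] by (simp add: root_def)
    qed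
    also have "\<dots> = mop (1\<^sub>m n + P) x"
      unfolding mop_mat_add[OF one_carrier_mat Pc] mop_one[OF x]
      unfolding P mop_mult[OF V(1) Dc] mop_mult[OF mat_diag_dim Vadj] mop_mat_diag_of_real mop_bump[OF x] by simp
    finally show "mop (bump root * bump root) x = mop (1\<^sub>m n + P) x" .
  qed
  fix x :: "'a fvec" assume x: "x \<in> fspace n" "x \<noteq> 0"
  have "inner (mop (bump root) x) x = inner (mop T x) (mop T x)"
    unfolding TT[OF x(1)] by (rule inner_mop_hermitian[OF T(2) x(1)])
  moreover have "mop T x \<noteq> 0"
  proof
    assume "mop T x = 0"
    then have "mop (bump (\<lambda>j. 1 / sqrt (root j))) (mop T x) = 0" by simp
    moreover have "mop (bump (\<lambda>j. 1 / sqrt (root j))) (mop T x) = x"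
      unfolding T_def
    proof (rule bump_bump)
      show "1 / sqrt (root j) * sqrt (root j) = 1" if "j < m" for j using r[OF that] by simp
    qed (rule x(1))
    ultimately show False using x(2) by simp
  qed
  ultimately show "0 < inner (mop (bump root) x) x" by simp
qed

end

section \<open>The T-transform\<close>

lemma T_transform_eq:
  "dim_row H = n \<Longrightarrow> T_transform H z = (\<Sum>k<n. eigvals H ! k / (z - eigvals H ! k)) / n"
  by (simp add: T_transform_def eigval_def sum.atLeast1_atMost_eq)

locale nonneg_spectrum =
  fixes n :: nat and ls :: "nat \<Rightarrow> real"
  assumes n: "0 < n" and dec: "\<And>i j. i \<le> j \<Longrightarrow> j < n \<Longrightarrow> ls j \<le> ls i"
    and nonneg: "\<And>k. k < n \<Longrightarrow> 0 \<le> ls k" and top: "0 < ls 0"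
begin

definition T :: "real \<Rightarrow> real" where "T z = (\<Sum>k<n. ls k / (z - ls k)) / n"

abbreviation bot :: real where "bot \<equiv> ls (n - 1)"

lemma bounds:
  assumes "k < n"
  shows "bot \<le> ls k" "ls k \<le> ls 0"
proof -
  have "k \<le> n - 1" "n - 1 < n" using assms by linarith+
  then show "bot \<le> ls k" "ls k \<le> ls 0" using dec assms by auto
qed

lemma outside: "k < n \<Longrightarrow> z < bot \<or> ls 0 < z \<Longrightarrow> z - ls k \<noteq> 0"
  using bounds[of k] by auto

lemma T_deriv:
  assumes "z < bot \<or> ls 0 < z"
  shows "(T has_real_derivative (- (\<Sum>k<n. ls k / (z - ls k)\<^sup>2) / n)) (at z)"
proof -
  have "((\<lambda>z. (\<Sum>k<n. ls k / (z - ls k)) / n) has_real_derivative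
      (\<Sum>k<n. - ls k / (z - ls k)\<^sup>2) / n) (at z)"
    using outside[OF _ assms] n
    by (auto intro!: derivative_eq_intros simp: power2_eq_square)
  then show ?thesis unfolding T_def[abs_def] by (simp add: sum_negf)
qed

lemma T_deriv_neg:
  assumes "z < bot \<or> ls 0 < z"
  shows "- (\<Sum>k<n. ls k / (z - ls k)\<^sup>2) / n < 0"
proof -
  have "0 < (\<Sum>k<n. ls k / (z - ls k)\<^sup>2)"
  proof (rule sum_pos2[of _ 0])
    show "0 < ls 0 / (z - ls 0)\<^sup>2" using top outside[OF n assms] by simp
  qed (use n nonneg in auto)
  then show ?thesis using n by simp
qed

lemma T_decreasing:
  assumes "x < y" "y < bot \<or> ls 0 < x"
  shows "T y < T x"
proof (rule DERIV_neg_imp_decreasing[OF assms(1)])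
  fix u assume u: "x \<le> u" "u \<le> y"
  then have "u < bot \<or> ls 0 < u" using assms(2) by auto
  then show "\<exists>d. (T has_real_derivative d) (at u) \<and> d < 0" using T_deriv T_deriv_neg by blast
qed

lemma T_inj_right: "inj_on T {ls 0 <..}"
proof (rule inj_onI)
  fix x y assume "x \<in> {ls 0 <..}" "y \<in> {ls 0 <..}" "T x = T y"
  then show "x = y" using T_decreasing[of x y] T_decreasing[of y x] by (cases x y rule: linorder_cases) auto
qed

lemma T_inj_left: "inj_on T {..< bot}"
proof (rule inj_onI)
  fix x y assume "x \<in> {..< bot}" "y \<in> {..< bot}" "T x = T y"
  then show "x = y" using T_decreasing[of x y] T_decreasing[of y x] by (cases x y rule: linorder_cases) auto
qed

lemma T_le: "ls 0 < z \<Longrightarrow> T z \<le> ls 0 / (z - ls 0)"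
proof -
  assume z: "ls 0 < z"
  have "(\<Sum>k<n. ls k / (z - ls k)) \<le> (\<Sum>k<n. ls 0 / (z - ls 0))"
  proof (rule sum_mono)
    fix k assume "k \<in> {..<n}"
    then have "0 \<le> ls k" "ls k \<le> ls 0" using nonneg dec[of 0 k] by auto
    then show "ls k / (z - ls k) \<le> ls 0 / (z - ls 0)" using z by (intro frac_le) auto
  qed
  then show ?thesis using n by (simp add: T_def divide_le_eq mult.commute)
qed

lemma T_ge: "ls 0 < z \<Longrightarrow> ls 0 / (z - ls 0) / n \<le> T z"
proof -
  assume z: "ls 0 < z"
  have "ls 0 / (z - ls 0) \<le> (\<Sum>k<n. ls k / (z - ls k))"
  proof (rule member_le_sum)
    fix k assume "k \<in> {..<n} - {0}"
    then have "0 \<le> ls k" "ls k \<le> ls 0" using nonneg dec[of 0 k] by auto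
    then show "0 \<le> ls k / (z - ls k)" using z by simp
  qed (use n in auto)
  then show ?thesis unfolding T_def by (rule divide_right_mono) simp
qed

lemma T_surj_right:
  assumes y: "0 < y"
  obtains z where "ls 0 < z" "T z = y"
proof -
  \<comment> \<open>The end points solve the two elementary bounds \<open>T_ge\<close> and
    \<open>T_le\<close> for the value \<open>y\<close>, so \<open>T a \<ge> y \<ge> T b\<close> and
    the intermediate value theorem applies.\<close>
  define a where "a = ls 0 + ls 0 / (n * y)"
  define b where "b = ls 0 + ls 0 / y"
  have a: "ls 0 < a" using top y n by (simp add: a_def)
  have b: "ls 0 < b" using top y by (simp add: b_def)
  have "ls 0 / (n * y) \<le> ls 0 / y" using top y n by (intro divide_left_mono) auto
  then have ab: "a \<le> b" by (simp add: a_def b_def)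
  have Ta: "y \<le> T a" using T_ge[OF a] top y n by (simp add: a_def)
  have Tb: "T b \<le> y" using T_le[OF b] top y by (simp add: b_def)
  have "\<exists>x\<ge>a. x \<le> b \<and> T x = y"
  proof (rule IVT2'[OF Tb Ta ab])
    show "continuous_on {a..b} T"
    proof (rule DERIV_continuous_on)
      fix x assume "x \<in> {a..b}"
      then have "x < bot \<or> ls 0 < x" using a by simp
      from has_field_derivative_at_within[OF T_deriv[OF this]]
      show "(T has_real_derivative - (\<Sum>k<n. ls k / (x - ls k)\<^sup>2) / n) (at x within {a..b})" .
    qed
  qed
  then obtain x where x: "a \<le> x" "T x = y" by blast
  show ?thesis by (rule that[of x]) (use a x in auto)
qed

end

text \<open>Each summand of \<open>K\<close> serves one purpose: \<open>1 + B\<close> bounds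
  \<open>1 + t\<close> as well as \<open>\<bar>z - ls k\<bar>\<close> on the left of the spectrum,
  \<open>B + B\<^sup>2\<close> bounds \<open>z\<close> on the right,
  \<open>1 / (2 * \<delta>)\<close> bounds the resolvent, and
  \<open>(1 + B) / (2 * \<delta>)\<close> bounds \<open>1 / s\<close> for a positive spike.\<close>

lemma outlier_scalars:
  fixes ls :: "nat \<Rightarrow> real"
  assumes spec: "nonneg_spectrum n ls" and \<delta>: "0 < \<delta>" and B: "0 < B"
    and le': "\<forall>k<n. ls k \<le> B"
    and t: "t \<noteq> 0" "-1 < t" "t \<le> B"
    and T: "(\<Sum>k<n. ls k / (z - ls k)) / n = 1 / t"
    and pos': "0 < t \<longrightarrow> ls 0 + 2 * \<delta> \<le> z" and neg': "t < 0 \<longrightarrow> z \<le> ls (n - 1) - 2 * \<delta>"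
  defines "g \<equiv> (\<Sum>k<n. 1 / (z - ls k)) / n" and "g2 \<equiv> (\<Sum>k<n. (1 / (z - ls k))\<^sup>2) / n"
    and "K \<equiv> 1 + B + B\<^sup>2 + (1 + B) / (2 * \<delta>) + 1 / (2 * \<delta>)"
    and "\<sigma> \<equiv> if 0 < t then 1 else -1 :: real"
  shows "1 \<le> K" "1 + B \<le> K"
    "\<And>k. k < n \<Longrightarrow> \<bar>z - ls k\<bar> \<le> K" "\<And>k. k < n \<Longrightarrow> 1 \<le> K * \<bar>z - ls k\<bar>"
    "\<And>k. k < n \<Longrightarrow> 0 < \<sigma> * (z - ls k)"
    "\<bar>z\<bar> \<le> K" "1 \<le> K * \<bar>g\<bar>" "1 \<le> K * (z - 1 / g)" "(z - 1 / g) * (1 + t) = z"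
    "g\<^sup>2 \<le> g2" "g2 \<le> K\<^sup>2"
    "- (1 / (1 + (1 + t) * (g2 / g\<^sup>2 - 1))) = (t + 1) / (t\<^sup>2 * z * (- (\<Sum>k<n. ls k / (z - ls k)\<^sup>2) / n))"
proof -
  interpret nonneg_spectrum n ls by (rule spec)
  note le = le'[rule_format] and pos = pos'[rule_format] and neg = neg'[rule_format]
  have n': "real n > 0" using n by simp
  have bot: "ls (n - 1) \<le> ls k" "ls k \<le> ls 0" "0 \<le> ls k" if "k < n" for k
    using bounds nonneg that by auto
  have K0: "0 \<le> B\<^sup>2" "0 \<le> (1 + B) / (2 * \<delta>)" "0 < 1 / (2 * \<delta>)" using B \<delta> by auto
  show K1: "1 \<le> K" and KB: "1 + B \<le> K" using K0 B by (auto simp: K_def)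
  have KBB: "B + B\<^sup>2 \<le> K" "1 / (2 * \<delta>) \<le> K" "(1 + B) / (2 * \<delta>) \<le> K" using K0 B by (auto simp: K_def)
  have tz: "(\<Sum>k<n. ls k / (z - ls k)) / n = T z" by (simp add: T_def)
  \<comment> \<open>Replacing every eigenvalue by the largest one gives
    \<open>z \<le> ls 0 * (1 + t)\<close>.\<close>
  have zpos: "0 < t \<Longrightarrow> z \<le> B + B\<^sup>2"
  proof -
    assume tp: "0 < t"
    have z: "ls 0 < z" using pos[OF tp] \<delta> by simp
    have "1 / t \<le> ls 0 / (z - ls 0)" using T_le[OF z] T by (simp add: tz)
    then have "z - ls 0 \<le> ls 0 * t" using tp z by (simp add: field_simps)
    also have "\<dots> \<le> B * B" using le[OF n] t B top tp by (intro mult_mono) auto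
    finally show ?thesis using le[OF n] by (simp add: power2_eq_square)
  qed
  \<comment> \<open>To the left of the spectrum and for \<open>z \<le> 0\<close>, each term of
    \<open>T z\<close> is at least \<open>- 1\<close>. That would give
    \<open>1 / t \<ge> - 1\<close>, contrary to \<open>-1 < t < 0\<close>.\<close>
  have zneg: "t < 0 \<Longrightarrow> 0 < z"
  proof (rule ccontr)
    assume tn: "t < 0" and "\<not> 0 < z"
    then have z: "z \<le> 0" by simp
    have "- 1 = (\<Sum>k<n. - 1 :: real) / n" using n by simp
    also have "\<dots> \<le> (\<Sum>k<n. ls k / (z - ls k)) / n"
    proof (intro divide_right_mono sum_mono)
      fix k assume "k \<in> {..<n}"
      then have k: "0 \<le> ls k" "z - ls k < 0" using bot[of k] neg[OF tn] \<delta> by auto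
      then show "- 1 \<le> ls k / (z - ls k)" using z by (simp add: le_divide_eq)
    qed simp
    finally have "- 1 \<le> 1 / t" using T by simp
    then show False using tn t(2) by (simp add: le_divide_eq)
  qed
  have z0: "0 < z" using zneg pos top \<delta> t(1) by (cases "0 < t") auto
  have \<sigma>pos: "2 * \<delta> \<le> \<sigma> * (z - ls k)" "\<sigma> * (z - ls k) \<le> K" if k: "k < n" for k
  proof -
    have "2 * \<delta> \<le> \<sigma> * (z - ls k) \<and> \<sigma> * (z - ls k) \<le> K"
    proof (cases "0 < t")
      case True
      then show ?thesis using pos zpos bot[OF k] KBB by (simp add: \<sigma>_def)
    next
      case False
      then have "t < 0" using t(1) by simp
      then show ?thesis using neg z0 bot[OF k] le[OF k] KB by (simp add: \<sigma>_def)
    qed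
    then show "2 * \<delta> \<le> \<sigma> * (z - ls k)" "\<sigma> * (z - ls k) \<le> K" by auto
  qed
  have \<sigma>abs: "\<sigma> * (z - ls k) = \<bar>z - ls k\<bar>" if "k < n" for k
    using \<sigma>pos[OF that] \<delta> by (auto simp: \<sigma>_def split: if_splits)
  show absK: "\<bar>z - ls k\<bar> \<le> K" if "k < n" for k using \<sigma>pos[OF that] \<sigma>abs[OF that] by simp
  have absd: "2 * \<delta> \<le> \<bar>z - ls k\<bar>" if "k < n" for k using \<sigma>pos[OF that] \<sigma>abs[OF that] by simp
  have Kd: "1 \<le> K * (2 * \<delta>)" using KBB(2) \<delta> by (simp add: divide_le_eq)
  show absK': "1 \<le> K * \<bar>z - ls k\<bar>" if "k < n" for k
    using Kd mult_left_mono[OF absd[OF that], of K] K1 by linarith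
  show "0 < \<sigma> * (z - ls k)" if "k < n" for k using \<sigma>pos[OF that] \<delta> by linarith
  have zls: "z - ls k \<noteq> 0" if "k < n" for k using absd[OF that] \<delta> by auto
  show "\<bar>z\<bar> \<le> K"
  proof (cases "0 < t")
    case True
    then show ?thesis using zpos z0 KBB by simp
  next
    case False
    then have "t < 0" using t(1) by simp
    then show ?thesis using neg z0 le[of "n - 1"] n KB \<delta> by simp
  qed
  have \<sigma>1: "\<bar>\<sigma>\<bar> = 1" "\<sigma> * \<sigma> = 1" by (auto simp: \<sigma>_def)
  \<comment> \<open>All differences \<open>z - ls k\<close> have the sign \<open>\<sigma>\<close>,
    so nothing cancels in the mean and \<open>\<bar>g\<bar>\<close> is bounded away from
    zero.\<close>
  have sg: "\<sigma> * g = (\<Sum>k<n. 1 / \<bar>z - ls k\<bar>) / n"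
  proof -
    have inv: "\<sigma> * (1 / w) = 1 / (\<sigma> * w)" for w by (simp add: \<sigma>_def)
    have "\<sigma> * (1 / (z - ls k)) = 1 / \<bar>z - ls k\<bar>" if "k < n" for k
      unfolding \<sigma>abs[OF that, symmetric] by (rule inv)
    then show ?thesis by (simp add: g_def sum_distrib_left)
  qed
  have avg_le: "(\<Sum>k<n. f k) / n \<le> c" if "\<And>k. k < n \<Longrightarrow> f k \<le> c" for f :: "nat \<Rightarrow> real" and c
  proof -
    have "(\<Sum>k<n. f k) \<le> (\<Sum>k<n. c)" using that by (intro sum_mono) auto
    then show ?thesis using n' by (simp add: divide_le_eq mult.commute)
  qed
  have avg_ge: "c \<le> (\<Sum>k<n. f k) / n" if "\<And>k. k < n \<Longrightarrow> c \<le> f k" for f :: "nat \<Rightarrow> real" and c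
  proof -
    have "(\<Sum>k<n. c) \<le> (\<Sum>k<n. f k)" using that by (intro sum_mono) auto
    then show ?thesis using n' by (simp add: le_divide_eq mult.commute)
  qed
  have "1 / K \<le> \<sigma> * g"
    unfolding sg
  proof (rule avg_ge)
    fix k assume k: "k < n"
    have "0 < \<bar>z - ls k\<bar>" using zls[OF k] by simp
    then show "1 / K \<le> 1 / \<bar>z - ls k\<bar>" using absK[OF k] K1 by (intro divide_left_mono) auto
  qed
  then have "1 / K \<le> \<bar>g\<bar>" using \<sigma>1 by (metis abs_ge_self abs_mult mult_1 order_trans)
  then show gK: "1 \<le> K * \<bar>g\<bar>" using K1 by (simp add: divide_le_eq mult.commute)
  have g0: "g \<noteq> 0" using gK by auto
  \<comment> \<open>Termwise \<open>z / (z - ls k) = 1 + ls k / (z - ls k)\<close>. This identity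
    makes \<open>s * (1 + t) = z\<close>.\<close>
  have zg: "z * g = (1 + t) / t"
  proof -
    have "z * g = (\<Sum>k<n. 1 + ls k / (z - ls k)) / n"
      unfolding g_def sum_divide_distrib sum_distrib_left
      by (rule sum.cong) (use zls in \<open>auto simp: field_simps\<close>)
    also have "\<dots> = 1 + 1 / t" using n T by (simp add: sum.distrib add_divide_distrib)
    finally show ?thesis using t(1) by (simp add: field_simps)
  qed
  have "1 / g = z / ((1 + t) / t)" unfolding zg[symmetric] using z0 by simp
  then have ig: "1 / g = z * t / (1 + t)" by simp
  have s: "z - 1 / g = z / (1 + t)" unfolding ig using t(2) by (simp add: field_simps)
  show "(z - 1 / g) * (1 + t) = z" unfolding s using t(2) by simp
  show "1 \<le> K * (z - 1 / g)"
  proof (cases "0 < t")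
    case True
    have "2 * \<delta> / (1 + B) \<le> z / (1 + t)" using pos[OF True] top t True \<delta> by (intro frac_le) auto
    then have "K * (2 * \<delta> / (1 + B)) \<le> K * (z / (1 + t))" using K1 by (intro mult_left_mono) auto
    moreover have "(1 + B) / (2 * \<delta>) * (2 * \<delta> / (1 + B)) \<le> K * (2 * \<delta> / (1 + B))"
      using KBB(3) \<delta> B by (intro mult_right_mono) auto
    moreover have "(1 + B) / (2 * \<delta>) * (2 * \<delta> / (1 + B)) = 1" using \<delta> B by simp
    ultimately show ?thesis unfolding s by linarith
  next
    case False
    then have tn: "t < 0" using t(1) by simp
    then have \<sigma>m: "\<sigma> = -1" by (simp add: \<sigma>_def)
    have bz: "0 < ls (n - 1) - z" using neg[OF tn] \<delta> by simp
    \<comment> \<open>To the left of the spectrum \<open>- 1 / g\<close> is at least the distance to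
      the smallest eigenvalue. Together with \<open>z > 0\<close> this gives
      \<open>s \<ge> 2 * \<delta>\<close>.\<close>
    have "\<sigma> * g \<le> 1 / (ls (n - 1) - z)"
      unfolding sg
    proof (rule avg_le)
      fix k assume k: "k < n"
      have "ls (n - 1) - z \<le> \<bar>z - ls k\<bar>" using bot[OF k] bz by simp
      then show "1 / \<bar>z - ls k\<bar> \<le> 1 / (ls (n - 1) - z)" using bz by (intro divide_left_mono) auto
    qed
    then have "- g \<le> 1 / (ls (n - 1) - z)" by (simp add: \<sigma>m)
    moreover have gn: "0 < - g"
    proof -
      have "0 < 1 / K" using K1 by simp
      then have "0 < \<sigma> * g" using \<open>1 / K \<le> \<sigma> * g\<close> by linarith
      then show ?thesis by (simp add: \<sigma>m)
    qed
    ultimately have "ls (n - 1) - z \<le> 1 / (- g)" using bz by (simp add: field_simps)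
    then have "2 * \<delta> \<le> z - 1 / g" using neg[OF tn] z0 by simp
    then have "K * (2 * \<delta>) \<le> K * (z - 1 / g)" using K1 by (intro mult_left_mono) auto
    then show ?thesis using Kd by linarith
  qed
  show g2: "g\<^sup>2 \<le> g2"
  proof -
    have "(\<Sum>k<n. 1 / (z - ls k))\<^sup>2 \<le> (\<Sum>k<n. (1 / (z - ls k))\<^sup>2) * n"
      using sum_squared_le_sum_of_squares[of "\<lambda>k. 1 / (z - ls k)" "{..<n}"] by simp
    then show ?thesis using n' by (simp add: g_def g2_def power_divide field_simps power2_eq_square)
  qed
  show "g2 \<le> K\<^sup>2"
    unfolding g2_def
  proof (rule avg_le)
    fix k assume k: "k < n"
    have "1 / \<bar>z - ls k\<bar> \<le> K" using absK'[OF k] absd[OF k] \<delta> by (simp add: divide_le_eq)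
    then have "(1 / \<bar>z - ls k\<bar>)\<^sup>2 \<le> K\<^sup>2" by (intro power_mono) auto
    then show "(1 / (z - ls k))\<^sup>2 \<le> K\<^sup>2" by (simp add: power_divide)
  qed
  define S where "S = (\<Sum>k<n. ls k / (z - ls k)\<^sup>2) / n"
  \<comment> \<open>\<open>- S\<close> is the derivative of the T-transform at \<open>z\<close>.
    Partial fractions express it by the two means \<open>g\<close> and \<open>g2\<close> that the
    concentration bounds involve.\<close>
  have S: "S = z * g2 - g"
  proof -
    have "z * (1 / w)\<^sup>2 - 1 / w = (z - w) / w\<^sup>2" if "w \<noteq> 0" for w
      using that by (simp add: power2_eq_square field_simps)
    from this[of "z - ls _"] have "z * (1 / (z - ls k))\<^sup>2 - 1 / (z - ls k) = ls k / (z - ls k)\<^sup>2" if "k < n" for k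
      using zls[OF that] by simp
    then have "(\<Sum>k<n. ls k / (z - ls k)\<^sup>2) = (\<Sum>k<n. z * (1 / (z - ls k))\<^sup>2 - 1 / (z - ls k))" by simp
    then show ?thesis
      by (simp add: S_def g_def g2_def sum_subtractf diff_divide_distrib sum_distrib_left)
  qed
  define h where "h = g2 / g\<^sup>2"
  \<comment> \<open>Since \<open>t * (z * g) = 1 + t\<close>, the denominator
    \<open>t\<^sup>2 * z * (- S)\<close> equals \<open>- (1 + t) * q\<close>. Hence the limit in the
    theorem is \<open>1 / q\<close>, the value found for the squared norm of the projected
    eigenvector.\<close>
  define q where "q = 1 + (1 + t) * (h - 1)"
  have "1 \<le> h" using g2 g0 by (simp add: h_def le_divide_eq)
  then have q: "1 \<le> q" using t(2) by (simp add: q_def)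
  have "t\<^sup>2 * z * (- S) = t\<^sup>2 * (z * g) - t\<^sup>2 * h * (z * g)\<^sup>2"
    using g0 by (simp add: S h_def power2_eq_square algebra_simps)
  also have "\<dots> = t * (1 + t) - h * (1 + t)\<^sup>2"
    unfolding zg using t(1) by (simp add: power2_eq_square)
  also have "\<dots> = - (1 + t) * q" by (simp add: q_def power2_eq_square algebra_simps)
  finally have "(t + 1) / (t\<^sup>2 * z * (- S)) = (t + 1) / (- (1 + t) * q)" by simp
  also have "- (1 + t) * q = (t + 1) * (- q)" by (simp add: algebra_simps)
  also have "(t + 1) / ((t + 1) * (- q)) = - (1 / q)" using t(2) by simp
  finally show "- (1 / (1 + (1 + t) * (g2 / g\<^sup>2 - 1))) = (t + 1) / (t\<^sup>2 * z * (- (\<Sum>k<n. ls k / (z - ls k)\<^sup>2) / n))"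
    by (simp add: S_def q_def h_def)
qed

section \<open>The outlier theorem\<close>

lemma mat_adjoint_mult:
  fixes A B :: "'a::rc_field mat"
  assumes A: "A \<in> carrier_mat n m" and B: "B \<in> carrier_mat m p"
  shows "mat_adjoint (A * B) = mat_adjoint B * mat_adjoint A"
proof (rule eq_matI)
  fix i j assume "i < dim_row (mat_adjoint B * mat_adjoint A)" "j < dim_col (mat_adjoint B * mat_adjoint A)"
  then have ij: "i < p" "j < n" using A B by auto
  then show "mat_adjoint (A * B) $$ (i, j) = (mat_adjoint B * mat_adjoint A) $$ (i, j)"
    using A B by (simp add: mat_adjoint_index[OF mult_carrier_mat[OF A B]] scalar_prod_def sum_conjugate
        mat_adjoint_index[OF A] mat_adjoint_index[OF B] conjugate_dist_mul mult.commute)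
qed (use A B in auto)

lemma admissible_nonneg_spectrum:
  fixes H :: "'a::rc_field mat"
  assumes H: "psd n H" "H \<noteq> 0\<^sub>m n n" and n: "0 < n"
  shows "nonneg_spectrum n (\<lambda>k. eigvals H ! k)"
proof
  have Hh: "hermitian n H" using H by (simp add: psd_def)
  obtain Q where Q: "length (eigvals H) = n" "sorted_wrt (\<ge>) (eigvals H)"
    using spectral_eigvals[OF Hh] by metis
  show "0 < n" by (rule n)
  show dec: "eigvals H ! j \<le> eigvals H ! i" if "i \<le> j" "j < n" for i j
    using Q that by (cases "i = j") (auto simp: sorted_wrt_iff_nth_less)
  show nonneg: "0 \<le> eigvals H ! k" if "k < n" for k by (rule psd_eigvals_nonneg[OF H(1) that])
  show "0 < eigvals H ! 0"
  proof (rule ccontr)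
    assume *: "\<not> 0 < eigvals H ! 0"
    have "eigvals H ! k = 0" if "k < n" for k using dec[of 0 k] nonneg[OF that] that * by simp
    then have "H = 0\<^sub>m n n" by (rule eigvals_eq_0_imp_zero[OF Hh])
    then show False using H(2) by simp
  qed
qed

text \<open>\<open>the_inv_into\<close> solves the equation only for values that are attained. For
  \<open>t > 0\<close> this is the surjectivity on the right of the spectrum; for
  \<open>t < 0\<close> it is the range condition in \<open>separated\<close>.\<close>

lemma T_inverse_solves:
  fixes H :: "'a::rc_field mat"
  assumes H: "psd n H" "H \<noteq> 0\<^sub>m n n" and n: "0 < n" and t: "t \<noteq> 0" and sep: "separated \<delta> H t"
  defines "z \<equiv> T_inverse H (1 / t)"
  shows "(\<Sum>k<n. eigvals H ! k / (z - eigvals H ! k)) / n = 1 / t"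
    and "0 < t \<longrightarrow> eigvals H ! 0 + 2 * \<delta> \<le> z"
    and "t < 0 \<longrightarrow> z \<le> eigvals H ! (n - 1) - 2 * \<delta>"
    and "z < eigvals H ! (n - 1) \<or> eigvals H ! 0 < z \<Longrightarrow>
      deriv (T_transform H) z = - (\<Sum>k<n. eigvals H ! k / (z - eigvals H ! k)\<^sup>2) / n"
proof -
  interpret nonneg_spectrum n "\<lambda>k. eigvals H ! k" by (rule admissible_nonneg_spectrum[OF H n])
  have dim: "dim_row H = n" using H(1) by (auto simp: psd_def hermitian_def)
  have TT: "T_transform H = T" by (rule ext) (simp add: T_transform_eq[OF dim] T_def)
  have ev: "eigval H (Suc 0) = eigvals H ! 0" "eigval H (dim_row H) = eigvals H ! (n - 1)"
    by (simp_all add: eigval_def dim)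
  have "T z = 1 / t"
  proof (cases "0 < t")
    case True
    then have "0 < 1 / t" by simp
    then obtain w where "eigvals H ! 0 < w" "T w = 1 / t" by (rule T_surj_right)
    then have "1 / t \<in> T ` {eigvals H ! 0 <..}" by (metis greaterThan_iff image_eqI)
    moreover have "z = the_inv_into {eigvals H ! 0 <..} T (1 / t)"
      using True by (simp add: z_def T_inverse_def ev TT)
    ultimately show ?thesis using f_the_inv_into_f[OF T_inj_right] by simp
  next
    case False
    then have tn: "t < 0" using t by simp
    then have "1 / t \<in> T ` {..< eigvals H ! (n - 1)}" using sep by (simp add: separated_def TT ev)
    moreover have "z = the_inv_into {..< eigvals H ! (n - 1)} T (1 / t)"
      using tn by (simp add: z_def T_inverse_def ev TT)
    ultimately show ?thesis using f_the_inv_into_f[OF T_inj_left] by simp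
  qed
  then show "(\<Sum>k<n. eigvals H ! k / (z - eigvals H ! k)) / n = 1 / t" by (simp add: T_def)
  show "0 < t \<longrightarrow> eigvals H ! 0 + 2 * \<delta> \<le> z" using sep by (simp add: separated_def ev z_def)
  show "t < 0 \<longrightarrow> z \<le> eigvals H ! (n - 1) - 2 * \<delta>" using sep by (simp add: separated_def ev z_def)
  show "z < eigvals H ! (n - 1) \<or> eigvals H ! 0 < z \<Longrightarrow>
      deriv (T_transform H) z = - (\<Sum>k<n. eigvals H ! k / (z - eigvals H ! k)\<^sup>2) / n"
    unfolding TT by (rule DERIV_imp_deriv[OF T_deriv])
qed

lemma nz_eigval_facts:
  fixes P :: "'a::rc_field mat"
  assumes P: "hermitian n P" "vec_space.rank n P = m" "opnorm P \<le> B"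
    and gt: "\<forall>x. eigenvalue P (of_real x) \<longrightarrow> -1 < x"
  shows "m \<le> n"
    and "\<And>j. j < m \<Longrightarrow> nz_eigval P (j + 1) \<noteq> 0 \<and> -1 < nz_eigval P (j + 1) \<and> nz_eigval P (j + 1) \<le> B"
    and "\<And>i j. i \<le> j \<Longrightarrow> j < m \<Longrightarrow> nz_eigval P (j + 1) \<le> nz_eigval P (i + 1)"
proof -
  define nz where "nz = filter (\<lambda>x. x \<noteq> 0) (eigvals P)"
  have lm: "length nz = m" using rank_hermitian[OF P(1)] P(2) by (simp add: nz_def)
  have \<theta>: "nz_eigval P (j + 1) = nz ! j" for j by (simp add: nz_eigval_def nz_def)
  have Pc: "P \<in> carrier_mat n n" using P(1) by (simp add: hermitian_def)
  obtain Q where Q: "length (eigvals P) = n" "sorted_wrt (\<ge>) (eigvals P)"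
    using spectral_eigvals[OF P(1)] by metis
  show "m \<le> n" unfolding lm[symmetric] Q(1)[symmetric] nz_def by (rule length_filter_le)
  show "nz_eigval P (j + 1) \<noteq> 0 \<and> -1 < nz_eigval P (j + 1) \<and> nz_eigval P (j + 1) \<le> B" if "j < m" for j
  proof -
    have "nz ! j \<in> set nz" using that lm by simp
    then have 0: "nz ! j \<noteq> 0" and "nz ! j \<in> set (eigvals P)" by (auto simp: nz_def)
    then obtain k where k: "k < n" "eigvals P ! k = nz ! j" using Q(1) by (metis in_set_conv_nth)
    obtain x where x: "x \<in> fspace n" "norm x = 1" "mop P x = (nz ! j) *\<^sub>R x"
      using eigvals_unit_eigenvector[OF P(1) k(1)] unfolding k(2) .
    then have "x \<noteq> 0" by auto
    then obtain v where "eigenvector P v (of_real (nz ! j))"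
      using eigenvector_of_mop[OF Pc x(1) _ x(3)] by blast
    then have "-1 < nz ! j" using gt by (auto simp: eigenvalue_def)
    moreover have "nz ! j \<le> B" using abs_eigvals_le_opnorm[OF P(1) k(1)] P(3) k(2) by simp
    ultimately show ?thesis unfolding \<theta> using 0 by simp
  qed
  show "nz_eigval P (j + 1) \<le> nz_eigval P (i + 1)" if "i \<le> j" "j < m" for i j
  proof -
    have "sorted_wrt (\<ge>) nz" unfolding nz_def by (rule sorted_wrt_filter[OF Q(2)])
    then show ?thesis unfolding \<theta> using that lm by (cases "i = j") (auto simp: sorted_wrt_iff_nth_less)
  qed
qed

definition spread :: "real \<Rightarrow> real \<Rightarrow> real" where
  "spread \<delta> B = 1 + B + B\<^sup>2 + (1 + B) / (2 * \<delta>) + 1 / (2 * \<delta>)"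

text \<open>The numerator is the square of the ratio between the accuracy used for the compressions
  and the final \<epsilon>. The denominator is the \<open>256 * c\<^sup>2\<close> of the
  concentration bound, with weights bounded by \<open>c = K\<^sup>2\<close>.\<close>

definition rate :: "real \<Rightarrow> real \<Rightarrow> real" where
  "rate \<delta> B = (1 / (2 * spread \<delta> B * (1 + \<delta>)))\<^sup>2 / (256 * spread \<delta> B ^ 4)"

lemma spread_ge_one: "0 < \<delta> \<Longrightarrow> 0 < B \<Longrightarrow> 1 \<le> spread \<delta> B"
  by (simp add: spread_def)

text \<open>Two concentration events, for the weights \<open>1 / (z - ls k)\<close> and their
  squares, reduce everything to the deterministic estimates. They are fixed before the eigenvector
  is chosen, so every unit eigenvector of a multiple eigenvalue is covered.\<close>

lemma outlier_eigenvector_haar: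
  fixes H P V :: "'a::rc_field mat"
  assumes \<delta>: "0 < \<delta>" and B: "0 < B" and dim: "DIM('a) \<le> 2" and n: "1 \<le> n"
    and adm: "admissible B n m H P" and V: "nz_eigenbasis n m P V" and h: "haar n \<mu>"
    and i: "1 \<le> i" "i \<le> m" and sep: "separated \<delta> H (nz_eigval P i)" and \<epsilon>: "0 < \<epsilon>" "\<epsilon> \<le> \<delta>"
  shows "let \<theta> = nz_eigval P i; z = T_inverse H (1 / \<theta>) in
    \<exists>E\<in>sets \<mu>.
      measure \<mu> E \<ge> 1 - 4 * exp (- rate \<delta> B * real n * \<epsilon>\<^sup>2 + 36 * real m) \<and>
      (\<forall>U\<in>E. \<forall>v. eigenvector (W_mat H P U) v (of_real (outlier m H P U i)) \<longrightarrow> vnorm v = 1 \<longrightarrow>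
        (let v' = mat_adjoint V *\<^sub>v v in
         \<bar>(vnorm v')\<^sup>2 + (\<theta> + 1) / (\<theta>\<^sup>2 * z * deriv (T_transform H) z)\<bar> \<le> \<epsilon> * (16 * spread \<delta> B ^ 11) \<and>
         vnorm (nz_diag m P *\<^sub>v v' - of_real \<theta> \<cdot>\<^sub>v v') \<le> \<epsilon> * (16 * spread \<delta> B ^ 11)))"
proof -
  define t where "t = nz_eigval P i"
  define z where "z = T_inverse H (1 / t)"
  interpret prob_space \<mu> using h by (simp add: haar_def)
  have n0: "0 < n" using n by simp
  have H: "psd n H" "H \<noteq> 0\<^sub>m n n" "opnorm H \<le> B" and P: "hermitian n P" "vec_space.rank n P = m" "opnorm P \<le> B"
    "\<forall>x. eigenvalue P (of_real x) \<longrightarrow> -1 < x"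
    using adm by (auto simp: admissible_def)
  have Hh: "hermitian n H" using H(1) by (simp add: psd_def)
  have Hc: "H \<in> carrier_mat n n" and Pc: "P \<in> carrier_mat n n" using Hh P(1) by (auto simp: hermitian_def)
  have Vc: "V \<in> carrier_mat n m" and VV: "mat_adjoint V * V = 1\<^sub>m m" using V by (auto simp: nz_eigenbasis_def)
  define ls where "ls k = eigvals H ! k" for k
  define \<theta> where "\<theta> j = nz_eigval P (j + 1)" for j
  define i0 where "i0 = i - 1"
  have i0: "i0 < m" "t = \<theta> i0" using i by (auto simp: i0_def t_def \<theta>_def)
  note \<theta>_facts = nz_eigval_facts[OF P, folded \<theta>_def]
  have t: "t \<noteq> 0" "-1 < t" "t \<le> B" using \<theta>_facts(2)[OF i0(1)] i0(2) by auto
  have sep': "separated \<delta> H t" using sep by (simp add: t_def)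
  note Tz = T_inverse_solves[OF H(1,2) n0 t(1) sep', folded z_def ls_def]
  have spec: "nonneg_spectrum n ls" unfolding ls_def by (rule admissible_nonneg_spectrum[OF H(1,2) n0])
  have lsB: "\<forall>k<n. ls k \<le> B"
    using abs_eigvals_le_opnorm[OF Hh] H(3) by (fastforce simp: ls_def)
  define K where "K = spread \<delta> B"
  define g where "g = (\<Sum>k<n. 1 / (z - ls k)) / n"
  define g2 where "g2 = (\<Sum>k<n. (1 / (z - ls k))\<^sup>2) / n"
  define \<sigma> where "\<sigma> = (if 0 < t then 1 else -1 :: real)"
  note sc = outlier_scalars[OF spec \<delta> B lsB t Tz(1-3), folded g_def g2_def \<sigma>_def spread_def, folded K_def]
  have zout: "z < ls (n - 1) \<or> ls 0 < z" using Tz(2,3) t(1) \<delta> by (cases "0 < t") auto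
  \<comment> \<open>The factor ensures \<open>2 * K * \<epsilon>' \<le> 1\<close> for all
    \<open>\<epsilon> \<le> \<delta>\<close>, as the deterministic estimates require, while keeping
    the accuracy proportional to \<epsilon>.\<close>
  define \<epsilon>' where "\<epsilon>' = 1 / (2 * K * (1 + \<delta>)) * \<epsilon>"
  have K1: "1 \<le> K" by (rule sc(1))
  have Kpow: "K ^ a \<le> K ^ b" if "a \<le> b" for a b using power_increasing[OF that K1] .
  have \<epsilon>'0: "0 < \<epsilon>'" using \<epsilon> K1 \<delta> by (simp add: \<epsilon>'_def)
  have "2 * K * \<epsilon>' = \<epsilon> / (1 + \<delta>)" using K1 by (simp add: \<epsilon>'_def)
  also have "\<dots> \<le> 1" using \<epsilon> \<delta> by simp
  finally have \<epsilon>'K: "2 * K * \<epsilon>' \<le> 1" .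
  have \<epsilon>'1: "\<epsilon>' \<le> 1"
  proof -
    have "1 * \<epsilon>' \<le> 2 * K * \<epsilon>'" using K1 \<epsilon>'0 by (intro mult_right_mono) auto
    then show ?thesis using \<epsilon>'K by simp
  qed
  have \<epsilon>'\<epsilon>: "\<epsilon>' \<le> \<epsilon>"
  proof -
    have "1 * 1 \<le> (2 * K) * (1 + \<delta>)" using K1 \<delta> by (intro mult_mono) auto
    then have "1 / (2 * K * (1 + \<delta>)) \<le> 1" by simp
    then have "1 / (2 * K * (1 + \<delta>)) * \<epsilon> \<le> 1 * \<epsilon>" using \<epsilon> by (intro mult_right_mono) auto
    then show ?thesis by (simp add: \<epsilon>'_def)
  qed
  obtain Q where Q: "Q \<in> unitary_group n" "H = Q * mat_diag n (\<lambda>k. of_real (ls k)) * mat_adjoint Q"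
    using spectral_eigvals[OF Hh] unfolding ls_def by metis
  have Q': "mat_adjoint Q \<in> unitary_group n" by (rule unitary_group_adjoint[OF Q(1)])
  \<comment> \<open>Both families of weights get the common bound \<open>K\<^sup>2\<close>, so that
    both events have the same exponent \<open>w\<close>.\<close>
  have f1: "\<bar>1 / (z - ls k)\<bar> \<le> K\<^sup>2" "\<bar>(1 / (z - ls k))\<^sup>2\<bar> \<le> K\<^sup>2" if k: "k < n" for k
  proof -
    have "0 < \<bar>z - ls k\<bar>" using sc(5)[OF k] by auto
    then have a: "\<bar>1 / (z - ls k)\<bar> \<le> K" using sc(4)[OF k] by (simp add: divide_le_eq)
    then show "\<bar>1 / (z - ls k)\<bar> \<le> K\<^sup>2" using Kpow[of 1 2] by simp
    have "\<bar>1 / (z - ls k)\<bar>\<^sup>2 \<le> K\<^sup>2" using a by (intro power_mono) auto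
    then show "\<bar>(1 / (z - ls k))\<^sup>2\<bar> \<le> K\<^sup>2" by (simp only: power2_abs abs_power2)
  qed
  have e4: "\<epsilon>' \<le> 4 * K\<^sup>2" using \<epsilon>'1 Kpow[of 0 2] by simp
  define w where "w = 18 * real (m * DIM('a)) - real n * \<epsilon>'\<^sup>2 / (256 * (K\<^sup>2)\<^sup>2)"
  obtain E1 where E1: "E1 \<in> sets \<mu>" "measure \<mu> E1 \<ge> 1 - 2 * exp w"
    "\<And>U x. U \<in> E1 \<Longrightarrow> x \<in> fspace m \<Longrightarrow>
      \<bar>(\<Sum>k<n. 1 / (z - ls k) * (norm (coord (mop (mat_adjoint Q * U) (mop V x)) k))\<^sup>2) - g * (norm x)\<^sup>2\<bar> \<le> \<epsilon>' * (norm x)\<^sup>2"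
    by (rule haar_compression_event[where f = "\<lambda>k. 1 / (z - ls k)", OF h n0 Q' Vc VV _ \<epsilon>'0 e4, folded g_def w_def])
      (erule f1(1), rule that)
  obtain E2 where E2: "E2 \<in> sets \<mu>" "measure \<mu> E2 \<ge> 1 - 2 * exp w"
    "\<And>U x. U \<in> E2 \<Longrightarrow> x \<in> fspace m \<Longrightarrow>
      \<bar>(\<Sum>k<n. (1 / (z - ls k))\<^sup>2 * (norm (coord (mop (mat_adjoint Q * U) (mop V x)) k))\<^sup>2) - g2 * (norm x)\<^sup>2\<bar> \<le> \<epsilon>' * (norm x)\<^sup>2"
    by (rule haar_compression_event[where f = "\<lambda>k. (1 / (z - ls k))\<^sup>2", OF h n0 Q' Vc VV _ \<epsilon>'0 e4, folded g2_def w_def])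
      (erule f1(2), rule that)
  have "w = - rate \<delta> B * real n * \<epsilon>\<^sup>2 + 18 * real DIM('a) * real m"
    by (simp add: w_def rate_def \<epsilon>'_def K_def power_mult_distrib power_divide)
  moreover have "18 * real DIM('a) * real m \<le> 36 * real m" using dim by (intro mult_right_mono) auto
  ultimately have w: "w \<le> - rate \<delta> B * real n * \<epsilon>\<^sup>2 + 36 * real m" by linarith
  have meas: "measure \<mu> (E1 \<inter> E2) \<ge> 1 - 4 * exp w"
  proof -
    have "space \<mu> - (E1 \<inter> E2) = (space \<mu> - E1) \<union> (space \<mu> - E2)" by auto
    then have "measure \<mu> (space \<mu> - (E1 \<inter> E2)) \<le> measure \<mu> (space \<mu> - E1) + measure \<mu> (space \<mu> - E2)"
      using measure_Un_le[of "space \<mu> - E1" \<mu> "space \<mu> - E2"] E1(1) E2(1) by simp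
    then show ?thesis using prob_compl[OF E1(1)] prob_compl[OF E2(1)] prob_compl[of "E1 \<inter> E2"] E1 E2 by simp
  qed
  have PV: "P = V * (mat_diag m (\<lambda>j. of_real (\<theta> j)) * mat_adjoint V)"
    using nz_eigenbasis_decomposition[OF P(1,2) V] by (simp add: \<theta>_def)
  have estimate: "\<bar>(vnorm (mat_adjoint V *\<^sub>v v))\<^sup>2 + (t + 1) / (t\<^sup>2 * z * deriv (T_transform H) z)\<bar> \<le> \<epsilon> * (16 * K ^ 11) \<and>
      vnorm (nz_diag m P *\<^sub>v (mat_adjoint V *\<^sub>v v) - of_real t \<cdot>\<^sub>v (mat_adjoint V *\<^sub>v v)) \<le> \<epsilon> * (16 * K ^ 11)"
    if U: "U \<in> E1 \<inter> E2" and ev: "eigenvector (W_mat H P U) v (of_real (outlier m H P U i))"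
      and nv: "vnorm v = 1" for U v
  proof -
    have "U \<in> space \<mu>" using U E1(1) sets.sets_into_space by blast
    then have Ug: "U \<in> unitary_group n" by (simp add: haar_space[OF h])
    note Uc = unitary_groupD[OF Ug] and Qc = unitary_groupD[OF Q(1)]
    define Y where "Y = mat_adjoint Q * U"
    interpret spiked_estimate n m Y V ls \<theta> z g g2 "z - 1 / g" \<epsilon>' K \<sigma>
    proof
      show "Y \<in> unitary_group n" unfolding Y_def by (rule unitary_group_mult[OF Q' Ug])
      show "V \<in> carrier_mat n m" "mat_adjoint V * V = 1\<^sub>m m" by (fact Vc VV)+
      show "-1 < \<theta> j" if "j < m" for j using \<theta>_facts(2)[OF that] by simp
      show "1 \<le> K" by (fact K1)
      show "1 + \<theta> j \<le> K" if "j < m" for j using \<theta>_facts(2)[OF that] sc(2) by simp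
      show "\<bar>z - ls k\<bar> \<le> K" "1 \<le> K * \<bar>z - ls k\<bar>" "0 < \<sigma> * (z - ls k)" if "k < n" for k
        using sc(3-5)[OF that] by auto
      show "\<sigma> = 1 \<or> \<sigma> = -1" by (simp add: \<sigma>_def)
      show "\<bar>z\<bar> \<le> K" "1 \<le> K * \<bar>g\<bar>" "1 \<le> K * (z - 1 / g)" by (fact sc)+
      show "z - 1 / g = z - 1 / g" ..
      show "0 \<le> \<epsilon>'" "2 * K * \<epsilon>' \<le> 1" using \<epsilon>'0 \<epsilon>'K by auto
      show "\<bar>(\<Sum>k<n. 1 / (z - ls k) * (norm (coord (mop Y (mop V x)) k))\<^sup>2) - g * (norm x)\<^sup>2\<bar> \<le> \<epsilon>' * (norm x)\<^sup>2"
        if "x \<in> fspace m" for x using E1(3)[OF _ that, of U] U by (simp add: Y_def)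
      show "\<bar>(\<Sum>k<n. (1 / (z - ls k))\<^sup>2 * (norm (coord (mop Y (mop V x)) k))\<^sup>2) - g2 * (norm x)\<^sup>2\<bar> \<le> \<epsilon>' * (norm x)\<^sup>2"
        if "x \<in> fspace m" for x using E2(3)[OF _ that, of U] U by (simp add: Y_def)
    qed
    define W where "W = W_mat H P U"
    have dimP: "dim_row P = n" using Pc by simp
    have R: "mat_sqrt (1\<^sub>m (dim_row P) + P) = bump root" unfolding dimP by (rule mat_sqrt_bump[OF PV])
    note Rc = bump_carrier[of root]
    have U': "mat_adjoint U \<in> carrier_mat n n" using Uc by simp
    note c1 = mult_carrier_mat[OF Rc U']
    note c2 = mult_carrier_mat[OF c1 Hc]
    note c3 = mult_carrier_mat[OF c2 Uc(1)]
    have Weq: "W = bump root * mat_adjoint U * H * U * bump root"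
      by (simp add: W_def W_mat_def R Let_def)
    have Wc: "W \<in> carrier_mat n n" unfolding Weq by (rule mult_carrier_mat[OF c3 Rc])
    \<comment> \<open>With \<open>H\<close> diagonalised by \<open>Q\<close>, the abstract
      \<open>fc ls\<close> is the conjugate of \<open>H\<close> by \<open>U\<close>. This identifies
      \<open>W_mat\<close> with the operator \<open>Wop\<close> of the deterministic model.\<close>
    have fcls: "mop (fc ls) y = mop (mat_adjoint U) (mop H (mop U y))" for y
    proof -
      have Ya: "mat_adjoint Y = mat_adjoint U * Q"
        unfolding Y_def by (simp add: mat_adjoint_mult[OF mat_adjoint_carrier[OF Qc(1)] Uc(1)])
      show ?thesis
        unfolding mop_fc Ya mop_mult[OF U' Qc(1)] mop_spectral[OF Q]
        unfolding Y_def mop_mult[OF mat_adjoint_carrier[OF Qc(1)] Uc(1)] ..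
    qed
    have WW: "mop W x = Wop x" for x
      unfolding Weq mop_mult[OF c3 Rc] mop_mult[OF c2 Uc(1)] mop_mult[OF c1 Hc] mop_mult[OF Rc U'] Wop_def fcls ..
    have Wh: "hermitian n W"
      by (rule hermitian_mopI[OF Wc]) (simp add: WW Wop_def bump_sym fc_sym)
    obtain Z where Z: "Z \<in> unitary_group n" "length (eigvals W) = n" "sorted_wrt (\<ge>) (eigvals W)"
      "W = Z * mat_diag n (\<lambda>k. of_real (eigvals W ! k)) * mat_adjoint Z"
      using spectral_eigvals[OF Wh] by metis
    \<comment> \<open>List positions start at 0 while eigenvalues are counted from 1, so
      \<open>i0 = i - 1\<close> replaces \<open>i\<close> in both cases of
      \<open>outlier\<close>.\<close>
    define p where "p = (if \<sigma> = 1 then i0 else n - m + i0)"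
    have loc: "\<bar>eigvals W ! p - z\<bar> \<le> 2 * \<epsilon>' * K ^ 3"
    proof (rule outlier_location[OF unitary_group_adjoint[OF Z(1)] _ _ \<theta>_facts(3) i0(1) _ \<theta>_facts(1) p_def])
      show "Wop v = mop (mat_adjoint (mat_adjoint Z)) (fdiag n (\<lambda>k. eigvals W ! k) (mop (mat_adjoint Z) v))" for v
        using mop_spectral[OF Z(1,4), of v] by (simp add: WW)
      show "eigvals W ! j \<le> eigvals W ! k" if "k \<le> j" "j < n" for k j
        using Z(2,3) that by (cases "k = j") (auto simp: sorted_wrt_iff_nth_less)
      show "(z - 1 / g) * (1 + \<theta> i0) = z" using sc(9) i0(2) by simp
    qed auto
    have outl: "outlier m H P U i = eigvals W ! p"
    proof -
      have "n - m + i - 1 = n - m + i0" "i - 1 = i0" using i by (auto simp: i0_def)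
      then show ?thesis
        by (auto simp: outlier_def eigval_def p_def \<sigma>_def t_def[symmetric] W_def dimP)
    qed
    define x where "x = emb v"
    have x: "v \<in> carrier_vec n" "x \<in> fspace n" "mop W x = (eigvals W ! p) *\<^sub>R x"
      using eigenvector_emb[OF Wc, of v "eigvals W ! p"] ev outl by (auto simp: W_def x_def)
    have nx: "norm x = 1" using nv by (simp add: x_def norm_emb)
    define vt where "vt = Vs x"
    have Wx: "Wop x = (eigvals W ! p) *\<^sub>R x" using x(3) by (simp add: WW)
    have st: "(z - 1 / g) * (1 + t) = z" by (fact sc)
    note est = outlier_eigenvector[OF x(2) nx Wx loc st t(2) sc(10,11)]
    define v' where "v' = mat_adjoint V *\<^sub>v v"
    have v': "v' \<in> carrier_vec m" "emb v' = vt"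
      using x(1) Vadj by (auto simp: v'_def vt_def x_def mop_emb[OF Vadj])
    have D: "nz_diag m P \<in> carrier_mat m m" by (simp add: nz_diag_def)
    have nzd: "emb (nz_diag m P *\<^sub>v v' - of_real t \<cdot>\<^sub>v v') = fdiag m \<theta> vt - t *\<^sub>R vt"
    proof -
      have "emb (nz_diag m P *\<^sub>v v') = mop (nz_diag m P) vt" using mop_emb[OF D v'(1)] v'(2) by simp
      also have "\<dots> = fdiag m \<theta> vt" unfolding nz_diag_def \<theta>_def[symmetric] by (rule mop_mat_diag_of_real)
      finally show ?thesis using D v' by (simp add: emb_minus[of _ m] emb_smult)
    qed
    have small: "5 * K ^ 7 * \<epsilon>' \<le> \<epsilon> * (16 * K ^ 11)" "16 * K ^ 11 * \<epsilon>' \<le> \<epsilon> * (16 * K ^ 11)"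
    proof -
      have "5 * K ^ 7 * \<epsilon>' \<le> 16 * K ^ 11 * \<epsilon>"
        using Kpow[of 7 11] \<epsilon>'\<epsilon> \<epsilon>'0 K1 by (intro mult_mono) auto
      then show "5 * K ^ 7 * \<epsilon>' \<le> \<epsilon> * (16 * K ^ 11)" by (simp add: mult.commute)
      have "16 * K ^ 11 * \<epsilon>' \<le> 16 * K ^ 11 * \<epsilon>" using \<epsilon>'\<epsilon> K1 by (intro mult_left_mono) auto
      then show "16 * K ^ 11 * \<epsilon>' \<le> \<epsilon> * (16 * K ^ 11)" by (simp add: mult.commute)
    qed
    have "\<bar>(vnorm v')\<^sup>2 + (t + 1) / (t\<^sup>2 * z * deriv (T_transform H) z)\<bar> \<le> \<epsilon> * (16 * K ^ 11)"
      unfolding Tz(4)[OF zout] sc(12)[symmetric] norm_emb[symmetric] v'(2) vt_def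
      using order_trans[OF est(2) small(2)] by simp
    moreover have "vnorm (nz_diag m P *\<^sub>v v' - of_real t \<cdot>\<^sub>v v') \<le> \<epsilon> * (16 * K ^ 11)"
      unfolding norm_emb[symmetric] nzd vt_def by (rule order_trans[OF est(1) small(1)])
    ultimately show ?thesis by (simp only: v'_def)
  qed
  show ?thesis
    unfolding Let_def t_def[symmetric] z_def[symmetric] K_def[symmetric]
  proof (rule bexI[of _ "E1 \<inter> E2"], rule conjI)
    show "E1 \<inter> E2 \<in> sets \<mu>" using E1 E2 by simp
    have "exp w \<le> exp (- rate \<delta> B * real n * \<epsilon>\<^sup>2 + 36 * real m)" using w by simp
    then show "1 - 4 * exp (- rate \<delta> B * real n * \<epsilon>\<^sup>2 + 36 * real m) \<le> measure \<mu> (E1 \<inter> E2)"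
      using meas by linarith
  qed (use estimate in blast)
qed

theorem theorem3p2:
  fixes \<delta> B :: real
  assumes "\<delta> > 0" and "B > 0"
  shows "\<exists>c\<^sub>1>0. \<exists>c\<^sub>2>0. \<exists>C>0. \<exists>C\<^sub>B\<^sub>\<delta>>0.
    \<forall>M :: nat \<Rightarrow> nat. (\<lambda>N. real (M N)) \<in> o(\<lambda>N. real N) \<longrightarrow>
    (\<forall>N\<ge>1.
      (\<forall>(H :: real mat) P V \<mu> i \<epsilon>.
        admissible B N (M N) H P \<longrightarrow> nz_eigenbasis N (M N) P V \<longrightarrow> haar N \<mu> \<longrightarrow>
        1 \<le> i \<longrightarrow> i \<le> M N \<longrightarrow> separated \<delta> H (nz_eigval P i) \<longrightarrow> 0 < \<epsilon> \<longrightarrow> \<epsilon> \<le> \<delta> \<longrightarrow>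
        (let \<theta> = nz_eigval P i; z = T_inverse H (1 / \<theta>) in
         \<exists>E\<in>sets \<mu>.
           measure \<mu> E \<ge> 1 - C * exp (- c\<^sub>1 * real N * \<epsilon>\<^sup>2 + c\<^sub>2 * real (M N)) \<and>
           (\<forall>U\<in>E. \<forall>v.
             eigenvector (W_mat H P U) v (of_real (outlier (M N) H P U i)) \<longrightarrow> vnorm v = 1 \<longrightarrow>
             (let v' = mat_adjoint V *\<^sub>v v in
              \<bar>(vnorm v')\<^sup>2 + (\<theta> + 1) / (\<theta>\<^sup>2 * z * deriv (T_transform H) z)\<bar> \<le> \<epsilon> * C\<^sub>B\<^sub>\<delta> \<and>
              vnorm (nz_diag (M N) P *\<^sub>v v' - of_real \<theta> \<cdot>\<^sub>v v') \<le> \<epsilon> * C\<^sub>B\<^sub>\<delta>)))) \<and>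
      (\<forall>(H :: complex mat) P V \<mu> i \<epsilon>.
        admissible B N (M N) H P \<longrightarrow> nz_eigenbasis N (M N) P V \<longrightarrow> haar N \<mu> \<longrightarrow>
        1 \<le> i \<longrightarrow> i \<le> M N \<longrightarrow> separated \<delta> H (nz_eigval P i) \<longrightarrow> 0 < \<epsilon> \<longrightarrow> \<epsilon> \<le> \<delta> \<longrightarrow>
        (let \<theta> = nz_eigval P i; z = T_inverse H (1 / \<theta>) in
         \<exists>E\<in>sets \<mu>.
           measure \<mu> E \<ge> 1 - C * exp (- c\<^sub>1 * real N * \<epsilon>\<^sup>2 + c\<^sub>2 * real (M N)) \<and>
           (\<forall>U\<in>E. \<forall>v.
             eigenvector (W_mat H P U) v (of_real (outlier (M N) H P U i)) \<longrightarrow> vnorm v = 1 \<longrightarrow>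
             (let v' = mat_adjoint V *\<^sub>v v in
              \<bar>(vnorm v')\<^sup>2 + (\<theta> + 1) / (\<theta>\<^sup>2 * z * deriv (T_transform H) z)\<bar> \<le> \<epsilon> * C\<^sub>B\<^sub>\<delta> \<and>
              vnorm (nz_diag (M N) P *\<^sub>v v' - of_real \<theta> \<cdot>\<^sub>v v') \<le> \<epsilon> * C\<^sub>B\<^sub>\<delta>)))))"
proof -
  define C where "C = 16 * spread \<delta> B ^ 11"
  define c where "c = rate \<delta> B"
  have K: "1 \<le> spread \<delta> B" by (rule spread_ge_one[OF assms])
  have C: "C > 0" using K by (simp add: C_def)
  have c: "c > 0" using K assms by (simp add: c_def rate_def)
  \<comment> \<open>One statement serves both scalar fields with the same constants:
    \<open>36\<close> is \<open>18\<close> times the largest real dimension of the scalars, and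
    \<open>4\<close> counts two events with two tails each.\<close>
  note main = outlier_eigenvector_haar[OF assms, folded C_def c_def]
  show ?thesis
  proof (rule exI[of _ c], rule conjI[OF c], rule exI[of _ 36], rule conjI, simp,
      rule exI[of _ 4], rule conjI, simp, rule exI[of _ C], rule conjI[OF C], intro allI impI conjI, goal_cases)
    case (1 M N H P V \<mu> i \<epsilon>)
    then show ?case by (intro main) simp_all
  next
    case (2 M N H P V \<mu> i \<epsilon>)
    then show ?case by (intro main) simp_all
  qed
qed

end
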